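(* Let $(\vartheta_0,D_6,D_5)$ be one of the triples $(0.924,4,6)$, $(0.739,6,8)$, $(0.643,6,12)$, $(0.584,10,16)$, $(0.544,12,20)$, $(0.516,14,26)$, and suppose some $\vartheta>\vartheta_0$ satisfies both conditions (A) and (B) below. Then at least one of the following holds: (i) there exist absolute constants $C$, $c>0$, an odd integer $b\le C$ and an even integer $d$ with $0<|d|\le D_6$ such that $P^-(p+d)>p^c$ and $\Omega(p+d)=b$ for infinitely many primes $p$; (ii) $\liminf_{n\to\infty}(p_{n+1}-p_n)\le D_5$.
   Context: $p_n$ is the $n$-th prime; $P^-(n)$ is the smallest prime factor of $n$; $\Omega(n)$ is the number of prime factors of $n$ counted with multiplicity and $\lambda(n)=(-1)^{\Omega(n)}$. Condition (A): for every $\varepsilon>0$, $A>0$, $\sum_{q\le N^{\vartheta-\varepsilon}}\max_{a:(a,q)=1}\bigl|\sum_{p\le N,\,p\equiv a\ (\mathrm{mod}\ q)}\log p-\frac{N}{\varphi(q)}\bigr|\ll_{\varepsilon,A}\frac{N}{(\log N)^A}$ ($p$ over primes). Condition (B): for every $\varepsilon>0$, $A>0$, $\sum_{q\le N^{\vartheta-\varepsilon}}\max_{y\le N}\max_a\bigl|\sum_{n\le y,\,n\equiv a\ (\mathrm{mod}\ q)}\lambda(n)\bigr|\ll_{\varepsilon,A}\frac{N}{(\log N)^A}$. *)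

theory Defs
  imports "HOL-Analysis.Analysis" "HOL-Number_Theory.Number_Theory" "HOL-Library.Infinite_Set"
begin

text \<open>p_n: the n-th prime (indexed from 0; the indexing is irrelevant for a liminf).\<close>
definition nth_prime :: "nat \<Rightarrow> nat" where
  "nth_prime n = enumerate {p. prime p} n"

definition bigOmega :: "nat \<Rightarrow> nat" where
  "bigOmega n = size (prime_factorization n)"

text \<open>Smallest prime factor P^-(n) (meaningful for n > 1).\<close>
definition least_pf :: "nat \<Rightarrow> nat" where
  "least_pf n = Min (prime_factors n)"

definition liouville :: "nat \<Rightarrow> real" where
  "liouville n = (-1) ^ bigOmega n"

definition theta_ap :: "real \<Rightarrow> nat \<Rightarrow> nat \<Rightarrow> real" where
  "theta_ap N q a = (\<Sum>p\<in>{p. prime p \<and> real p \<le> N \<and> [p = a] (mod q)}. ln (real p))"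

definition condA :: "real \<Rightarrow> bool" where
  "condA \<theta> \<longleftrightarrow> (\<forall>\<epsilon>>0. \<forall>A>0. \<exists>K. \<forall>N::real. N \<ge> 2 \<longrightarrow>
     (\<Sum>q\<in>{q::nat. 1 \<le> q \<and> real q \<le> N powr (\<theta> - \<epsilon>)}.
        Max ((\<lambda>a. \<bar>theta_ap N q a - N / real (totient q)\<bar>) ` {a. a < q \<and> coprime a q}))
     \<le> K * N / (ln N) powr A)"

text \<open>Condition (B) (level of distribution theta for the Liouville function);
  y ranges over reals y <= N, equivalently over integers 0 <= m <= N.\<close>
definition condB :: "real \<Rightarrow> bool" where
  "condB \<theta> \<longleftrightarrow> (\<forall>\<epsilon>>0. \<forall>A>0. \<exists>K. \<forall>N::real. N \<ge> 2 \<longrightarrow>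
     (\<Sum>q\<in>{q::nat. 1 \<le> q \<and> real q \<le> N powr (\<theta> - \<epsilon>)}.
        Max ((\<lambda>(m, a). \<bar>\<Sum>n\<in>{n. 1 \<le> n \<and> n \<le> m \<and> [n = a] (mod q)}. liouville n\<bar>)
             ` ({0..nat \<lfloor>N\<rfloor>} \<times> {..<q})))
     \<le> K * N / (ln N) powr A)"

end

theory Submission
  imports Defs
begin

text \<open>
  The tuple is split into a centre \<open>c\<close> and the remaining shifts \<open>Hs\<close>, \<open>K\<close> in number, all within \<open>D6\<close> of \<open>c\<close>.
  If both alternatives fail, then for large \<open>n\<close> at most one \<open>n + h\<close> with \<open>h \<in> Hs\<close> is prime, and if one is and
  \<open>n + c\<close> has no prime factor below \<open>n\<^sup>\<zeta>\<close>, then \<open>\<lambda>(n + c) = 1\<close>. For every weight \<open>w \<ge> 0\<close> this gives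
  \<open>\<Sum> w(n) #{h. n + h prime} \<le> \<Sum> w(n) (1 + \<lambda>(n + c)) / 2 + \<Sum> w(n) [n + c has a small prime factor]\<close>.

  The weight is the square of a Selberg sieve function of level \<open>R = N\<close> to the power \<open>\<theta>0/2\<close> on the forms
  \<open>n + h\<close>, and of tiny level \<open>D\<close> on \<open>n + c\<close>. Written in a basis of products of local functions which is
  orthogonal for the uniform density, its sum over \<open>n\<close> is an exact diagonal form \<open>M0\<close>; the condition that
  \<open>n + h\<close> is prime changes the local density, and an affine change of the local functions diagonalises that
  form as well, giving \<open>M1\<close>. Condition (B) makes the Liouville sum negligible, so the first term on the
  right is half the total mass, and the logarithmic cutoff at \<open>D\<close> makes the last term small.

  Both diagonal forms are compared with one and the same sum by elementary inequalities; no asymptotic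
  formula is needed. The resulting ratio is \<open>3K/(K+3) \<cdot> \<theta>0/2\<close>, which exceeds \<open>1/2\<close> for all six triples.
\<close>

section \<open>Sums over subsets of a finite set\<close>

text \<open>The weight is of Goldston-Pintz-Yildirim type with one degree beyond the number of
  shifts. Heuristically, up to local factors, \<open>Y\<close> is the logarithm of R/pr S, and a
  K-dimensional sum of its square is about 2 (ln R)^(K+2)/(K+2)!. Passing to the density of primes
  integrates \<open>Y\<close> once, turning it into half a squared logarithm, and lowers the
  dimension to K-1: about 6 (ln R)^(K+3)/(K+3)!. The quotient is 3 ln R/(K+3); with K shifts and
  weight ln N for each prime this is the ratio of the overview. The threshold is 1/2 instead of 1
  because a sieve cannot see the parity of Omega(n + c), and condition (B) supplies exactly that
  information. Both forms carry Euler products over the primes of \<open>P\<close>; comparing them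
  with a single sum avoids evaluating these. Fixing n modulo the product Q of the primes up to d
  removes the small primes, and the local factors at p > d differ from their ideal values by amounts
  whose total is tiny. The margin is smallest for K = 7 and \<theta>0 = 0.516, where the ratio is
  0.5418; this dictates constants such as 2.98 and 0.538.\<close>

lemma sum_Pow_split:
  assumes "finite P"
  shows "(\<Sum>W\<in>Pow P. \<Sum>V\<in>Pow W. g V (W - V)) = (\<Sum>V\<in>Pow P. \<Sum>U\<in>Pow (P - V). g V U)"
proof -
  have "(\<Sum>W\<in>Pow P. \<Sum>V\<in>Pow W. g V (W - V)) = (\<Sum>(W,V)\<in>Sigma (Pow P) Pow. g V (W - V))"
    using assms finite_subset by (subst sum.Sigma) auto
  also have "\<dots> = (\<Sum>(V,U)\<in>Sigma (Pow P) (\<lambda>V. Pow (P - V)). g V U)"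
    by (rule sum.reindex_bij_witness[of _ "\<lambda>(V,U). (V \<union> U, V)" "\<lambda>(W,V). (V, W - V)"]) auto
  also have "\<dots> = (\<Sum>V\<in>Pow P. \<Sum>U\<in>Pow (P - V). g V U)"
    using assms by (subst sum.Sigma) auto
  finally show ?thesis .
qed

lemma sum_Pow_swap:
  assumes "finite P"
  shows "(\<Sum>S\<in>Pow P. \<Sum>T\<in>Pow (P - S). g S T) = (\<Sum>T\<in>Pow P. \<Sum>S\<in>Pow (P - T). g S T)"
proof -
  have "(\<Sum>S\<in>Pow P. \<Sum>T\<in>Pow (P - S). g S T) = (\<Sum>(S,T)\<in>Sigma (Pow P) (\<lambda>V. Pow (P - V)). g S T)"
    using assms by (subst sum.Sigma) auto
  also have "\<dots> = (\<Sum>(T,S)\<in>Sigma (Pow P) (\<lambda>V. Pow (P - V)). g S T)"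
    by (rule sum.reindex_bij_witness[of _ "\<lambda>(V,U). (U, V)" "\<lambda>(V,U). (U, V)"]) auto
  also have "\<dots> = (\<Sum>T\<in>Pow P. \<Sum>S\<in>Pow (P - T). g S T)"
    using assms by (subst sum.Sigma) auto
  finally show ?thesis .
qed

lemma sum_Pow_element:
  assumes "finite P"
  shows "(\<Sum>S\<in>Pow P. \<Sum>p\<in>S. g p S) = (\<Sum>p\<in>P. \<Sum>S\<in>Pow (P - {p}). g p (insert p S))"
proof -
  have "(\<Sum>S\<in>Pow P. \<Sum>p\<in>S. g p S) = (\<Sum>(S,p)\<in>Sigma (Pow P) (\<lambda>S. S). g p S)"
    using assms finite_subset by (subst sum.Sigma) auto
  also have "\<dots> = (\<Sum>(p,S)\<in>Sigma P (\<lambda>p. Pow (P - {p})). g p (insert p S))"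
    by (rule sum.reindex_bij_witness[of _ "\<lambda>(p,S). (insert p S, p)" "\<lambda>(S,p). (p, S - {p})"])
       (auto simp: insert_absorb)
  also have "\<dots> = (\<Sum>p\<in>P. \<Sum>S\<in>Pow (P - {p}). g p (insert p S))"
    using assms by (subst sum.Sigma) auto
  finally show ?thesis .
qed

lemma sum_Pow_prod:
  fixes f :: "'a \<Rightarrow> 'b::comm_semiring_1"
  assumes "finite A"
  shows "(\<Sum>S\<in>Pow A. prod f S) = (\<Prod>p\<in>A. 1 + f p)"
  using prod_add[OF assms, of f "\<lambda>_. 1"] by (simp add: add.commute)

text \<open>A squarefree number is encoded by its set of prime factors, and \<open>pr S\<close> is
  that number as a real: disjoint union is multiplication, inclusion is divisibility, and divisor
  sums become sums over \<open>Pow\<close>.\<close>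

definition pr :: "nat set \<Rightarrow> real" where
  "pr S = (\<Prod>p\<in>S. real p)"

lemma pr_eq: "pr S = real (\<Prod>S)"
  by (simp add: pr_def)

lemma pr_empty [simp]: "pr {} = 1"
  by (simp add: pr_def)

lemma pr_insert: "finite S \<Longrightarrow> p \<notin> S \<Longrightarrow> pr (insert p S) = real p * pr S"
  by (simp add: pr_def)

lemma pr_Un_disjoint: "finite S \<Longrightarrow> finite T \<Longrightarrow> S \<inter> T = {} \<Longrightarrow> pr (S \<union> T) = pr S * pr T"
  by (simp add: pr_def prod.union_disjoint)

lemma pr_ge_1: "(\<And>p. p \<in> S \<Longrightarrow> 1 \<le> p) \<Longrightarrow> 1 \<le> pr S"
  unfolding pr_def by (rule prod_ge_1) (simp add: Suc_le_eq)

lemma pr_mono: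
  assumes "finite T" "S \<subseteq> T" "\<And>p. p \<in> T \<Longrightarrow> 1 \<le> p"
  shows "pr S \<le> pr T"
proof -
  have "pr T = pr S * pr (T - S)"
    using assms pr_Un_disjoint[of S "T - S"] finite_subset[of S T]
    by (metis Diff_disjoint Un_Diff_cancel finite_Diff sup.absorb2)
  moreover have "1 \<le> pr (T - S)" "1 \<le> pr S"
    using assms by (auto intro!: pr_ge_1)
  ultimately show ?thesis by (simp add: mult_le_cancel_left1)
qed

lemma pr_Un_le:
  assumes "finite S" "finite T" "\<And>p. p \<in> S \<union> T \<Longrightarrow> 1 \<le> p"
  shows "pr (S \<union> T) \<le> pr S * pr T"
proof -
  have "pr (S \<union> T) = pr S * pr (T - S)"
    using pr_Un_disjoint[of S "T - S"] assms by auto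
  also have "\<dots> \<le> pr S * pr T"
    using assms pr_mono[of T "T - S"] pr_ge_1[of S] by (intro mult_left_mono) auto
  finally show ?thesis .
qed

lemma prime_factors_prod_primes:
  assumes "finite S" "\<And>p. p \<in> S \<Longrightarrow> prime (p::nat)"
  shows "prime_factors (\<Prod>S) = S"
proof -
  have "0 \<notin> S" using assms(2) not_prime_0 by blast
  then show ?thesis
    using assms by (subst prime_factors_prod) (auto simp: prime_factorization_prime)
qed

lemma inj_on_prod_primes:
  assumes "finite P" "\<And>p. p \<in> P \<Longrightarrow> prime (p::nat)"
  shows "inj_on (\<lambda>S. \<Prod>S) (Pow P)"
proof (rule inj_onI)
  fix S T assume "S \<in> Pow P" "T \<in> Pow P" "\<Prod>S = \<Prod>T"
  then show "S = T"
    using prime_factors_prod_primes[of S] prime_factors_prod_primes[of T] assms finite_subset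
    by (metis PowD subsetD)
qed

section \<open>Logarithmic weights\<close>

text \<open>Truncation at 0 builds support conditions such as \<open>pr S \<le> R\<close> into the
  weight, so that sums may run over all of \<open>Pow P\<close>.\<close>

definition lnp :: "real \<Rightarrow> real" where
  "lnp t = max 0 (ln t)"

lemma lnp_nonneg [simp]: "0 \<le> lnp t"
  by (simp add: lnp_def)

lemma lnp_eq_ln: "1 \<le> t \<Longrightarrow> lnp t = ln t"
  by (simp add: lnp_def)

lemma lnp_eq_0: "0 < t \<Longrightarrow> t \<le> 1 \<Longrightarrow> lnp t = 0"
  by (simp add: lnp_def)

lemma lnp_mono: "0 < s \<Longrightarrow> s \<le> t \<Longrightarrow> lnp s \<le> lnp t"
  unfolding lnp_def by (intro max.mono) auto

lemma sum_inverse_log_le: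
  assumes "1 \<le> x"
  shows "(\<Sum>n = 1..nat \<lfloor>x\<rfloor>. 1 / real n) \<le> 1 + ln x"
proof -
  define N where "N = nat \<lfloor>x\<rfloor>"
  have N: "1 \<le> N" "real N \<le> x"
    using assms by (auto simp: N_def le_nat_floor)
  have "harm n - ln (real n) \<le> 1" if "1 \<le> n" for n
    using decseq_harm_diff_ln[THEN decseqD, of 0 "n - 1"] that by (simp add: harm_def)
  from this[OF N(1)] have "harm N \<le> 1 + ln (real N)" by simp
  also have "ln (real N) \<le> ln x" using N by simp
  finally show ?thesis by (simp add: harm_def N_def inverse_eq_divide)
qed

text \<open>\<open>C ^ card W\<close> counts the ordered factorisations of the squarefree number
  \<open>pr W\<close> into \<open>C\<close> factors, each of which is at most \<open>x\<close>. The
  induction splits off one factor, and each factor contributes a harmonic sum.\<close>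

lemma sum_Pow_card_power_le:
  assumes "finite P" "\<And>p. p \<in> P \<Longrightarrow> prime p" "1 \<le> x"
  shows "(\<Sum>W\<in>{W\<in>Pow P. pr W \<le> x}. real C ^ card W / pr W) \<le> (1 + ln x) ^ C"
proof (induction C)
  case 0
  have "(\<Sum>W\<in>{W\<in>Pow P. pr W \<le> x}. real 0 ^ card W / pr W) = (\<Sum>W\<in>{W\<in>Pow P. pr W \<le> x}. if W = {} then 1 else 0)"
    using assms(1) by (intro sum.cong) (auto simp: card_eq_0_iff power_0_left dest: finite_subset)
  also have "\<dots> = 1" using assms by (subst sum.delta) auto
  finally show ?case by simp
next
  case (Suc C)
  let ?A = "{W\<in>Pow P. pr W \<le> x}"
  have p1: "1 \<le> p" if "p \<in> P" for p using assms(2)[OF that] prime_ge_1_nat by blast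
  have pr1: "1 \<le> pr W" if "W \<subseteq> P" for W using that p1 by (auto intro!: pr_ge_1)
  have pr0: "0 \<le> pr W" if "W \<subseteq> P" for W using pr1[OF that] by simp
  have "(\<Sum>U\<in>?A. 1 / pr U) = (\<Sum>n\<in>(\<lambda>S. \<Prod>S) ` ?A. 1 / real n)"
    by (subst sum.reindex) (auto simp: pr_eq intro: inj_on_subset[OF inj_on_prod_primes[OF assms(1,2)]])
  also have "\<dots> \<le> (\<Sum>n = 1..nat \<lfloor>x\<rfloor>. 1 / real n)"
  proof (rule sum_mono2)
    show "(\<lambda>S. \<Prod>S) ` ?A \<subseteq> {1..nat \<lfloor>x\<rfloor>}"
    proof clarsimp
      fix W assume W: "W \<subseteq> P" "pr W \<le> x"
      then show "Suc 0 \<le> \<Prod>W \<and> \<Prod>W \<le> nat \<lfloor>x\<rfloor>"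
        using pr1[OF W(1)] by (auto simp: pr_eq le_nat_floor simp del: of_nat_prod)
    qed
  qed auto
  also have "\<dots> \<le> 1 + ln x" by (rule sum_inverse_log_le) fact
  finally have base: "(\<Sum>U\<in>?A. 1 / pr U) \<le> 1 + ln x" .
  have expand: "real (Suc C) ^ card W / pr W * indicator {..x} (pr W)
        = (\<Sum>V\<in>Pow W. real C ^ card V / pr V * (1 / pr (W - V)) * indicator {..x} (pr W))"
    if "W \<in> Pow P" for W
  proof -
    have fW: "finite W" using that assms(1) finite_subset by auto
    have "real (Suc C) ^ card W = (\<Prod>p\<in>W. real C + 1)" by (simp add: add.commute)
    also have "\<dots> = (\<Sum>V\<in>Pow W. real C ^ card V)"
      by (subst prod_add[OF fW]) simp
    finally have "real (Suc C) ^ card W / pr W = (\<Sum>V\<in>Pow W. real C ^ card V / pr W)"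
      by (simp add: sum_divide_distrib)
    also have "\<dots> = (\<Sum>V\<in>Pow W. real C ^ card V / pr V * (1 / pr (W - V)))"
    proof (rule sum.cong)
      fix V assume "V \<in> Pow W"
      then have "pr W = pr V * pr (W - V)"
        using pr_Un_disjoint[of V "W - V"] fW finite_subset[of V W] by (auto simp: Un_absorb1)
      then show "real C ^ card V / pr W = real C ^ card V / pr V * (1 / pr (W - V))" by simp
    qed simp
    finally show ?thesis by (simp add: sum_distrib_right)
  qed
  have "(\<Sum>W\<in>?A. real (Suc C) ^ card W / pr W)
      = (\<Sum>W\<in>Pow P. real (Suc C) ^ card W / pr W * indicator {..x} (pr W))"
    using assms(1) by (intro sum.mono_neutral_cong_left) (auto simp: indicator_def)
  also have "\<dots> = (\<Sum>W\<in>Pow P. \<Sum>V\<in>Pow W. real C ^ card V / pr V * (1 / pr (W - V)) * indicator {..x} (pr (V \<union> (W - V))))"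
    by (intro sum.cong refl, subst expand) (auto intro!: sum.cong simp: Un_absorb1)
  also have "\<dots> = (\<Sum>V\<in>Pow P. \<Sum>U\<in>Pow (P - V). real C ^ card V / pr V * (1 / pr U) * indicator {..x} (pr (V \<union> U)))"
    by (rule sum_Pow_split[OF assms(1)])
  \<comment> \<open>Disjointness is dropped and the bound on the union is weakened to a bound on
    each part, so that the double sum becomes a product.\<close>
  also have "\<dots> \<le> (\<Sum>V\<in>Pow P. \<Sum>U\<in>Pow P. (real C ^ card V / pr V * indicator {..x} (pr V)) * (1 / pr U * indicator {..x} (pr U)))"
  proof (rule sum_mono, rule sum_le_included[where i = id])
    fix V assume V: "V \<in> Pow P"
    show "\<forall>U\<in>Pow (P - V). \<exists>U'\<in>Pow P. id U' = U \<and>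
        real C ^ card V / pr V * (1 / pr U) * indicator {..x} (pr (V \<union> U))
        \<le> real C ^ card V / pr V * indicator {..x} (pr V) * (1 / pr U' * indicator {..x} (pr U'))"
    proof clarsimp
      fix U assume U: "U \<subseteq> P - V"
      have f: "finite (V \<union> U)" using U V assms(1) finite_subset[of "V \<union> U" P] by auto
      have "pr V \<le> pr (V \<union> U)" "pr U \<le> pr (V \<union> U)"
        using f U V p1 by (auto intro!: pr_mono)
      moreover have "U \<subseteq> P" using U by auto
      ultimately show "U \<subseteq> P \<and> real C ^ card V * indicator {..x} (pr (V \<union> U)) / (pr V * pr U)
         \<le> real C ^ card V * indicator {..x} (pr V) * indicator {..x} (pr U) / (pr V * pr U)"
        using pr1[of V] pr1[of U] V by (auto simp: indicator_def)
    qed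
  qed (use assms(1) pr0 in \<open>auto simp: indicator_def\<close>)
  also have "\<dots> = (\<Sum>V\<in>Pow P. real C ^ card V / pr V * indicator {..x} (pr V)) * (\<Sum>U\<in>Pow P. 1 / pr U * indicator {..x} (pr U))"
    by (simp only: sum_product)
  also have "(\<Sum>V\<in>Pow P. real C ^ card V / pr V * indicator {..x} (pr V)) = (\<Sum>V\<in>?A. real C ^ card V / pr V)"
    using assms(1) by (intro sum.mono_neutral_cong_right) (auto simp: indicator_def)
  also have "(\<Sum>V\<in>Pow P. 1 / pr V * indicator {..x} (pr V)) = (\<Sum>V\<in>?A. 1 / pr V)"
    using assms(1) by (intro sum.mono_neutral_cong_right) (auto simp: indicator_def)
  also have "(\<Sum>V\<in>?A. real C ^ card V / pr V) * (\<Sum>V\<in>?A. 1 / pr V) \<le> (1 + ln x) ^ C * (1 + ln x)"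
    using Suc base pr0 assms(3)
    by (intro mult_mono sum_nonneg) auto
  finally show ?case by (simp add: mult.commute)
qed

section \<open>Comparison of logarithmic moments\<close>

text \<open>Partial summation through an integral: \<open>(L - u p) ^ m\<close> is the integral of
  its derivative over \<open>v\<close> from \<open>u p\<close> to \<open>L\<close>, so after
  exchanging sum and integral the hypothesis on partial sums applies pointwise in
  \<open>v\<close>.\<close>

lemma sum_power_diff_le:
  fixes c u :: "'a \<Rightarrow> real"
  assumes "finite P" "0 \<le> \<kappa>" "0 \<le> C" "0 \<le> L"
    and c: "\<And>p. p \<in> P \<Longrightarrow> 0 \<le> c p" "\<And>p. p \<in> P \<Longrightarrow> 0 \<le> u p"
    and A: "\<And>v. 0 \<le> v \<Longrightarrow> (\<Sum>p\<in>{p\<in>P. u p \<le> v}. c p) \<le> \<kappa> * v + C"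
  shows "(\<Sum>p\<in>{p\<in>P. u p \<le> L}. c p * (L - u p) ^ m) \<le> \<kappa> / real (m + 1) * L ^ (m + 1) + C * L ^ m"
proof (cases m)
  case 0
  then show ?thesis using A[OF assms(4)] by (simp add: mult.commute)
next
  case (Suc j)
  let ?B = "{p\<in>P. u p \<le> L}"
  have fB: "finite ?B" using assms by simp
  have d1: "((\<lambda>v. (L - v) ^ (n+1)) has_real_derivative - (real (n+1) * (L - v) ^ n)) (at v within X)" for v n X
    by (auto intro!: derivative_eq_intros simp del: power_Suc)
  have I1: "((\<lambda>v. if v \<in> {u p..L} then real (j+1) * (L - v) ^ j else 0) has_integral (L - u p) ^ (j+1)) {0..L}"
    if "p \<in> ?B" for p
  proof -
    have "((\<lambda>v. real (j+1) * (L - v) ^ j) has_integral (- ((L - L) ^ (j+1)) - (- ((L - u p) ^ (j+1))))) {u p..L}"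
      using that
      by (intro fundamental_theorem_of_calculus)
         (auto simp: has_real_derivative_iff_has_vector_derivative[symmetric] intro!: derivative_eq_intros simp del: power_Suc)
    then have "((\<lambda>v. real (j+1) * (L - v) ^ j) has_integral (L - u p) ^ (j+1)) {u p..L}" by simp
    then show ?thesis using that c(2)[of p]
      by (subst has_integral_restrict) auto
  qed
  have I2: "((\<lambda>v. \<Sum>p\<in>?B. c p * (if v \<in> {u p..L} then real (j+1) * (L - v) ^ j else 0)) has_integral
        (\<Sum>p\<in>?B. c p * (L - u p) ^ (j+1))) {0..L}"
    by (intro has_integral_sum fB has_integral_mult_right I1)
  \<comment> \<open>Antiderivative of the majorant found by integration by parts. It vanishes at
    \<open>L\<close>, and \<open>- ?F 0\<close> is the claimed bound.\<close>
  let ?F = "\<lambda>v. - ((\<kappa> * v + C) * (L - v) ^ (j+1)) - \<kappa> / real (j+2) * (L - v) ^ (j+2)"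
  have I3: "((\<lambda>v. (\<kappa> * v + C) * (real (j+1) * (L - v) ^ j)) has_integral (?F L - ?F 0)) {0..L}"
    using assms(4)
  proof (intro fundamental_theorem_of_calculus)
    fix v
    have "((\<lambda>v. \<kappa> * v + C) has_real_derivative \<kappa>) (at v within {0..L})"
      by (auto intro!: derivative_eq_intros)
    from DERIV_mult[OF this d1[of j]] DERIV_cmult[OF d1[of "j+1"], of "\<kappa> / real (j+2)"]
    have "(?F has_real_derivative - (\<kappa> * (L - v) ^ (j+1) + (- (real (j+1) * (L - v) ^ j)) * (\<kappa> * v + C))
        - \<kappa> / real (j+2) * - (real (j+2) * (L - v) ^ (j+1))) (at v within {0..L})"
      by (intro DERIV_diff DERIV_minus) (auto simp del: power_Suc)
    also have "- (\<kappa> * (L - v) ^ (j+1) + (- (real (j+1) * (L - v) ^ j)) * (\<kappa> * v + C))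
        - \<kappa> / real (j+2) * - (real (j+2) * (L - v) ^ (j+1)) = (\<kappa> * v + C) * (real (j+1) * (L - v) ^ j)"
      by (simp add: field_simps)
    finally show "(?F has_vector_derivative (\<kappa> * v + C) * (real (j+1) * (L - v) ^ j)) (at v within {0..L})"
      by (simp only: has_real_derivative_iff_has_vector_derivative)
  qed
  have "(\<Sum>p\<in>?B. c p * (L - u p) ^ (j+1)) \<le> ?F L - ?F 0"
  proof (rule has_integral_le[OF I2 I3])
    fix v assume v: "v \<in> {0..L}"
    have "(\<Sum>p\<in>?B. c p * (if v \<in> {u p..L} then real (j+1) * (L - v) ^ j else 0))
        = (\<Sum>p\<in>{p\<in>P. u p \<le> v}. c p * (real (j+1) * (L - v) ^ j))"
      using v assms(1) by (intro sum.mono_neutral_cong_right) auto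
    also have "\<dots> = (\<Sum>p\<in>{p\<in>P. u p \<le> v}. c p) * (real (j+1) * (L - v) ^ j)"
      by (simp only: sum_distrib_right)
    also have "\<dots> \<le> (\<kappa> * v + C) * (real (j+1) * (L - v) ^ j)"
      using v by (intro mult_right_mono A) auto
    finally show "(\<Sum>p\<in>?B. c p * (if v \<in> {u p..L} then real (j+1) * (L - v) ^ j else 0))
      \<le> (\<kappa> * v + C) * (real (j+1) * (L - v) ^ j)" .
  qed
  then show ?thesis using Suc by (simp add: algebra_simps)
qed

text \<open>Write ln x as ln(x/pr S) plus the sum of ln p over p in S. The first part raises the
  exponent of the logarithm by one; in the second, p is taken out of S and the sum over p is
  estimated by partial summation with x/pr S as the bound. For a multiplicative function of
  dimension \<kappa> the inequality is sharp to leading order, which is why no asymptotic formula is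
  needed later.\<close>

lemma log_moment_le:
  fixes H :: "nat \<Rightarrow> real"
  assumes fin: "finite P" and P1: "\<And>p. p \<in> P \<Longrightarrow> 1 \<le> p" and H: "\<And>p. p \<in> P \<Longrightarrow> 0 \<le> H p"
    and kC: "0 \<le> \<kappa>" "0 \<le> C"
    and A: "\<And>x. 1 \<le> x \<Longrightarrow> (\<Sum>p\<in>{p\<in>P. real p \<le> x}. H p * ln (real p)) \<le> \<kappa> * ln x + C"
    and x: "1 \<le> x"
  shows "(ln x - C) * (\<Sum>S\<in>{S\<in>Pow P. pr S \<le> x}. prod H S * ln (x / pr S) ^ m)
     \<le> (1 + \<kappa> / real (m + 1)) * (\<Sum>S\<in>{S\<in>Pow P. pr S \<le> x}. prod H S * ln (x / pr S) ^ (m + 1))"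
proof -
  let ?A = "{S\<in>Pow P. pr S \<le> x}"
  let ?I = "\<lambda>S. if pr S \<le> x then 1 else (0::real)"
  have pr1: "1 \<le> pr W" if "W \<subseteq> P" for W using that P1 by (auto intro!: pr_ge_1)
  have fs: "finite S" if "S \<subseteq> P" for S using that fin finite_subset by auto
  have H0: "0 \<le> prod H S" if "S \<subseteq> P" for S using that H by (auto intro!: prod_nonneg)
  have inner: "(\<Sum>p\<in>{p\<in>P. real p \<le> y}. H p * ln (real p) * ln (y / real p) ^ m)
      \<le> \<kappa> / real (m + 1) * ln y ^ (m + 1) + C * ln y ^ m" if y: "1 \<le> y" for y
  proof -
    have *: "{p\<in>P. real p \<le> exp v} = {p\<in>P. ln (real p) \<le> v}" for v
    proof -
      have "real p \<le> exp v \<longleftrightarrow> ln (real p) \<le> v" if "p \<in> P" for p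
        using P1[OF that] by (metis exp_le_cancel_iff exp_ln of_nat_0_less_iff less_le_trans zero_less_one)
      then show ?thesis by auto
    qed
    have "(\<Sum>p\<in>{p\<in>P. ln (real p) \<le> ln y}. H p * ln (real p) * (ln y - ln (real p)) ^ m)
      \<le> \<kappa> / real (m + 1) * ln y ^ (m + 1) + C * ln y ^ m"
    proof (rule sum_power_diff_le)
      fix v :: real assume "0 \<le> v"
      then have "(\<Sum>p\<in>{p\<in>P. real p \<le> exp v}. H p * ln (real p)) \<le> \<kappa> * ln (exp v) + C"
        by (intro A) simp
      then show "(\<Sum>p\<in>{p \<in> P. ln (real p) \<le> v}. H p * ln (real p)) \<le> \<kappa> * v + C"
        by (simp add: *)
    qed (use fin kC y H P1 in \<open>auto intro!: mult_nonneg_nonneg ln_ge_zero\<close>)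
    moreover have "(\<Sum>p\<in>{p\<in>P. real p \<le> y}. H p * ln (real p) * ln (y / real p) ^ m)
      = (\<Sum>p\<in>{p\<in>P. ln (real p) \<le> ln y}. H p * ln (real p) * (ln y - ln (real p)) ^ m)"
      using *[of "ln y"] y P1 by (intro sum.cong) (fastforce simp: ln_div)+
    ultimately show ?thesis by simp
  qed
  have "(\<Sum>S\<in>?A. prod H S * ln (x / pr S) ^ m * (\<Sum>p\<in>S. ln (real p)))
      = (\<Sum>S\<in>Pow P. \<Sum>p\<in>S. ?I S * (prod H S * ln (x / pr S) ^ m * ln (real p)))"
    using fin by (intro sum.mono_neutral_cong_left) (auto simp: sum_distrib_left)
  also have "\<dots> = (\<Sum>p\<in>P. \<Sum>S\<in>Pow (P - {p}). ?I (insert p S) * (prod H (insert p S) * ln (x / pr (insert p S)) ^ m * ln (real p)))"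
    by (rule sum_Pow_element[OF fin])
  \<comment> \<open>The restriction \<open>p \<notin> S\<close> is dropped, the extra terms being
    nonnegative. The condition on \<open>insert p S\<close> becomes \<open>p \<le> x / pr S\<close>,
    which is the range of \<open>inner\<close>.\<close>
  also have "\<dots> \<le> (\<Sum>p\<in>P. \<Sum>S\<in>Pow P. ?I S * (if real p \<le> x / pr S then prod H S * (H p * ln (real p) * ln (x / pr S / real p) ^ m) else 0))"
  proof (rule sum_mono, rule sum_le_included[where i = id])
    fix p assume p: "p \<in> P"
    show "\<forall>S\<in>Pow P. 0 \<le> ?I S * (if real p \<le> x / pr S then prod H S * (H p * ln (real p) * ln (x / pr S / real p) ^ m) else 0)"
    proof
      fix S assume S: "S \<in> Pow P"
      show "0 \<le> ?I S * (if real p \<le> x / pr S then prod H S * (H p * ln (real p) * ln (x / pr S / real p) ^ m) else 0)"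
        using H0[of S] S H[OF p] P1[OF p] pr1[of S]
        by (auto intro!: mult_nonneg_nonneg zero_le_power ln_ge_zero simp: field_simps)
    qed
    show "\<forall>S\<in>Pow (P - {p}). \<exists>S'\<in>Pow P. id S' = S \<and>
       ?I (insert p S) * (prod H (insert p S) * ln (x / pr (insert p S)) ^ m * ln (real p))
       \<le> ?I S' * (if real p \<le> x / pr S' then prod H S' * (H p * ln (real p) * ln (x / pr S' / real p) ^ m) else 0)"
    proof (intro ballI bexI conjI)
      fix S assume S: "S \<in> Pow (P - {p})"
      then have S': "finite S" "p \<notin> S" "S \<subseteq> P" using fs by auto
      have "1 \<le> real p" using P1[OF p] by simp
      then have "pr S \<le> pr S * real p" using pr1[OF S'(3)] by (simp add: mult_le_cancel_left1)
      then have "pr S \<le> x" if "pr S * real p \<le> x" using that by linarith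
      then show "?I (insert p S) * (prod H (insert p S) * ln (x / pr (insert p S)) ^ m * ln (real p))
       \<le> ?I S * (if real p \<le> x / pr S then prod H S * (H p * ln (real p) * ln (x / pr S / real p) ^ m) else 0)"
        using S' pr1[OF S'(3)] by (auto simp: pr_insert mult.commute field_simps)
    qed (auto)
  qed (use fin in auto)
  also have "\<dots> = (\<Sum>S\<in>Pow P. ?I S * (prod H S * (\<Sum>p\<in>P. if real p \<le> x / pr S then H p * ln (real p) * ln (x / pr S / real p) ^ m else 0)))"
    by (subst sum.swap, intro sum.cong refl, subst sum_distrib_left, subst sum_distrib_left, intro sum.cong refl) auto
  also have "\<dots> = (\<Sum>S\<in>?A. prod H S * (\<Sum>p\<in>{p\<in>P. real p \<le> x / pr S}. H p * ln (real p) * ln (x / pr S / real p) ^ m))"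
    using fin by (intro sum.mono_neutral_cong_right) (auto simp: sum.inter_filter simp del: divide_divide_eq_left)
  also have "\<dots> \<le> (\<Sum>S\<in>?A. prod H S * (\<kappa> / real (m + 1) * ln (x / pr S) ^ (m + 1) + C * ln (x / pr S) ^ m))"
  proof (intro sum_mono mult_left_mono inner)
    fix S assume "S \<in> ?A"
    then show "1 \<le> x / pr S" "0 \<le> prod H S" using pr1[of S] H0[of S] by (auto simp: field_simps)
  qed
  finally have main: "(\<Sum>S\<in>?A. prod H S * ln (x / pr S) ^ m * (\<Sum>p\<in>S. ln (real p)))
     \<le> \<kappa> / real (m + 1) * (\<Sum>S\<in>?A. prod H S * ln (x / pr S) ^ (m + 1)) + C * (\<Sum>S\<in>?A. prod H S * ln (x / pr S) ^ m)"
    by (simp add: sum_distrib_left sum.distrib algebra_simps)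
  have "ln x * (\<Sum>S\<in>?A. prod H S * ln (x / pr S) ^ m)
     = (\<Sum>S\<in>?A. prod H S * ln (x / pr S) ^ (m + 1)) + (\<Sum>S\<in>?A. prod H S * ln (x / pr S) ^ m * (\<Sum>p\<in>S. ln (real p)))"
    unfolding sum_distrib_left[where r = "ln x"] sum.distrib[symmetric]
  proof (rule sum.cong)
    fix S assume S: "S \<in> ?A"
    have "ln (pr S) = (\<Sum>p\<in>S. ln (real p))"
      unfolding pr_def using S fs P1 by (intro ln_prod) (auto simp: Suc_le_eq)
    then have "ln x = ln (x / pr S) + (\<Sum>p\<in>S. ln (real p))"
      using S x pr1[of S] by (subst ln_div) auto
    then show "ln x * (prod H S * ln (x / pr S) ^ m)
      = prod H S * ln (x / pr S) ^ (m + 1) + (prod H S * ln (x / pr S) ^ m * (\<Sum>p\<in>S. ln (real p)))"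
      by (metis (no_types, lifting) distrib_left mult.assoc mult.commute power_Suc Suc_eq_plus1)
  qed simp
  with main show ?thesis by (simp add: algebra_simps)
qed

section \<open>Sums of arithmetic functions with logarithmic weights\<close>

lemma prod_le_nat_of_prime_factors:
  assumes "0 < n" "S \<subseteq> prime_factors n"
  shows "\<Prod>S \<le> (n::nat)"
proof -
  have "finite S" using assms(2) finite_subset by blast
  then have "mset_set S \<subseteq># prime_factorization n"
    using assms(2) by (auto simp: mset_subset_eqI subseteq_mset_def count_mset_set' Suc_le_eq count_greater_zero_iff)
  then have "\<Prod>\<^sub># (mset_set S) dvd \<Prod>\<^sub># (prime_factorization n)"
    by (rule prod_mset_subset_imp_dvd)
  then have "\<Prod>S dvd n" using assms(1)
    by (simp add: prod_unfold_prod_mset prod_mset_prime_factorization_nat)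
  then show ?thesis using assms(1) by (simp add: dvd_imp_le)
qed

lemma geometric_sum_le:
  assumes "2 \<le> (p::nat)"
  shows "(\<Sum>e = 1..N. (1 / real p) ^ e) \<le> 1 / (real p - 1)"
proof -
  have "(\<Sum>e = 1..N. (1 / real p) ^ e) = (1 - (1 / real p) ^ N) / (real p - 1)"
  proof (induction N)
    case (Suc N)
    have "(1 - (1 / real p) ^ N) / (real p - 1) + (1 / real p) ^ Suc N = (1 - (1 / real p) ^ Suc N) / (real p - 1)"
      using assms by (simp add: divide_simps) (simp add: algebra_simps)
    then show ?case using Suc by simp
  qed simp
  also have "\<dots> \<le> 1 / (real p - 1)"
    using assms by (intro divide_right_mono) auto
  finally show ?thesis .
qed

text \<open>Without the cutoff N there is equality, by the geometric series at each prime. The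
  induction separates the full power of one prime, n = p^e m.\<close>

lemma sum_inverse_fixed_prime_factors_le:
  assumes "finite S" "\<And>p. p \<in> S \<Longrightarrow> prime (p::nat)"
  shows "(\<Sum>n\<in>{n\<in>{1..N}. prime_factors n = S}. 1 / real n) \<le> (\<Prod>p\<in>S. 1 / (real p - 1))"
  using assms
proof (induction S rule: finite_induct)
  case empty
  have "{n\<in>{1..N}. prime_factors n = {}} \<subseteq> {1}"
    by (auto simp: prime_factorization_empty_iff)
  then have "(\<Sum>n\<in>{n\<in>{1..N}. prime_factors n = {}}. 1 / real n) \<le> (\<Sum>n\<in>{1::nat}. 1 / real n)"
    by (intro sum_mono2) auto
  then show ?case by simp
next
  case (insert p S)
  let ?B = "\<lambda>S. {n\<in>{1..N}. prime_factors n = S}"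
  have p: "prime p" using insert.prems by simp
  then have p2: "2 \<le> p" by (rule prime_ge_2_nat)
  have "(\<Sum>n\<in>?B (insert p S). 1 / real n) \<le> (\<Sum>(e,m)\<in>{1..N} \<times> ?B S. (1 / real p) ^ e * (1 / real m))"
  proof (rule sum_le_included[where i = "\<lambda>(e,m). p ^ e * m"])
    show "\<forall>n\<in>?B (insert p S). \<exists>y\<in>{1..N} \<times> ?B S. (case y of (e, m) \<Rightarrow> p ^ e * m) = n \<and>
        1 / real n \<le> (case y of (e, m) \<Rightarrow> (1 / real p) ^ e * (1 / real m))"
    proof
      fix n assume n: "n \<in> ?B (insert p S)"
      define e where "e = multiplicity p n"
      define m where "m = n div p ^ e"
      have n0: "n \<noteq> 0" and pdvd: "p dvd n" using n by auto
      have nem: "n = p ^ e * m" unfolding m_def e_def by (simp add: multiplicity_dvd)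
      have e1: "1 \<le> e" unfolding e_def using n0 pdvd p
        by (metis One_nat_def Suc_leI multiplicity_gt_zero_iff not_prime_unit)
      have npm: "\<not> p dvd m"
        unfolding m_def e_def using n0 p by (metis multiplicity_decompose not_prime_unit)
      have m0: "m \<noteq> 0" using nem n0 by auto
      have "prime_factors n = prime_factors (p ^ e) \<union> prime_factors m"
        unfolding nem using p m0 by (subst prime_factorization_mult) auto
      also have "prime_factors (p ^ e) = {p}" using p e1 by (simp add: prime_factorization_prime_power)
      finally have "insert p S = insert p (prime_factors m)" using n by simp
      moreover have "p \<notin> prime_factors m" using npm by auto
      ultimately have pm: "prime_factors m = S" using insert.hyps(2) by (metis insert_ident)
      have "m \<le> n" using nem p2 by (simp add: m_def)
      \<comment> \<open>A crude bound, only to keep the exponents within the finite range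
        1..N.\<close>
      have "e < p ^ e" using p2 by (intro power_gt_expt) auto
      also have "p ^ e \<le> n" unfolding nem using m0 by simp
      finally have "e \<le> N" using n by simp
      have "m \<le> N" using \<open>m \<le> n\<close> n by simp
      from \<open>e \<le> N\<close> show "\<exists>y\<in>{1..N} \<times> ?B S. (case y of (e, m) \<Rightarrow> p ^ e * m) = n \<and>
        1 / real n \<le> (case y of (e, m) \<Rightarrow> (1 / real p) ^ e * (1 / real m))"
        using e1 pm m0 \<open>m \<le> N\<close> n nem
        by (intro bexI[of _ "(e, m)"]) (auto simp: power_divide)
    qed
  qed auto
  also have "\<dots> = (\<Sum>e = 1..N. (1 / real p) ^ e) * (\<Sum>m\<in>?B S. 1 / real m)"
    by (simp only: sum_product sum.cartesian_product)
  also have "\<dots> \<le> (1 / (real p - 1)) * (\<Prod>p\<in>S. 1 / (real p - 1))"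
    using insert p2 by (intro mult_mono geometric_sum_le sum_nonneg) auto
  also have "\<dots> = (\<Prod>p\<in>insert p S. 1 / (real p - 1))"
    using insert.hyps by simp
  finally show ?case .
qed

text \<open>Comparison with the integral of ln(x/t)/t, carried out as a telescoping sum of half
  squares.\<close>

lemma sum_log_weight_ge:
  assumes "1 \<le> x"
  shows "ln x ^ 2 / 2 \<le> (\<Sum>n = 1..nat \<lfloor>x\<rfloor>. lnp (x / real n) / real n)"
proof -
  have step: "(lnp (x / real n) ^ 2 - lnp (x / real (Suc n)) ^ 2) / 2 \<le> lnp (x / real n) / real n"
    if n: "1 \<le> n" for n :: nat
  proof -
    define a where "a = lnp (x / real n)"
    define b where "b = lnp (x / real (Suc n))"
    have ab: "b \<le> a" "0 \<le> b" unfolding a_def b_def using assms n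
      by (auto intro!: lnp_mono divide_left_mono)
    have "ln (x / real n) - ln (x / real (Suc n)) = ln (1 + 1 / real n)"
      using assms n by (simp add: ln_div ln_mult add_divide_distrib[symmetric] field_simps)
    also have "\<dots> \<le> 1 / real n" by (rule ln_add_one_self_le_self) simp
    finally have *: "ln (x / real n) - ln (x / real (Suc n)) \<le> 1 / real n" .
    have "a - b \<le> 1 / real n"
      using * n unfolding a_def b_def lnp_def max_def
      by (smt (verit) divide_nonneg_nonneg of_nat_0_le_iff)
    have "(a^2 - b^2) / 2 = (a - b) * ((a + b) / 2)" by (simp add: power2_eq_square algebra_simps)
    also have "\<dots> \<le> (1 / real n) * a"
      using ab \<open>a - b \<le> 1 / real n\<close> by (intro mult_mono) auto
    finally show ?thesis by (simp add: a_def b_def)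
  qed
  have "(lnp (x / real 1) ^ 2 - lnp (x / real (Suc m)) ^ 2) / 2 \<le> (\<Sum>n = 1..m. lnp (x / real n) / real n)" for m
  proof (induction m)
    case (Suc m)
    then show ?case using step[of "Suc m"] by (simp add: diff_divide_distrib)
  qed simp
  from this[of "nat \<lfloor>x\<rfloor>"] have "(lnp x ^ 2 - lnp (x / real (Suc (nat \<lfloor>x\<rfloor>))) ^ 2) / 2
      \<le> (\<Sum>n = 1..nat \<lfloor>x\<rfloor>. lnp (x / real n) / real n)" by simp
  \<comment> \<open>The first integer beyond \<open>x\<close> has weight 0, so the telescoping sum
    ends without a remainder.\<close>
  moreover have "x < real (Suc (nat \<lfloor>x\<rfloor>))" using assms by linarith
  then have "lnp (x / real (Suc (nat \<lfloor>x\<rfloor>))) = 0"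
    using assms by (intro lnp_eq_0) auto
  ultimately show ?thesis using assms by (simp add: lnp_eq_ln)
qed

text \<open>Every integer up to \<open>x\<close> is determined by its set of prime factors up to the geometric sums
  \<open>\<Sum>\<^sub>e p\<^sup>-\<^sup>e = 1/(p-1)\<close>, and the weight only increases when an integer is replaced by the product
  of those of its prime factors that lie in \<open>A\<close>.\<close>
lemma sum_inverse_totient_log_ge:
  assumes fin: "finite A" "finite Z" and disj: "A \<inter> Z = {}"
    and pA: "\<And>p. p \<in> A \<union> Z \<Longrightarrow> prime p"
    and cover: "\<And>p. prime p \<Longrightarrow> real p \<le> x \<Longrightarrow> p \<in> A \<union> Z"
    and x: "1 \<le> x"
  shows "(\<Prod>p\<in>Z. 1 - 1 / real p) * (ln x ^ 2 / 2)
     \<le> (\<Sum>M\<in>Pow A. (\<Prod>p\<in>M. 1 / (real p - 1)) * lnp (x / pr M))"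
proof -
  let ?N = "nat \<lfloor>x\<rfloor>"
  let ?B = "\<lambda>S. {n\<in>{1..?N}. prime_factors n = S}"
  have fin2: "finite (Pow (A \<union> Z))" using fin by simp
  have pf: "prime_factors n \<subseteq> A \<union> Z" if "n \<in> {1..?N}" for n
  proof
    fix p assume p: "p \<in> prime_factors n"
    then have "p \<le> n" using that by (auto intro!: dvd_imp_le)
    moreover have "real n \<le> x" using that x by (auto simp: le_nat_floor)
       linarith
    ultimately show "p \<in> A \<union> Z" using p by (intro cover) auto
  qed
  have "(\<Sum>n = 1..?N. lnp (x / real n) / real n) = (\<Sum>S\<in>Pow (A \<union> Z). \<Sum>n\<in>?B S. lnp (x / real n) / real n)"
    using pf fin2 by (intro sum.group[symmetric] finite_atLeastAtMost image_subsetI PowI) auto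
  also have "\<dots> \<le> (\<Sum>S\<in>Pow (A \<union> Z). lnp (x / pr (S \<inter> A)) * (\<Prod>p\<in>S. 1 / (real p - 1)))"
  proof (rule sum_mono)
    fix S assume S: "S \<in> Pow (A \<union> Z)"
    have "(\<Sum>n\<in>?B S. lnp (x / real n) / real n) \<le> (\<Sum>n\<in>?B S. lnp (x / pr (S \<inter> A)) * (1 / real n))"
    proof (rule sum_mono)
      fix n assume n: "n \<in> ?B S"
      have "\<Prod>(S \<inter> A) \<le> n" using n by (intro prod_le_nat_of_prime_factors) auto
      then have "pr (S \<inter> A) \<le> real n" unfolding pr_eq by linarith
      moreover have "1 \<le> pr (S \<inter> A)"
        using S pA prime_ge_1_nat by (intro pr_ge_1) blast
      ultimately have "lnp (x / real n) \<le> lnp (x / pr (S \<inter> A))"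
        using x n by (intro lnp_mono divide_left_mono) auto
      then show "lnp (x / real n) / real n \<le> lnp (x / pr (S \<inter> A)) * (1 / real n)"
        by (simp add: divide_right_mono)
    qed
    also have "\<dots> = lnp (x / pr (S \<inter> A)) * (\<Sum>n\<in>?B S. 1 / real n)"
      by (simp add: sum_distrib_left)
    also have "\<dots> \<le> lnp (x / pr (S \<inter> A)) * (\<Prod>p\<in>S. 1 / (real p - 1))"
      using S pA fin finite_subset[of S "A \<union> Z"]
      by (intro mult_left_mono sum_inverse_fixed_prime_factors_le) auto
    finally show "(\<Sum>n\<in>?B S. lnp (x / real n) / real n) \<le> lnp (x / pr (S \<inter> A)) * (\<Prod>p\<in>S. 1 / (real p - 1))" .
  qed
  also have "\<dots> = (\<Sum>(M,Y)\<in>Pow A \<times> Pow Z. (\<Prod>p\<in>M. 1 / (real p - 1)) * lnp (x / pr M) * (\<Prod>p\<in>Y. 1 / (real p - 1)))"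
  proof (rule sum.reindex_bij_witness[of _ "\<lambda>(M,Y). M \<union> Y" "\<lambda>S. (S \<inter> A, S \<inter> Z)"])
    fix S assume S: "S \<in> Pow (A \<union> Z)"
    have "(\<Prod>p\<in>S. 1 / (real p - 1)) = (\<Prod>p\<in>(S \<inter> A) \<union> (S \<inter> Z). 1 / (real p - 1))"
      using S by (intro prod.cong) auto
    also have "\<dots> = (\<Prod>p\<in>S \<inter> A. 1 / (real p - 1)) * (\<Prod>p\<in>S \<inter> Z. 1 / (real p - 1))"
      using fin disj by (intro prod.union_disjoint) auto
    finally show "(case (S \<inter> A, S \<inter> Z) of (M, Y) \<Rightarrow>
      (\<Prod>p\<in>M. 1 / (real p - 1)) * lnp (x / pr M) * (\<Prod>p\<in>Y. 1 / (real p - 1)))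
      = lnp (x / pr (S \<inter> A)) * (\<Prod>p\<in>S. 1 / (real p - 1))" by simp
  qed (use disj in auto)
  also have "\<dots> = (\<Sum>M\<in>Pow A. (\<Prod>p\<in>M. 1 / (real p - 1)) * lnp (x / pr M)) * (\<Sum>Y\<in>Pow Z. \<Prod>p\<in>Y. 1 / (real p - 1))"
    by (simp only: sum_product sum.cartesian_product)
  also have "(\<Sum>Y\<in>Pow Z. \<Prod>p\<in>Y. 1 / (real p - 1)) = (\<Prod>p\<in>Z. 1 + 1 / (real p - 1))"
    by (rule sum_Pow_prod) fact
  finally have le: "ln x ^ 2 / 2 \<le> (\<Sum>M\<in>Pow A. (\<Prod>p\<in>M. 1 / (real p - 1)) * lnp (x / pr M)) * (\<Prod>p\<in>Z. 1 + 1 / (real p - 1))"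
    using sum_log_weight_ge[OF x] by linarith
  have pZ: "2 \<le> p" if "p \<in> Z" for p using pA[of p] that prime_ge_2_nat by auto
  have "(\<Prod>p\<in>Z. 1 + 1 / (real p - 1)) * (\<Prod>p\<in>Z. 1 - 1 / real p) = (\<Prod>p\<in>Z. 1)"
    unfolding prod.distrib[symmetric]
  proof (rule prod.cong)
    fix p assume "p \<in> Z"
    from pZ[OF this] show "(1 + 1 / (real p - 1)) * (1 - 1 / real p) = 1"
      by (simp add: field_simps)
  qed simp
  then have eq: "(\<Prod>p\<in>Z. 1 + 1 / (real p - 1)) * (\<Prod>p\<in>Z. 1 - 1 / real p) = 1" by simp
  have "(\<Prod>p\<in>Z. 1 - 1 / real p) * (ln x ^ 2 / 2) \<le> (\<Prod>p\<in>Z. 1 - 1 / real p) *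
     ((\<Sum>M\<in>Pow A. (\<Prod>p\<in>M. 1 / (real p - 1)) * lnp (x / pr M)) * (\<Prod>p\<in>Z. 1 + 1 / (real p - 1)))"
    using pZ by (intro mult_left_mono le prod_nonneg) (auto simp: field_simps dest!: pZ)
  also have "\<dots> = (\<Sum>M\<in>Pow A. (\<Prod>p\<in>M. 1 / (real p - 1)) * lnp (x / pr M)) *
     ((\<Prod>p\<in>Z. 1 + 1 / (real p - 1)) * (\<Prod>p\<in>Z. 1 - 1 / real p))"
    by (simp only: mult_ac)
  finally show ?thesis by (simp add: eq)
qed

section \<open>Upper bounds for logarithmic sums over integers coprime to a modulus\<close>

lemma sum_log2_weight_le:
  assumes "1 \<le> x"
  shows "(\<Sum>j = 1..M. lnp (x / real j) ^ 2 / real j) \<le> ln x ^ 3 / 3 + ln x ^ 2"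
proof -
  \<comment> \<open>Telescoping cubes only control the terms from j = 2 on; the term j = 1 is paid
    for by \<open>lnp x ^ 2\<close>. The \<open>max 1 M\<close> makes the bound meaningful for M =
    0.\<close>
  have "(\<Sum>j = 1..M. lnp (x / real j) ^ 2 / real j) \<le> (lnp x ^ 3 - lnp (x / real (max 1 M)) ^ 3) / 3 + lnp x ^ 2"
  proof (induction M)
    case (Suc M)
    show ?case
    proof (cases "M = 0")
      case False
      define a where "a = lnp (x / real M)"
      define b where "b = lnp (x / real (Suc M))"
      have ab: "b \<le> a" "0 \<le> b" unfolding a_def b_def using assms False
        by (auto intro!: lnp_mono divide_left_mono)
      have "b ^ 2 / real (Suc M) \<le> (a ^ 3 - b ^ 3) / 3"
      proof (cases "b = 0")
        case True
        then show ?thesis using ab by simp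
      next
        case b: False
        then have b': "0 < ln (x / real (Suc M))" unfolding b_def lnp_def by (auto simp: max_def split: if_splits)
        have "ln (real M / real (Suc M)) \<le> real M / real (Suc M) - 1"
          using False by (intro ln_le_minus_one) auto
        then have "1 / real (Suc M) \<le> ln (real (Suc M)) - ln (real M)"
          using False by (simp add: ln_div field_simps)
        also have "\<dots> = ln (x / real M) - ln (x / real (Suc M))"
          using False assms by (simp add: ln_div)
        also have "\<dots> \<le> a - b" using b' unfolding a_def b_def lnp_def by (auto simp: max_def)
        finally have *: "1 / real (Suc M) \<le> a - b" .
        have "b ^ 2 \<le> (a^2 + a * b + b^2) / 3"
          using ab mult_mono[of b a b a] mult_mono[of b a b b] by (simp add: power2_eq_square)
        then have "b ^ 2 * (1 / real (Suc M)) \<le> (a^2 + a * b + b^2) / 3 * (a - b)"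
          using * ab by (intro mult_mono) auto
        also have "\<dots> = (a ^ 3 - b ^ 3) / 3" by (simp add: power3_eq_cube power2_eq_square algebra_simps)
        finally show ?thesis by simp
      qed
      then show ?thesis using Suc False by (simp add: a_def b_def max_def diff_divide_distrib)
    qed simp
  qed (simp add: lnp_def)
  also have "\<dots> \<le> ln x ^ 3 / 3 + ln x ^ 2" using assms by (simp add: lnp_eq_ln)
  finally show ?thesis .
qed

text \<open>Write n = jQ + r with r coprime to Q. For j >= 1 the term is at most lnp(x/j)^2/(jQ),
  and summing over r yields the density totient(Q)/Q. The block j = 0 costs only a lower power of ln
  x, with a factor depending on the fixed Q.\<close>

lemma sum_coprime_log2_weight_le:
  assumes "1 \<le> x" "1 < Q"
  shows "(\<Sum>n\<in>{n\<in>{1..N}. coprime n Q}. lnp (x / real n) ^ 2 / real n)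
     \<le> real (totient Q) / real Q * (ln x ^ 3 / 3) + (real Q + 1) * ln x ^ 2"
proof -
  let ?g = "\<lambda>n::nat. lnp (x / real n) ^ 2 / real n"
  have lx: "lnp (x / real n) \<le> ln x" if "1 \<le> n" for n :: nat
  proof -
    have "lnp (x / real n) \<le> lnp x" using assms that by (intro lnp_mono) (auto simp: field_simps)
    then show ?thesis using assms by (simp add: lnp_eq_ln)
  qed
  have "(\<Sum>n\<in>{n\<in>{1..N}. coprime n Q}. ?g n) \<le> (\<Sum>(j,r)\<in>{0..N} \<times> totatives Q. ?g (j * Q + r))"
  proof (rule sum_le_included[where i = "\<lambda>(j,r). j * Q + r"])
    show "\<forall>n\<in>{n\<in>{1..N}. coprime n Q}. \<exists>y\<in>{0..N} \<times> totatives Q. (case y of (j, r) \<Rightarrow> j * Q + r) = n \<and>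
            ?g n \<le> (case y of (j, r) \<Rightarrow> ?g (j * Q + r))"
    proof
      fix n assume n: "n \<in> {n\<in>{1..N}. coprime n Q}"
      then have "coprime (n mod Q) Q" using assms(2) by auto
      moreover have "n mod Q \<noteq> 0" using calculation assms(2) by (metis coprime_0_left_iff less_numeral_extra(4) nat_dvd_1_iff_1)
      ultimately have "n mod Q \<in> totatives Q" using assms(2) by (simp add: in_totatives_iff mod_le_divisor)
      moreover have "n div Q \<le> N" using n by (auto intro: le_trans[OF div_le_dividend])
      ultimately show "\<exists>y\<in>{0..N} \<times> totatives Q. (case y of (j, r) \<Rightarrow> j * Q + r) = n \<and>
            ?g n \<le> (case y of (j, r) \<Rightarrow> ?g (j * Q + r))"
        by (intro bexI[of _ "(n div Q, n mod Q)"]) (auto simp del: of_nat_add of_nat_mult)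
    qed
  qed auto
  also have "\<dots> = (\<Sum>j = 0..N. \<Sum>r\<in>totatives Q. ?g (j * Q + r))"
    by (simp add: sum.cartesian_product)
  also have "\<dots> = (\<Sum>r\<in>totatives Q. ?g r) + (\<Sum>j = 1..N. \<Sum>r\<in>totatives Q. ?g (j * Q + r))"
    by (simp add: sum.atLeast_Suc_atMost)
  also have "(\<Sum>r\<in>totatives Q. ?g r) \<le> (\<Sum>r\<in>totatives Q. ln x ^ 2)"
  proof (rule sum_mono)
    fix r assume "r \<in> totatives Q"
    then have r: "1 \<le> r" by (auto simp: in_totatives_iff)
    have "?g r \<le> lnp (x / real r) ^ 2 / 1" using r by (intro divide_left_mono) auto
    also have "\<dots> \<le> ln x ^ 2" using lx[OF r] by (simp add: power_mono)
    finally show "?g r \<le> ln x ^ 2" .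
  qed
  also have "(\<Sum>r\<in>totatives Q. ln x ^ 2) \<le> real Q * ln x ^ 2"
    using totient_le[of Q] by (simp add: totient_def[symmetric] mult_right_mono)
  also have "(\<Sum>j = 1..N. \<Sum>r\<in>totatives Q. ?g (j * Q + r)) \<le> (\<Sum>j = 1..N. \<Sum>r\<in>totatives Q. lnp (x / real j) ^ 2 / (real j * real Q))"
  proof (intro sum_mono)
    fix j r assume j: "j \<in> {1..N}" and r: "r \<in> totatives Q"
    have "real j * 1 \<le> real j * real Q" using assms by (intro mult_left_mono) auto
    then have "real j \<le> real (j * Q + r)" by simp
    then have "lnp (x / real (j * Q + r)) \<le> lnp (x / real j)"
      using assms j by (intro lnp_mono divide_left_mono) auto
    then show "?g (j * Q + r) \<le> lnp (x / real j) ^ 2 / (real j * real Q)"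
      using j assms by (intro frac_le power_mono) auto
  qed
  also have "\<dots> = real (totient Q) / real Q * (\<Sum>j = 1..N. lnp (x / real j) ^ 2 / real j)"
    by (simp add: totient_def sum_distrib_left algebra_simps)
  also have "\<dots> \<le> real (totient Q) / real Q * (ln x ^ 3 / 3 + ln x ^ 2)"
    using assms by (intro mult_left_mono sum_log2_weight_le) auto
  also have "real (totient Q) / real Q * (ln x ^ 3 / 3 + ln x ^ 2)
      = real (totient Q) / real Q * (ln x ^ 3 / 3) + real (totient Q) / real Q * ln x ^ 2"
    by (simp add: algebra_simps)
  also have "real (totient Q) / real Q * ln x ^ 2 \<le> 1 * ln x ^ 2"
    using assms totient_le[of Q] by (intro mult_right_mono) auto
  finally show ?thesis by (simp add: algebra_simps)
qed

lemma sum_inverse_square_le: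
  assumes "finite P" "0 < d" "\<And>p. p \<in> P \<Longrightarrow> d < (p::nat)"
  shows "(\<Sum>p\<in>P. 1 / real p ^ 2) \<le> 1 / real d"
proof -
  have tel: "(\<Sum>n\<in>{d<..M}. 1 / real n ^ 2) \<le> 1 / real d - 1 / real M" if "d \<le> M" for M
    using that
  proof (induction rule: dec_induct)
    case (step n)
    have "{d<..Suc n} = insert (Suc n) {d<..n}" using step by auto
    then have "(\<Sum>n\<in>{d<..Suc n}. 1 / real n ^ 2) = 1 / real (Suc n) ^ 2 + (\<Sum>n\<in>{d<..n}. 1 / real n ^ 2)" by simp
    moreover have "1 / real (Suc n) ^ 2 \<le> 1 / real n - 1 / real (Suc n)"
    proof -
      have n0: "0 < real n" using step assms by simp
      have "1 / real (Suc n) ^ 2 \<le> 1 / (real n * real (Suc n))"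
        using n0 by (intro divide_left_mono) (auto simp: power2_eq_square)
      also have "\<dots> = 1 / real n - 1 / real (Suc n)" using n0 by (simp add: field_simps)
      finally show ?thesis .
    qed
    ultimately show ?case using step by linarith
  qed simp
  define M where "M = Max (insert d P)"
  have M: "d \<le> M" "P \<subseteq> {d<..M}" using assms by (auto simp: M_def)
  have "(\<Sum>p\<in>P. 1 / real p ^ 2) \<le> (\<Sum>n\<in>{d<..M}. 1 / real n ^ 2)"
    using M by (intro sum_mono2) auto
  also have "\<dots> \<le> 1 / real d - 1 / real M" by (rule tel) fact
  finally show ?thesis by (smt (verit) divide_nonneg_nonneg of_nat_0_le_iff)
qed

text \<open>1/(p - K) exceeds 1/p by K/(p(p - K)), whose sum over p > d converges. Expanding the
  product therefore costs the factor exp(2K/d), and what is left runs over distinct integers coprime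
  to Q.\<close>

lemma sum_shifted_log2_le:
  assumes fin: "finite P" and pP: "\<And>p. p \<in> P \<Longrightarrow> prime p" "\<And>p. p \<in> P \<Longrightarrow> coprime p Q"
    and d: "2 * K \<le> d" "0 < d" "\<And>p. p \<in> P \<Longrightarrow> d < p"
    and x: "1 \<le> x" "1 < Q"
  shows "(\<Sum>B\<in>Pow P. (\<Prod>p\<in>B. 1 / (real p - real K)) * lnp (x / pr B) ^ 2)
     \<le> exp (2 * real K / real d) * (real (totient Q) / real Q * (ln x ^ 3 / 3) + (real Q + 1) * ln x ^ 2)"
proof -
  have fs: "finite S" if "S \<subseteq> P" for S using that fin finite_subset by auto
  have p1: "1 \<le> p" if "p \<in> P" for p using pP(1)[OF that] prime_ge_1_nat by blast
  have pr1: "1 \<le> pr W" if "W \<subseteq> P" for W using that p1 by (auto intro!: pr_ge_1)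
  let ?k = "\<lambda>p. real K / (real p * (real p - real K))"
  have pK: "real K < real p" "real p \<le> 2 * (real p - real K)" if "p \<in> P" for p
  proof -
    have "2 * K < p" using d(1) d(3)[OF that] by linarith
    then have "2 * real K < real p" by (metis of_nat_less_iff of_nat_mult of_nat_numeral)
    then show "real K < real p" "real p \<le> 2 * (real p - real K)" by auto
  qed
  have split: "1 / (real p - real K) = ?k p + 1 / real p" if "p \<in> P" for p
    using pK[OF that] p1[OF that] by (simp add: field_simps)
  have "(\<Sum>B\<in>Pow P. (\<Prod>p\<in>B. 1 / (real p - real K)) * lnp (x / pr B) ^ 2)
      = (\<Sum>B\<in>Pow P. \<Sum>T\<in>Pow B. prod ?k T * (1 / pr (B - T)) * lnp (x / pr (T \<union> (B - T))) ^ 2)"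
  proof (rule sum.cong)
    fix B assume B: "B \<in> Pow P"
    have "(\<Prod>p\<in>B. 1 / (real p - real K)) = (\<Prod>p\<in>B. ?k p + 1 / real p)"
      using B split by (intro prod.cong) auto
    also have "\<dots> = (\<Sum>T\<in>Pow B. prod ?k T * (\<Prod>p\<in>B - T. 1 / real p))"
      using B fs by (intro prod_add) auto
    also have "\<dots> = (\<Sum>T\<in>Pow B. prod ?k T * (1 / pr (B - T)))"
      by (simp add: pr_def prod_dividef)
    finally show "(\<Prod>p\<in>B. 1 / (real p - real K)) * lnp (x / pr B) ^ 2
      = (\<Sum>T\<in>Pow B. prod ?k T * (1 / pr (B - T)) * lnp (x / pr (T \<union> (B - T))) ^ 2)"
      by (auto simp: sum_distrib_right Un_absorb1 intro!: sum.cong)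
  qed simp
  also have "\<dots> = (\<Sum>T\<in>Pow P. \<Sum>U\<in>Pow (P - T). prod ?k T * (1 / pr U) * lnp (x / pr (T \<union> U)) ^ 2)"
    by (rule sum_Pow_split[OF fin])
  also have "\<dots> \<le> (\<Sum>T\<in>Pow P. \<Sum>U\<in>Pow P. prod ?k T * (1 / pr U * lnp (x / pr U) ^ 2))"
  proof (rule sum_mono)
    fix T assume T: "T \<in> Pow P"
    have kT: "0 \<le> prod ?k T"
      using T pK by (intro prod_nonneg) (force intro!: divide_nonneg_nonneg mult_nonneg_nonneg)
    have "(\<Sum>U\<in>Pow (P - T). prod ?k T * (1 / pr U) * lnp (x / pr (T \<union> U)) ^ 2)
       \<le> (\<Sum>U\<in>Pow (P - T). prod ?k T * (1 / pr U * lnp (x / pr U) ^ 2))"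
    proof (rule sum_mono)
      fix U assume U: "U \<in> Pow (P - T)"
      have "U \<subseteq> P" using U by auto
      have "pr U \<le> pr (T \<union> U)"
        using U T p1 fs[of "T \<union> U"] by (intro pr_mono) auto
      then have "lnp (x / pr (T \<union> U)) \<le> lnp (x / pr U)"
        using x pr1[OF \<open>U \<subseteq> P\<close>] by (intro lnp_mono divide_left_mono) auto
      then have "lnp (x / pr (T \<union> U)) ^ 2 \<le> lnp (x / pr U) ^ 2" by (intro power_mono) auto
      then show "prod ?k T * (1 / pr U) * lnp (x / pr (T \<union> U)) ^ 2
         \<le> prod ?k T * (1 / pr U * lnp (x / pr U) ^ 2)"
        using kT pr1[OF \<open>U \<subseteq> P\<close>] by (simp only: mult.assoc) (intro mult_left_mono, auto)
    qed
    also have "\<dots> \<le> (\<Sum>U\<in>Pow P. prod ?k T * (1 / pr U * lnp (x / pr U) ^ 2))"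
    proof (rule sum_mono2)
      fix U assume "U \<in> Pow P - Pow (P - T)"
      then have "U \<subseteq> P" by auto
      from pr1[OF this] show "0 \<le> prod ?k T * (1 / pr U * lnp (x / pr U) ^ 2)"
        using kT by (intro mult_nonneg_nonneg) auto
    qed (use fin in auto)
    finally show "(\<Sum>U\<in>Pow (P - T). prod ?k T * (1 / pr U) * lnp (x / pr (T \<union> U)) ^ 2)
      \<le> (\<Sum>U\<in>Pow P. prod ?k T * (1 / pr U * lnp (x / pr U) ^ 2))" .
  qed
  also have "\<dots> = (\<Sum>T\<in>Pow P. prod ?k T) * (\<Sum>U\<in>Pow P. lnp (x / pr U) ^ 2 / pr U)"
    by (simp add: sum_product)
  also have "(\<Sum>T\<in>Pow P. prod ?k T) = (\<Prod>p\<in>P. 1 + ?k p)" by (rule sum_Pow_prod[OF fin])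
  also have "(\<Sum>U\<in>Pow P. lnp (x / pr U) ^ 2 / pr U) = (\<Sum>n\<in>(\<lambda>S. \<Prod>S) ` Pow P. lnp (x / real n) ^ 2 / real n)"
    by (subst sum.reindex[OF inj_on_prod_primes[OF fin pP(1)]]) (auto simp: pr_eq)
  also have "(\<Prod>p\<in>P. 1 + ?k p) * (\<Sum>n\<in>(\<lambda>S. \<Prod>S) ` Pow P. lnp (x / real n) ^ 2 / real n)
     \<le> exp (2 * real K / real d) * (real (totient Q) / real Q * (ln x ^ 3 / 3) + (real Q + 1) * ln x ^ 2)"
  proof (rule mult_mono)
    have "(\<Prod>p\<in>P. 1 + ?k p) \<le> (\<Prod>p\<in>P. exp (2 * real K * (1 / real p ^ 2)))"
    proof (rule prod_mono)
      fix p assume p: "p \<in> P"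
      have "?k p \<le> 2 * real K * (1 / real p ^ 2)"
      proof -
        have "?k p \<le> real K / (real p * (real p / 2))"
          using pK[OF p] p1[OF p] by (intro divide_left_mono mult_left_mono) auto
        also have "\<dots> = 2 * real K * (1 / real p ^ 2)" by (simp add: power2_eq_square)
        finally show ?thesis .
      qed
      moreover have "1 + 2 * real K * (1 / real p ^ 2) \<le> exp (2 * real K * (1 / real p ^ 2))"
        by (rule exp_ge_add_one_self)
      moreover have "0 \<le> ?k p" using pK[OF p] by auto
      ultimately show "0 \<le> 1 + ?k p \<and> 1 + ?k p \<le> exp (2 * real K * (1 / real p ^ 2))" by linarith
    qed
    also have "\<dots> = exp (2 * real K * (\<Sum>p\<in>P. 1 / real p ^ 2))"
      using fin by (simp add: exp_sum sum_distrib_left)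
    also have "\<dots> \<le> exp (2 * real K * (1 / real d))"
      unfolding exp_le_cancel_iff using sum_inverse_square_le[OF fin d(2,3)] by (intro mult_left_mono) auto
    finally show "(\<Prod>p\<in>P. 1 + ?k p) \<le> exp (2 * real K / real d)" by simp
    define N where "N = Max ((\<lambda>S. \<Prod>S) ` Pow P)"
    have "(\<Sum>n\<in>(\<lambda>S. \<Prod>S) ` Pow P. lnp (x / real n) ^ 2 / real n)
      \<le> (\<Sum>n\<in>{n\<in>{1..N}. coprime n Q}. lnp (x / real n) ^ 2 / real n)"
    proof (rule sum_mono2)
      show "(\<lambda>S. \<Prod>S) ` Pow P \<subseteq> {n\<in>{1..N}. coprime n Q}"
      proof clarify
        fix S assume S: "S \<subseteq> P"
        have "\<Prod>S \<le> N" unfolding N_def using S fin by (intro Max_ge) auto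
        moreover have "1 \<le> \<Prod>S" using S p1 by (intro prod_ge_1) auto
        moreover have "coprime (\<Prod>S) Q" using S pP(2) by (intro prod_coprime_left) auto
        ultimately show "\<Prod>S \<in> {1..N} \<and> coprime (\<Prod>S) Q" by simp
      qed
    qed auto
    also have "\<dots> \<le> real (totient Q) / real Q * (ln x ^ 3 / 3) + (real Q + 1) * ln x ^ 2"
      by (rule sum_coprime_log2_weight_le) (use x in auto)
    finally show "(\<Sum>n\<in>(\<lambda>S. \<Prod>S) ` Pow P. lnp (x / real n) ^ 2 / real n)
       \<le> real (totient Q) / real Q * (ln x ^ 3 / 3) + (real Q + 1) * ln x ^ 2" .
  qed (auto intro!: sum_nonneg divide_nonneg_nonneg prod_nonneg)
  finally show ?thesis .
qed

text \<open>The bound for the Chebyshev function turns \<open>ln n!\<close> into Mertens' upper bound.\<close>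
lemma mertens_upper:
  assumes theta: "\<And>n::nat. 1 \<le> n \<Longrightarrow> (\<Sum>p\<in>{p. prime p \<and> p \<le> n}. ln (real p)) \<le> B * real n"
    and x: "1 \<le> x" and P: "finite P" "\<And>p. p \<in> P \<Longrightarrow> prime p"
  shows "(\<Sum>p\<in>{p\<in>P. real p \<le> x}. ln (real p) / real p) \<le> ln x + B"
proof -
  define n where "n = nat \<lfloor>x\<rfloor>"
  have n: "1 \<le> n" "real n \<le> x" using x by (auto simp: n_def le_nat_floor)
  let ?A = "{p. prime p \<and> p \<le> n}"
  have fA: "finite ?A" by simp
  have "real n * (\<Sum>p\<in>?A. ln (real p) / real p) - (\<Sum>p\<in>?A. ln (real p))
      = (\<Sum>p\<in>?A. ln (real p) * (real n / real p - 1))"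
    by (simp add: sum_distrib_left sum_subtractf algebra_simps)
  also have "\<dots> \<le> (\<Sum>p\<in>?A. ln (real p) * real (card {m\<in>{1..n}. p dvd m}))"
  proof (intro sum_mono mult_left_mono)
    fix p assume p: "p \<in> ?A"
    then have p0: "1 \<le> p" using prime_ge_1_nat by auto
    have "card {m\<in>{1..n}. p dvd m} = card ((\<lambda>k. p * k) ` {1..n div p})"
    proof (rule arg_cong[where f = card], safe)
      fix m assume "m \<in> {1..n}" "p dvd m"
      then show "m \<in> (\<lambda>k. p * k) ` {1..n div p}"
        using p0 by (intro image_eqI[of _ _ "m div p"]) (auto simp: div_le_mono Suc_le_eq div_greater_zero_iff dvd_imp_le)
    next
      fix k assume "k \<in> {1..n div p}"
      then have "p * k \<le> p * (n div p)" "1 \<le> k" by auto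
      then have "p * k \<le> n" using times_div_less_eq_dividend[of p n] by (meson le_trans)
      then show "p * k \<in> {1..n}" using p0 \<open>1 \<le> k\<close> by (auto simp: Suc_le_eq)
    qed auto
    also have "\<dots> = n div p" using p0 by (subst card_image) (auto intro!: inj_onI)
    finally have "card {m\<in>{1..n}. p dvd m} = n div p" .
    moreover have "real n / real p - 1 \<le> real (n div p)"
    proof -
      have "n < (n div p + 1) * p"
        using p0 dividend_less_times_div[of p n] by (simp add: algebra_simps)
      then have "real n < real ((n div p + 1) * p)" by linarith
      then show ?thesis using p0 by (simp add: field_simps)
    qed
    ultimately show "real n / real p - 1 \<le> real (card {m\<in>{1..n}. p dvd m})" by simp
    show "0 \<le> ln (real p)" using p0 by simp
  qed
  also have "\<dots> = (\<Sum>p\<in>?A. \<Sum>m\<in>{1..n}. if p dvd m then ln (real p) else 0)"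
    by (simp add: sum.If_cases Int_def mult.commute)
  \<comment> \<open>Exchanging the sums gives an upper bound for each m separately: the distinct
    primes dividing m have product at most m.\<close>
  also have "\<dots> = (\<Sum>m\<in>{1..n}. \<Sum>p\<in>?A. if p dvd m then ln (real p) else 0)"
    by (rule sum.swap)
  also have "\<dots> \<le> (\<Sum>m\<in>{1..n}. ln (real n))"
  proof (rule sum_mono)
    fix m assume m: "m \<in> {1..n}"
    have "(\<Sum>p\<in>?A. if p dvd m then ln (real p) else 0) = (\<Sum>p\<in>{p\<in>?A. p dvd m}. ln (real p))"
      by (rule sum.inter_filter[OF fA, symmetric])
    also have "\<dots> = ln (\<Prod>p\<in>{p\<in>?A. p dvd m}. real p)"
      by (subst ln_prod) (auto simp: prime_gt_0_nat)
    also have "\<dots> \<le> ln (real m)"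
    proof -
      have "\<Prod>{p\<in>?A. p dvd m} \<le> m"
        using m by (intro prod_le_nat_of_prime_factors) (auto simp: prime_factors_dvd)
      then have "(\<Prod>p\<in>{p\<in>?A. p dvd m}. real p) \<le> real m"
        unfolding of_nat_prod[symmetric] of_nat_le_iff by simp
      moreover have "0 < (\<Prod>p\<in>{p\<in>?A. p dvd m}. real p)" by (intro prod_pos) (auto simp: prime_gt_0_nat)
      ultimately show ?thesis by simp
    qed
    also have "\<dots> \<le> ln (real n)" using m by simp
    finally show "(\<Sum>p\<in>?A. if p dvd m then ln (real p) else 0) \<le> ln (real n)" .
  qed
  also have "\<dots> = real n * ln (real n)" by simp
  finally have "real n * (\<Sum>p\<in>?A. ln (real p) / real p) \<le> real n * ln (real n) + B * real n"
    using theta[OF n(1)] by linarith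
  then have "real n * (\<Sum>p\<in>?A. ln (real p) / real p) \<le> real n * (ln (real n) + B)"
    by (simp add: algebra_simps)
  then have "(\<Sum>p\<in>?A. ln (real p) / real p) \<le> ln (real n) + B" using n by simp
  moreover have "(\<Sum>p\<in>{p\<in>P. real p \<le> x}. ln (real p) / real p) \<le> (\<Sum>p\<in>?A. ln (real p) / real p)"
    using P x by (intro sum_mono2) (auto simp: n_def le_nat_floor intro!: divide_nonneg_nonneg ln_ge_zero dest: prime_ge_1_nat)
  moreover have "ln (real n) \<le> ln x" using n by simp
  ultimately show ?thesis by linarith
qed

section \<open>Sums of squares of periodic functions\<close>

lemma bij_betw_mod_pair:
  assumes "coprime m n" "0 < m" "0 < (n::nat)"
  shows "bij_betw (\<lambda>b. (b mod m, b mod n)) {..<m * n} ({..<m} \<times> {..<n})"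
proof -
  have inj: "inj_on (\<lambda>b. (b mod m, b mod n)) {..<m * n}"
  proof (rule inj_onI)
    fix b b' assume *: "b \<in> {..<m * n}" "b' \<in> {..<m * n}" "(b mod m, b mod n) = (b' mod m, b' mod n)"
    then have "[b = b'] (mod m * n)"
      by (intro coprime_cong_mult_nat) (auto simp: cong_def assms)
    then show "b = b'" using * by (auto simp: cong_def)
  qed
  moreover have "(\<lambda>b. (b mod m, b mod n)) ` {..<m * n} = {..<m} \<times> {..<n}"
    using assms card_image[OF inj] by (intro card_subset_eq) auto
  ultimately show ?thesis by (simp add: bij_betw_def)
qed

lemma mod_Prod_mod: "finite W \<Longrightarrow> p \<in> W \<Longrightarrow> n mod \<Prod>W mod p = n mod (p::nat)"
  using dvd_prodI[of W p "\<lambda>x. x"] by (simp add: mod_mod_cancel)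

lemma sum_prod_residues:
  fixes F :: "nat \<Rightarrow> nat \<Rightarrow> real"
  assumes "finite W" "\<And>p. p \<in> W \<Longrightarrow> prime p"
  shows "(\<Sum>b<\<Prod>W. \<Prod>p\<in>W. F p (b mod p)) = (\<Prod>p\<in>W. \<Sum>b<p. F p b)"
  using assms
proof (induction W rule: finite_induct)
  case (insert q W)
  have q: "prime q" and pW: "\<And>p. p \<in> W \<Longrightarrow> prime p" using insert.prems by auto
  have cop: "coprime q (\<Prod>W)"
    using insert.hyps q pW by (intro prod_coprime_right) (metis primes_coprime)
  have pos: "0 < q" "0 < \<Prod>W" using q pW by (auto simp: prime_gt_0_nat intro!: prod_pos)
  have "(\<Sum>b<\<Prod>(insert q W). \<Prod>p\<in>insert q W. F p (b mod p))
      = (\<Sum>b<q * \<Prod>W. F q (b mod q) * (\<Prod>p\<in>W. F p (b mod \<Prod>W mod p)))"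
    using insert.hyps
    by (intro sum.cong) (auto intro!: prod.cong arg_cong2[where f = "(*)"] simp: mod_Prod_mod)
  also have "\<dots> = (\<Sum>(i,j)\<in>{..<q} \<times> {..<\<Prod>W}. F q i * (\<Prod>p\<in>W. F p (j mod p)))"
    using sum.reindex_bij_betw[OF bij_betw_mod_pair[OF cop pos], of "\<lambda>(i,j). F q i * (\<Prod>p\<in>W. F p (j mod p))"]
    by simp
  also have "\<dots> = (\<Sum>i<q. F q i) * (\<Sum>j<\<Prod>W. \<Prod>p\<in>W. F p (j mod p))"
    by (simp only: sum_product sum.cartesian_product)
  finally show ?case using insert by simp
qed simp

text \<open>A sum of a product of periodic functions depends only on the distribution of
  \<open>a\<close> in residue classes modulo the product of W. By the Chinese remainder theorem both
  the main term and the error factor over the primes. The error involves the l1 norms of the local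
  functions, so these must be bounded independently of p.\<close>

lemma sum_prod_periodic:
  fixes u \<gamma> :: "nat \<Rightarrow> nat \<Rightarrow> real" and a :: "nat \<Rightarrow> real"
  assumes "finite I" "finite W" "\<And>p. p \<in> W \<Longrightarrow> prime p"
    and per: "\<And>p n. p \<in> W \<Longrightarrow> u p (n mod p) = u p n"
    and E: "\<And>b. b < \<Prod>W \<Longrightarrow> \<bar>(\<Sum>n\<in>{n\<in>I. n mod \<Prod>W = b}. a n) - X * (\<Prod>p\<in>W. \<gamma> p (b mod p))\<bar> \<le> E"
  shows "\<bar>(\<Sum>n\<in>I. a n * (\<Prod>p\<in>W. u p n)) - X * (\<Prod>p\<in>W. \<Sum>b<p. \<gamma> p b * u p b)\<bar>
    \<le> E * (\<Prod>p\<in>W. \<Sum>b<p. \<bar>u p b\<bar>)"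
proof -
  let ?q = "\<Prod>W"
  have pos: "0 < ?q" using assms(3) by (auto simp: prime_gt_0_nat intro!: prod_pos)
  have "(\<Sum>n\<in>I. a n * (\<Prod>p\<in>W. u p n)) = (\<Sum>b<?q. \<Sum>n\<in>{n\<in>I. n mod ?q = b}. a n * (\<Prod>p\<in>W. u p n))"
    using assms(1) pos by (intro sum.group[symmetric]) auto
  also have "\<dots> = (\<Sum>b<?q. (\<Sum>n\<in>{n\<in>I. n mod ?q = b}. a n) * (\<Prod>p\<in>W. u p (b mod p)))"
    unfolding sum_distrib_right
  proof (intro sum.cong refl)
    fix b n assume "b \<in> {..<?q}" and n: "n \<in> {n\<in>I. n mod ?q = b}"
    have "(\<Prod>p\<in>W. u p n) = (\<Prod>p\<in>W. u p (b mod p))"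
    proof (rule prod.cong)
      fix p assume p: "p \<in> W"
      have "b mod p = n mod p" using n p assms(2) by (auto simp: mod_Prod_mod)
      then show "u p n = u p (b mod p)" using per[OF p] by simp
    qed simp
    then show "a n * (\<Prod>p\<in>W. u p n) = a n * (\<Prod>p\<in>W. u p (b mod p))" by simp
  qed
  finally have 1: "(\<Sum>n\<in>I. a n * (\<Prod>p\<in>W. u p n))
      = (\<Sum>b<?q. (\<Sum>n\<in>{n\<in>I. n mod ?q = b}. a n) * (\<Prod>p\<in>W. u p (b mod p)))" .
  have 2: "X * (\<Prod>p\<in>W. \<Sum>b<p. \<gamma> p b * u p b)
      = (\<Sum>b<?q. X * (\<Prod>p\<in>W. \<gamma> p (b mod p)) * (\<Prod>p\<in>W. u p (b mod p)))"
    using sum_prod_residues[OF assms(2,3), of "\<lambda>p b. \<gamma> p b * u p b"]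
    by (simp add: prod.distrib sum_distrib_left[symmetric] mult.assoc)
  have "\<bar>(\<Sum>n\<in>I. a n * (\<Prod>p\<in>W. u p n)) - X * (\<Prod>p\<in>W. \<Sum>b<p. \<gamma> p b * u p b)\<bar>
     = \<bar>\<Sum>b<?q. ((\<Sum>n\<in>{n\<in>I. n mod ?q = b}. a n) - X * (\<Prod>p\<in>W. \<gamma> p (b mod p))) * (\<Prod>p\<in>W. u p (b mod p))\<bar>"
    unfolding 1 2 by (simp only: sum_subtractf left_diff_distrib)
  also have "\<dots> \<le> (\<Sum>b<?q. E * (\<Prod>p\<in>W. \<bar>u p (b mod p)\<bar>))"
    by (intro order.trans[OF sum_abs] sum_mono)
       (auto simp: abs_mult abs_prod intro!: mult_right_mono E prod_nonneg)
  also have "\<dots> = E * (\<Prod>p\<in>W. \<Sum>b<p. \<bar>u p b\<bar>)"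
    using sum_prod_residues[OF assms(2,3), of "\<lambda>p b. \<bar>u p b\<bar>"] by (simp add: sum_distrib_left[symmetric])
  finally show ?thesis .
qed

section \<open>Expansion of the sieve weight in the local basis\<close>

definition disj_pairs :: "'a set \<Rightarrow> ('a set \<times> 'a set) set" where
  "disj_pairs P = {(S, T). S \<subseteq> P \<and> T \<subseteq> P \<and> S \<inter> T = {}}"

lemma finite_disj_pairs [simp]: "finite P \<Longrightarrow> finite (disj_pairs P)"
  by (rule finite_subset[of _ "Pow P \<times> Pow P"]) (auto simp: disj_pairs_def)

lemma sum_disj_pairs:
  assumes "finite P"
  shows "(\<Sum>(S,T)\<in>disj_pairs P. g S T) = (\<Sum>S\<in>Pow P. \<Sum>T\<in>Pow (P - S). g S T)"
proof -
  have "disj_pairs P = Sigma (Pow P) (\<lambda>S. Pow (P - S))" by (auto simp: disj_pairs_def)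
  then show ?thesis using assms by (subst sum.Sigma) auto
qed

text \<open>At every prime one of the three functions 1, \<psi>, \<phi> is chosen: \<open>S\<close>
  collects the primes with \<psi>, \<open>T\<close> those with \<phi>, hence the disjointness.
  \<psi> will see the shifts \<open>Hs\<close>, and \<phi> the centre.\<close>

definition sieve_fun ::
  "nat set \<Rightarrow> (nat set \<Rightarrow> nat set \<Rightarrow> real) \<Rightarrow> (nat \<Rightarrow> nat \<Rightarrow> real) \<Rightarrow> (nat \<Rightarrow> nat \<Rightarrow> real) \<Rightarrow> nat \<Rightarrow> real" where
  "sieve_fun P Y \<psi> \<phi> n = (\<Sum>(S,T)\<in>disj_pairs P. Y S T * ((\<Prod>p\<in>S. \<psi> p n) * (\<Prod>p\<in>T. \<phi> p n)))"

text \<open>Two index pairs are four subsets of their union, so each prime has at most 2^4 patterns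
  of membership.\<close>

lemma sum_unions_le:
  fixes g :: "nat set \<Rightarrow> real"
  assumes "finite P" "\<And>W. W \<subseteq> P \<Longrightarrow> 0 \<le> g W"
  shows "(\<Sum>x\<in>{x\<in>disj_pairs P \<times> disj_pairs P. Q (fst (fst x) \<union> snd (fst x) \<union> (fst (snd x) \<union> snd (snd x)))}.
            g (fst (fst x) \<union> snd (fst x) \<union> (fst (snd x) \<union> snd (snd x))))
    \<le> (\<Sum>W\<in>{W\<in>Pow P. Q W}. 16 ^ card W * g W)"
proof -
  let ?w = "\<lambda>x :: (nat set \<times> nat set) \<times> (nat set \<times> nat set). fst (fst x) \<union> snd (fst x) \<union> (fst (snd x) \<union> snd (snd x))"
  let ?X = "{x\<in>disj_pairs P \<times> disj_pairs P. Q (?w x)}"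
  have "finite (disj_pairs P \<times> disj_pairs P)" using assms(1) by simp
  then have fX: "finite ?X" by (rule rev_finite_subset) blast
  have "(\<Sum>x\<in>?X. g (?w x)) = (\<Sum>W\<in>{W\<in>Pow P. Q W}. \<Sum>x\<in>{x\<in>?X. ?w x = W}. g (?w x))"
    using assms(1) by (intro sum.group[symmetric] fX) (auto simp: disj_pairs_def)
  also have "\<dots> \<le> (\<Sum>W\<in>{W\<in>Pow P. Q W}. 16 ^ card W * g W)"
  proof (rule sum_mono)
    fix W assume W: "W \<in> {W\<in>Pow P. Q W}"
    then have fW: "finite W" using assms(1) finite_subset by auto
    have "card {x\<in>?X. ?w x = W} \<le> card ((Pow W \<times> Pow W) \<times> (Pow W \<times> Pow W))"
      using fW by (intro card_mono) auto
    also have "\<dots> = 16 ^ card W"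
      using fW by (simp add: card_cartesian_product card_Pow power_mult_distrib[symmetric])
    finally have "real (card {x\<in>?X. ?w x = W}) \<le> real (16 ^ card W)" by (rule of_nat_mono)
    then have "real (card {x\<in>?X. ?w x = W}) \<le> 16 ^ card W" unfolding of_nat_power of_nat_numeral .
    moreover have "(\<Sum>x\<in>{x\<in>?X. ?w x = W}. g (?w x)) = (\<Sum>x\<in>{x\<in>?X. ?w x = W}. g W)"
      by (intro sum.cong refl) blast
    then have "(\<Sum>x\<in>{x\<in>?X. ?w x = W}. g (?w x)) = real (card {x\<in>?X. ?w x = W}) * g W"
      by (simp only: sum_constant)
    ultimately show "(\<Sum>x\<in>{x\<in>?X. ?w x = W}. g (?w x)) \<le> 16 ^ card W * g W"
      using assms(2)[of W] W by (metis (no_types, lifting) mem_Collect_eq PowD mult_right_mono)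
  qed
  finally show ?thesis .
qed

text \<open>The functions \<open>1\<close>, \<open>\<psi> p\<close>, \<open>\<phi> p\<close> are orthogonal with respect to the local density \<open>\<gamma> p\<close>, so
  the main term is diagonal.\<close>
lemma sieve_square_sum:
  fixes \<psi> \<phi> \<gamma> :: "nat \<Rightarrow> nat \<Rightarrow> real" and a :: "nat \<Rightarrow> real" and h\<psi> h\<phi> :: "nat \<Rightarrow> real"
  assumes fin: "finite I" "finite P" and pP: "\<And>p. p \<in> P \<Longrightarrow> prime p"
    and per: "\<And>p n. p \<in> P \<Longrightarrow> \<psi> p (n mod p) = \<psi> p n" "\<And>p n. p \<in> P \<Longrightarrow> \<phi> p (n mod p) = \<phi> p n"
    and bd: "\<And>p n. p \<in> P \<Longrightarrow> \<bar>\<psi> p n\<bar> \<le> 1" "\<And>p n. p \<in> P \<Longrightarrow> \<bar>\<phi> p n\<bar> \<le> 1"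
    and C0: "\<And>p. p \<in> P \<Longrightarrow> (\<Sum>b<p. \<bar>\<psi> p b\<bar>) \<le> C" "\<And>p. p \<in> P \<Longrightarrow> (\<Sum>b<p. \<bar>\<phi> p b\<bar>) \<le> C"
    and orth: "\<And>p. p \<in> P \<Longrightarrow> (\<Sum>b<p. \<gamma> p b * \<psi> p b) = 0" "\<And>p. p \<in> P \<Longrightarrow> (\<Sum>b<p. \<gamma> p b * \<phi> p b) = 0"
      "\<And>p. p \<in> P \<Longrightarrow> (\<Sum>b<p. \<gamma> p b * (\<psi> p b * \<phi> p b)) = 0"
      "\<And>p. p \<in> P \<Longrightarrow> (\<Sum>b<p. \<gamma> p b * (\<psi> p b)\<^sup>2) = h\<psi> p" "\<And>p. p \<in> P \<Longrightarrow> (\<Sum>b<p. \<gamma> p b * (\<phi> p b)\<^sup>2) = h\<phi> p"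
    and supp: "\<And>S T. S \<subseteq> P \<Longrightarrow> T \<subseteq> P \<Longrightarrow> Y S T \<noteq> 0 \<Longrightarrow> pr S * pr T \<le> L"
    and Ym: "\<And>S T. S \<subseteq> P \<Longrightarrow> T \<subseteq> P \<Longrightarrow> \<bar>Y S T\<bar> \<le> Ym * 2 ^ card S"
    and E: "\<And>W b. W \<subseteq> P \<Longrightarrow> pr W \<le> L\<^sup>2 \<Longrightarrow> b < \<Prod>W \<Longrightarrow>
        \<bar>(\<Sum>n\<in>{n\<in>I. n mod \<Prod>W = b}. a n) - X * (\<Prod>p\<in>W. \<gamma> p (b mod p))\<bar> \<le> E W"
    and E0: "\<And>W. W \<subseteq> P \<Longrightarrow> 0 \<le> E W"
  shows "\<bar>(\<Sum>n\<in>I. a n * (sieve_fun P Y \<psi> \<phi> n)\<^sup>2)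
           - X * (\<Sum>(S,T)\<in>disj_pairs P. (Y S T)\<^sup>2 * (prod h\<psi> S * prod h\<phi> T))\<bar>
     \<le> Ym\<^sup>2 * (\<Sum>W\<in>{W\<in>Pow P. pr W \<le> L\<^sup>2}. (64 * C) ^ card W * E W)"
proof -
  let ?D = "disj_pairs P"
  define w :: "(nat set \<times> nat set) \<times> (nat set \<times> nat set) \<Rightarrow> nat set"
    where "w x = fst (fst x) \<union> snd (fst x) \<union> (fst (snd x) \<union> snd (snd x))" for x
  define e :: "nat set \<times> nat set \<Rightarrow> nat \<Rightarrow> nat \<Rightarrow> real"
    where "e x p n = (if p \<in> fst x then \<psi> p n else if p \<in> snd x then \<phi> p n else 1)" for x p n
  define y where "y x = Y (fst x) (snd x)" for x
  have fs: "finite S" if "S \<subseteq> P" for S using that fin finite_subset by auto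
  have p1: "1 \<le> p" if "p \<in> P" for p using pP[OF that] prime_ge_1_nat by blast
  have wP: "w x \<subseteq> P" if "x \<in> ?D \<times> ?D" for x using that by (auto simp: w_def disj_pairs_def)
  have C1: "0 \<le> C" if "p \<in> P" for p using C0(1)[OF that] by (meson abs_ge_zero order.trans sum_nonneg)
  have prode: "(\<Prod>p\<in>W. e x p n) = (\<Prod>p\<in>fst x. \<psi> p n) * (\<Prod>p\<in>snd x. \<phi> p n)"
    if x: "x \<in> ?D" and W: "fst x \<union> snd x \<subseteq> W" "W \<subseteq> P" for x W n
  proof -
    have "(\<Prod>p\<in>W. e x p n) = (\<Prod>p\<in>fst x \<union> snd x. e x p n)"
      using W fs[OF W(2)] by (intro prod.mono_neutral_right) (auto simp: e_def)
    also have "\<dots> = (\<Prod>p\<in>fst x. e x p n) * (\<Prod>p\<in>snd x. e x p n)"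
      using x fs by (intro prod.union_disjoint) (auto simp: disj_pairs_def)
    also have "(\<Prod>p\<in>fst x. e x p n) = (\<Prod>p\<in>fst x. \<psi> p n)"
      by (intro prod.cong) (auto simp: e_def)
    also have "(\<Prod>p\<in>snd x. e x p n) = (\<Prod>p\<in>snd x. \<phi> p n)"
      using x by (intro prod.cong) (auto simp: e_def disj_pairs_def)
    finally show ?thesis .
  qed
  have sq: "(sieve_fun P Y \<psi> \<phi> n)\<^sup>2
      = (\<Sum>x\<in>?D \<times> ?D. y (fst x) * y (snd x) * (\<Prod>p\<in>w x. e (fst x) p n * e (snd x) p n))" for n
  proof -
    have "(sieve_fun P Y \<psi> \<phi> n)\<^sup>2 = (\<Sum>x\<in>?D. \<Sum>x'\<in>?D.
        (y x * ((\<Prod>p\<in>fst x. \<psi> p n) * (\<Prod>p\<in>snd x. \<phi> p n))) * (y x' * ((\<Prod>p\<in>fst x'. \<psi> p n) * (\<Prod>p\<in>snd x'. \<phi> p n))))"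
      unfolding power2_eq_square sieve_fun_def y_def split_beta sum_product ..
    also have "\<dots> = (\<Sum>x\<in>?D \<times> ?D. (y (fst x) * ((\<Prod>p\<in>fst (fst x). \<psi> p n) * (\<Prod>p\<in>snd (fst x). \<phi> p n))) *
         (y (snd x) * ((\<Prod>p\<in>fst (snd x). \<psi> p n) * (\<Prod>p\<in>snd (snd x). \<phi> p n))))"
      by (simp only: sum.cartesian_product' fst_conv snd_conv)
    also have "\<dots> = (\<Sum>x\<in>?D \<times> ?D. y (fst x) * y (snd x) * (\<Prod>p\<in>w x. e (fst x) p n * e (snd x) p n))"
    proof (rule sum.cong)
      fix x assume x: "x \<in> ?D \<times> ?D"
      have "(\<Prod>p\<in>w x. e (fst x) p n) = (\<Prod>p\<in>fst (fst x). \<psi> p n) * (\<Prod>p\<in>snd (fst x). \<phi> p n)"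
        by (rule prode) (use x wP[OF x] in \<open>auto simp: w_def\<close>)
      moreover have "(\<Prod>p\<in>w x. e (snd x) p n) = (\<Prod>p\<in>fst (snd x). \<psi> p n) * (\<Prod>p\<in>snd (snd x). \<phi> p n)"
        by (rule prode) (use x wP[OF x] in \<open>auto simp: w_def\<close>)
      ultimately show "(y (fst x) * ((\<Prod>p\<in>fst (fst x). \<psi> p n) * (\<Prod>p\<in>snd (fst x). \<phi> p n))) *
         (y (snd x) * ((\<Prod>p\<in>fst (snd x). \<psi> p n) * (\<Prod>p\<in>snd (snd x). \<phi> p n)))
         = y (fst x) * y (snd x) * (\<Prod>p\<in>w x. e (fst x) p n * e (snd x) p n)"
        by (simp add: prod.distrib mult_ac)
    qed simp
    finally show ?thesis .
  qed
  have loc: "(\<Prod>p\<in>w x. \<Sum>b<p. \<gamma> p b * (e (fst x) p b * e (snd x) p b))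
      = (if fst x = snd x then prod h\<psi> (fst (fst x)) * prod h\<phi> (snd (fst x)) else 0)"
    if x: "x \<in> ?D \<times> ?D" for x
  proof (cases "fst x = snd x")
    case True
    have f: "finite (fst (fst x))" "finite (snd (fst x))" "fst (fst x) \<subseteq> P" "snd (fst x) \<subseteq> P"
      "fst (fst x) \<inter> snd (fst x) = {}"
      using x fs by (auto simp: disj_pairs_def)
    have "(\<Prod>p\<in>w x. \<Sum>b<p. \<gamma> p b * (e (fst x) p b * e (snd x) p b))
       = (\<Prod>p\<in>fst (fst x) \<union> snd (fst x). \<Sum>b<p. \<gamma> p b * (e (fst x) p b)\<^sup>2)"
      using True by (auto simp: w_def power2_eq_square)
    also have "\<dots> = (\<Prod>p\<in>fst (fst x). \<Sum>b<p. \<gamma> p b * (e (fst x) p b)\<^sup>2) * (\<Prod>p\<in>snd (fst x). \<Sum>b<p. \<gamma> p b * (e (fst x) p b)\<^sup>2)"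
      using f by (intro prod.union_disjoint) auto
    also have "(\<Prod>p\<in>fst (fst x). \<Sum>b<p. \<gamma> p b * (e (fst x) p b)\<^sup>2) = prod h\<psi> (fst (fst x))"
    proof (rule prod.cong)
      fix p assume "p \<in> fst (fst x)"
      then show "(\<Sum>b<p. \<gamma> p b * (e (fst x) p b)\<^sup>2) = h\<psi> p" using f orth(4)[of p] by (auto simp: e_def)
    qed simp
    also have "(\<Prod>p\<in>snd (fst x). \<Sum>b<p. \<gamma> p b * (e (fst x) p b)\<^sup>2) = prod h\<phi> (snd (fst x))"
    proof (rule prod.cong)
      fix p assume "p \<in> snd (fst x)"
      moreover then have "p \<notin> fst (fst x)" using f by auto
      ultimately show "(\<Sum>b<p. \<gamma> p b * (e (fst x) p b)\<^sup>2) = h\<phi> p" using f orth(5)[of p] by (auto simp: e_def)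
    qed simp
    finally show ?thesis using True by simp
  next
    case False
    \<comment> \<open>Distinct index pairs differ at some prime. There two different members of the
      orthogonal triple 1, \<psi>, \<phi> meet and the local factor is 0.\<close>
    then obtain p where p: "p \<in> w x" "(p \<in> fst (fst x)) \<noteq> (p \<in> fst (snd x)) \<or> (p \<in> snd (fst x)) \<noteq> (p \<in> snd (snd x))"
      unfolding w_def prod_eq_iff by blast
    have pP': "p \<in> P" using p(1) wP[OF x] by auto
    have dis: "\<not> (p \<in> fst (fst x) \<and> p \<in> snd (fst x))" "\<not> (p \<in> fst (snd x) \<and> p \<in> snd (snd x))"
      using x by (auto simp: disj_pairs_def)
    have "(\<Sum>b<p. \<gamma> p b * (\<phi> p b * \<psi> p b)) = 0" using orth(3)[OF pP'] by (simp add: mult.commute)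
    then have "(\<Sum>b<p. \<gamma> p b * (e (fst x) p b * e (snd x) p b)) = 0"
      using p dis orth(1-3)[OF pP'] unfolding e_def
      by (cases "p \<in> fst (fst x)"; cases "p \<in> snd (fst x)"; cases "p \<in> fst (snd x)"; cases "p \<in> snd (snd x)"; simp)
    then have "(\<Prod>p\<in>w x. \<Sum>b<p. \<gamma> p b * (e (fst x) p b * e (snd x) p b)) = 0"
      using p(1) fs[OF wP[OF x]] by (intro prod_zero) auto
    then show ?thesis using False by simp
  qed
  \<comment> \<open>Each index pair spans a number at most L, so squaring the weight leads to moduli
    up to the square of L. This is why \<open>R\<close> will have exponent half the level of
    distribution.\<close>
  have wle: "pr (w x) \<le> L\<^sup>2" if x: "x \<in> ?D \<times> ?D" and y0: "y (fst x) * y (snd x) \<noteq> 0" for x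
  proof -
    have sub: "fst (fst x) \<subseteq> P" "snd (fst x) \<subseteq> P" "fst (snd x) \<subseteq> P" "snd (snd x) \<subseteq> P"
      using x by (auto simp: disj_pairs_def)
    have 1: "pr (S \<union> T) \<le> L" "0 \<le> pr (S \<union> T)" if "S \<subseteq> P" "T \<subseteq> P" "Y S T \<noteq> 0" for S T
    proof -
      have "pr (S \<union> T) \<le> pr S * pr T" using that fs p1 by (intro pr_Un_le) auto
      also have "\<dots> \<le> L" using that by (intro supp)
      finally show "pr (S \<union> T) \<le> L" .
      show "0 \<le> pr (S \<union> T)" by (simp add: pr_def prod_nonneg)
    qed
    have "pr (w x) \<le> pr (fst (fst x) \<union> snd (fst x)) * pr (fst (snd x) \<union> snd (snd x))"
      unfolding w_def using sub fs p1 by (intro pr_Un_le) (auto simp: subset_iff)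
    also have "\<dots> \<le> L * L"
      using y0 1[OF sub(1,2)] 1[OF sub(3,4)] by (intro mult_mono) (auto simp: y_def)
    finally show ?thesis by (simp add: power2_eq_square)
  qed
  \<comment> \<open>At a prime of \<open>w x\<close> at least one of the two factors is \<psi> or
    \<phi>, with bounded l1 norm; the other is at most 1 in absolute value. The constant function
    alone would have norm p.\<close>
  have eb: "(\<Sum>b<p. \<bar>e (fst x) p b * e (snd x) p b\<bar>) \<le> C" if x: "x \<in> ?D \<times> ?D" "p \<in> w x" for x p
  proof -
    have p: "p \<in> P" using wP[OF that(1)] that(2) by blast
    have e1: "\<bar>e z p b\<bar> \<le> 1" for z b using bd[OF p] by (auto simp: e_def)
    have *: "(\<Sum>b<p. \<bar>e z p b\<bar>) \<le> C" if "p \<in> fst z \<union> snd z" for z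
      using that C0[OF p] by (cases "p \<in> fst z") (auto simp: e_def)
    consider "p \<in> fst (fst x) \<union> snd (fst x)" | "p \<in> fst (snd x) \<union> snd (snd x)" using x(2) by (auto simp: w_def)
    then show ?thesis
    proof cases
      case 1
      have "(\<Sum>b<p. \<bar>e (fst x) p b * e (snd x) p b\<bar>) \<le> (\<Sum>b<p. \<bar>e (fst x) p b\<bar> * 1)"
        unfolding abs_mult using e1 by (intro sum_mono mult_left_mono) auto
      then show ?thesis using *[OF 1] by simp
    next
      case 2
      have "(\<Sum>b<p. \<bar>e (fst x) p b * e (snd x) p b\<bar>) \<le> (\<Sum>b<p. 1 * \<bar>e (snd x) p b\<bar>)"
        unfolding abs_mult using e1 by (intro sum_mono mult_right_mono) auto
      then show ?thesis using *[OF 2] by simp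
    qed
  qed
  have trm: "\<bar>(\<Sum>n\<in>I. a n * (y (fst x) * y (snd x) * (\<Prod>p\<in>w x. e (fst x) p n * e (snd x) p n)))
       - X * (if fst x = snd x then (y (fst x))\<^sup>2 * (prod h\<psi> (fst (fst x)) * prod h\<phi> (snd (fst x))) else 0)\<bar>
      \<le> (if pr (w x) \<le> L\<^sup>2 then Ym\<^sup>2 * ((4 * C) ^ card (w x) * E (w x)) else 0)"
    if x: "x \<in> ?D \<times> ?D" for x
  proof (cases "y (fst x) * y (snd x) = 0")
    case True
    have "0 \<le> (4 * C) ^ card (w x)"
      using C1 wP[OF x] by (cases "w x = {}") (auto intro!: zero_le_power)
    moreover have "(if fst x = snd x then (y (fst x))\<^sup>2 * (prod h\<psi> (fst (fst x)) * prod h\<phi> (snd (fst x))) else 0) = 0"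
      using True by auto
    ultimately show ?thesis using True E0[OF wP[OF x]] by auto
  next
    case False
    note le = wle[OF x False]
    have sub: "fst (fst x) \<subseteq> P" "snd (fst x) \<subseteq> P" "fst (snd x) \<subseteq> P" "snd (snd x) \<subseteq> P"
      using x by (auto simp: disj_pairs_def)
    have perx: "e (fst x) p (n mod p) * e (snd x) p (n mod p) = e (fst x) p n * e (snd x) p n" if "p \<in> w x" for p n
      using that wP[OF x] per by (auto simp: e_def)
    have main: "\<bar>(\<Sum>n\<in>I. a n * (\<Prod>p\<in>w x. e (fst x) p n * e (snd x) p n))
        - X * (\<Prod>p\<in>w x. \<Sum>b<p. \<gamma> p b * (e (fst x) p b * e (snd x) p b))\<bar>
        \<le> E (w x) * (\<Prod>p\<in>w x. \<Sum>b<p. \<bar>e (fst x) p b * e (snd x) p b\<bar>)"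
      by (rule sum_prod_periodic[OF fin(1) fs[OF wP[OF x]]])
         (use pP wP[OF x] perx E[OF wP[OF x] le] in auto)
    have "\<bar>(\<Sum>n\<in>I. a n * (y (fst x) * y (snd x) * (\<Prod>p\<in>w x. e (fst x) p n * e (snd x) p n)))
       - X * (if fst x = snd x then (y (fst x))\<^sup>2 * (prod h\<psi> (fst (fst x)) * prod h\<phi> (snd (fst x))) else 0)\<bar>
      = \<bar>y (fst x) * y (snd x)\<bar> * \<bar>(\<Sum>n\<in>I. a n * (\<Prod>p\<in>w x. e (fst x) p n * e (snd x) p n))
        - X * (\<Prod>p\<in>w x. \<Sum>b<p. \<gamma> p b * (e (fst x) p b * e (snd x) p b))\<bar>"
      unfolding loc[OF x] abs_mult[symmetric]
      by (auto simp: sum_distrib_left right_diff_distrib power2_eq_square mult_ac)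
    also have "\<dots> \<le> (Ym\<^sup>2 * 4 ^ card (w x)) * (E (w x) * C ^ card (w x))"
    proof (rule mult_mono)
      have cs: "card (fst (fst x)) \<le> card (w x)" "card (fst (snd x)) \<le> card (w x)"
        using fs[OF wP[OF x]] by (auto simp: w_def intro!: card_mono)
      have Ym0: "0 \<le> Ym" using Ym[of "{}" "{}"] by simp
      have "\<bar>y (fst x)\<bar> \<le> Ym * 2 ^ card (w x)"
        unfolding y_def using cs Ym0
        by (intro order.trans[OF Ym[OF sub(1,2)]] mult_left_mono power_increasing) auto
      moreover have "\<bar>y (snd x)\<bar> \<le> Ym * 2 ^ card (w x)"
        unfolding y_def using cs Ym0
        by (intro order.trans[OF Ym[OF sub(3,4)]] mult_left_mono power_increasing) auto
      ultimately have "\<bar>y (fst x) * y (snd x)\<bar> \<le> (Ym * 2 ^ card (w x)) * (Ym * 2 ^ card (w x))"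
        unfolding abs_mult using Ym0 by (intro mult_mono) auto
      also have "\<dots> = Ym\<^sup>2 * 4 ^ card (w x)"
        by (simp add: power2_eq_square power_mult_distrib[symmetric] mult_ac)
      finally show "\<bar>y (fst x) * y (snd x)\<bar> \<le> Ym\<^sup>2 * 4 ^ card (w x)" .
      have "(\<Prod>p\<in>w x. \<Sum>b<p. \<bar>e (fst x) p b * e (snd x) p b\<bar>) \<le> (\<Prod>p\<in>w x. C)"
        using eb[OF x] by (intro prod_mono) (auto intro!: sum_nonneg)
      then show "\<bar>(\<Sum>n\<in>I. a n * (\<Prod>p\<in>w x. e (fst x) p n * e (snd x) p n))
        - X * (\<Prod>p\<in>w x. \<Sum>b<p. \<gamma> p b * (e (fst x) p b * e (snd x) p b))\<bar> \<le> E (w x) * C ^ card (w x)"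
        using main E0[OF wP[OF x]] by (auto intro: order.trans mult_left_mono)
    qed auto
    also have "\<dots> = Ym\<^sup>2 * ((4 * C) ^ card (w x) * E (w x))" by (simp add: power_mult_distrib mult_ac)
    finally show ?thesis using le by simp
  qed
  have lhs: "(\<Sum>n\<in>I. a n * (sieve_fun P Y \<psi> \<phi> n)\<^sup>2)
    = (\<Sum>x\<in>?D \<times> ?D. \<Sum>n\<in>I. a n * (y (fst x) * y (snd x) * (\<Prod>p\<in>w x. e (fst x) p n * e (snd x) p n)))"
    unfolding sq sum_distrib_left by (rule sum.swap)
  have diag: "(\<Sum>(S,T)\<in>?D. (Y S T)\<^sup>2 * (prod h\<psi> S * prod h\<phi> T))
    = (\<Sum>x\<in>?D \<times> ?D. if fst x = snd x then (y (fst x))\<^sup>2 * (prod h\<psi> (fst (fst x)) * prod h\<phi> (snd (fst x))) else 0)"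
  proof -
    have "(\<Sum>x\<in>?D \<times> ?D. if fst x = snd x then (y (fst x))\<^sup>2 * (prod h\<psi> (fst (fst x)) * prod h\<phi> (snd (fst x))) else 0)
      = (\<Sum>x\<in>?D. \<Sum>x'\<in>?D. if x = x' then (y x)\<^sup>2 * (prod h\<psi> (fst x) * prod h\<phi> (snd x)) else 0)"
      by (simp only: sum.cartesian_product' fst_conv snd_conv)
    also have "\<dots> = (\<Sum>x\<in>?D. (y x)\<^sup>2 * (prod h\<psi> (fst x) * prod h\<phi> (snd x)))"
      using fin by (intro sum.cong) auto
    finally show ?thesis by (simp add: y_def split_beta)
  qed
  have "\<bar>(\<Sum>n\<in>I. a n * (sieve_fun P Y \<psi> \<phi> n)\<^sup>2)
           - X * (\<Sum>(S,T)\<in>disj_pairs P. (Y S T)\<^sup>2 * (prod h\<psi> S * prod h\<phi> T))\<bar>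
    \<le> (\<Sum>x\<in>?D \<times> ?D. if pr (w x) \<le> L\<^sup>2 then Ym\<^sup>2 * ((4 * C) ^ card (w x) * E (w x)) else 0)"
    unfolding lhs diag sum_distrib_left[where r = X] sum_subtractf[symmetric]
    by (intro order.trans[OF sum_abs] sum_mono trm)
  also have "\<dots> = (\<Sum>x\<in>{x\<in>?D \<times> ?D. pr (w x) \<le> L\<^sup>2}. Ym\<^sup>2 * ((4 * C) ^ card (w x) * E (w x)))"
    using fin by (intro sum.inter_filter[symmetric]) auto
  also have "\<dots> \<le> (\<Sum>W\<in>{W\<in>Pow P. pr W \<le> L\<^sup>2}. 16 ^ card W * (Ym\<^sup>2 * ((4 * C) ^ card W * E W)))"
    unfolding w_def
  proof (rule sum_unions_le[OF fin(2)])
    fix W assume W: "W \<subseteq> P"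
    have "0 \<le> (4 * C) ^ card W"
      using C1 W by (cases "W = {}") (auto intro!: zero_le_power)
    then show "0 \<le> Ym\<^sup>2 * ((4 * C) ^ card W * E W)" using E0[OF W] by simp
  qed
  \<comment> \<open>64 = 16 * 4: sixteen membership patterns for each prime, and a factor 2 for each
    prime in each of the two coefficients.\<close>
  also have "\<dots> = Ym\<^sup>2 * (\<Sum>W\<in>{W\<in>Pow P. pr W \<le> L\<^sup>2}. (64 * C) ^ card W * E W)"
  proof -
    have eq: "16 ^ k * (Ym\<^sup>2 * ((4 * C) ^ k * z)) = Ym\<^sup>2 * ((64 * C) ^ k * z)" for k z
    proof -
      have "(64 * C) ^ k = (16 * (4 * C)) ^ k" by simp
      also have "\<dots> = 16 ^ k * (4 * C) ^ k" by (rule power_mult_distrib)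
      finally have *: "(64 * C) ^ k = 16 ^ k * (4 * C) ^ k" .
      show ?thesis unfolding * by (simp only: mult.left_commute mult.assoc)
    qed
    show ?thesis unfolding sum_distrib_left by (intro sum.cong refl eq)
  qed
  finally show ?thesis .
qed

section \<open>Change of basis\<close>

text \<open>Expand the product of affine expressions over S and collect the terms in which \<psi>'
  is chosen on A; the constants chosen on M = S - A sum into the new coefficient. With \<alpha> =
  1/(p - 1) this is Selberg's passage to the coefficients adapted to primes.\<close>

lemma sieve_fun_affine:
  fixes \<psi> \<psi>' :: "nat \<Rightarrow> nat \<Rightarrow> real"
  assumes fin: "finite P" and eq: "\<And>p. p \<in> P \<Longrightarrow> \<psi> p n = \<beta> p * \<psi>' p n + \<alpha> p"
  shows "sieve_fun P Y \<psi> \<phi> n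
    = sieve_fun P (\<lambda>S T. prod \<beta> S * (\<Sum>M\<in>Pow (P - T - S). prod \<alpha> M * Y (S \<union> M) T)) \<psi>' \<phi> n"
proof -
  have "sieve_fun P Y \<psi> \<phi> n = (\<Sum>T\<in>Pow P. \<Sum>S\<in>Pow (P - T). Y S T * ((\<Prod>p\<in>S. \<psi> p n) * (\<Prod>p\<in>T. \<phi> p n)))"
    unfolding sieve_fun_def sum_disj_pairs[OF fin] by (rule sum_Pow_swap[OF fin])
  also have "\<dots> = (\<Sum>T\<in>Pow P. \<Sum>S\<in>Pow (P - T). \<Sum>A\<in>Pow S.
      Y (A \<union> (S - A)) T * (prod \<beta> A * (\<Prod>p\<in>A. \<psi>' p n) * prod \<alpha> (S - A)) * (\<Prod>p\<in>T. \<phi> p n))"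
  proof (intro sum.cong refl)
    fix S T assume S: "S \<in> Pow (P - T)"
    then have fS: "finite S" using fin finite_subset by auto
    have "(\<Prod>p\<in>S. \<psi> p n) = (\<Prod>p\<in>S. \<beta> p * \<psi>' p n + \<alpha> p)"
      using S eq by (intro prod.cong) auto
    also have "\<dots> = (\<Sum>A\<in>Pow S. prod \<beta> A * (\<Prod>p\<in>A. \<psi>' p n) * prod \<alpha> (S - A))"
      unfolding prod_add[OF fS] by (simp add: prod.distrib)
    finally have "(\<Prod>p\<in>S. \<psi> p n) = (\<Sum>A\<in>Pow S. prod \<beta> A * (\<Prod>p\<in>A. \<psi>' p n) * prod \<alpha> (S - A))" .
    then show "Y S T * ((\<Prod>p\<in>S. \<psi> p n) * (\<Prod>p\<in>T. \<phi> p n)) = (\<Sum>A\<in>Pow S.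
      Y (A \<union> (S - A)) T * (prod \<beta> A * (\<Prod>p\<in>A. \<psi>' p n) * prod \<alpha> (S - A)) * (\<Prod>p\<in>T. \<phi> p n))"
      by (auto simp: sum_distrib_left sum_distrib_right Un_absorb1 mult_ac intro!: sum.cong)
  qed
  also have "\<dots> = (\<Sum>T\<in>Pow P. \<Sum>A\<in>Pow (P - T). \<Sum>M\<in>Pow (P - T - A).
      Y (A \<union> M) T * (prod \<beta> A * (\<Prod>p\<in>A. \<psi>' p n) * prod \<alpha> M) * (\<Prod>p\<in>T. \<phi> p n))"
    using fin by (intro sum.cong refl sum_Pow_split) auto
  also have "\<dots> = (\<Sum>T\<in>Pow P. \<Sum>A\<in>Pow (P - T). prod \<beta> A * (\<Sum>M\<in>Pow (P - T - A). prod \<alpha> M * Y (A \<union> M) T)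
        * ((\<Prod>p\<in>A. \<psi>' p n) * (\<Prod>p\<in>T. \<phi> p n)))"
    by (simp add: sum_distrib_left sum_distrib_right mult_ac)
  also have "\<dots> = sieve_fun P (\<lambda>S T. prod \<beta> S * (\<Sum>M\<in>Pow (P - T - S). prod \<alpha> M * Y (S \<union> M) T)) \<psi>' \<phi> n"
    unfolding sieve_fun_def sum_disj_pairs[OF fin] by (rule sum_Pow_swap[OF fin, symmetric])
  finally show ?thesis .
qed

lemma disj_pairs_remove:
  assumes "p \<in> P"
  shows "disj_pairs P = disj_pairs (P - {p}) \<union> (\<lambda>(S,T). (insert p S, T)) ` disj_pairs (P - {p})
           \<union> (\<lambda>(S,T). (S, insert p T)) ` disj_pairs (P - {p})"
proof (intro equalityI subsetI)
  fix x assume x: "x \<in> disj_pairs P"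
  obtain S T where ST: "x = (S, T)" by (cases x)
  have *: "S \<subseteq> P" "T \<subseteq> P" "S \<inter> T = {}" using x ST by (auto simp: disj_pairs_def)
  consider "p \<in> S" | "p \<in> T" | "p \<notin> S" "p \<notin> T" by blast
  then show "x \<in> disj_pairs (P - {p}) \<union> (\<lambda>(S,T). (insert p S, T)) ` disj_pairs (P - {p})
           \<union> (\<lambda>(S,T). (S, insert p T)) ` disj_pairs (P - {p})"
  proof cases
    case 1
    then have "x = (\<lambda>(S,T). (insert p S, T)) (S - {p}, T)" "(S - {p}, T) \<in> disj_pairs (P - {p})"
      using * ST by (auto simp: disj_pairs_def)
    then show ?thesis by blast
  next
    case 2
    then have "x = (\<lambda>(S,T). (S, insert p T)) (S, T - {p})" "(S, T - {p}) \<in> disj_pairs (P - {p})"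
      using * ST by (auto simp: disj_pairs_def)
    then show ?thesis by blast
  next
    case 3
    then show ?thesis using * ST by (auto simp: disj_pairs_def)
  qed
qed (use assms in \<open>auto simp: disj_pairs_def\<close>)

text \<open>When p divides n + c, both local functions at p are constant. The prime then drops out
  of the expansion, and the three coefficients that differ only at p merge into one; their near
  cancellation is what makes small factors of the centre rare.\<close>

lemma sieve_fun_remove:
  assumes fin: "finite P" and p: "p \<in> P" and val: "\<psi> p n = t" "\<phi> p n = -1"
  shows "sieve_fun P Y \<psi> \<phi> n
    = sieve_fun (P - {p}) (\<lambda>S T. Y S T + t * Y (insert p S) T - Y S (insert p T)) \<psi> \<phi> n"
proof -
  let ?D = "disj_pairs (P - {p})"
  let ?g = "\<lambda>(S,T). Y S T * ((\<Prod>p\<in>S. \<psi> p n) * (\<Prod>p\<in>T. \<phi> p n))"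
  have fD: "finite ?D" using fin by simp
  have mem: "S \<subseteq> P - {p}" "T \<subseteq> P - {p}" "finite S" "finite T" "p \<notin> S" "p \<notin> T" if "(S,T) \<in> ?D" for S T
    using that fin by (auto simp: disj_pairs_def dest: finite_subset)
  have i1: "inj_on (\<lambda>(S,T). (insert p S, T)) ?D"
    by (rule inj_onI) (auto dest!: mem(5) simp: insert_ident)
  have i2: "inj_on (\<lambda>(S,T). (S, insert p T)) ?D"
    by (rule inj_onI) (auto dest!: mem(6) simp: insert_ident)
  have "sieve_fun P Y \<psi> \<phi> n = sum ?g (?D \<union> (\<lambda>(S,T). (insert p S, T)) ` ?D \<union> (\<lambda>(S,T). (S, insert p T)) ` ?D)"
    unfolding sieve_fun_def disj_pairs_remove[OF p] ..
  also have "\<dots> = sum ?g (?D \<union> (\<lambda>(S,T). (insert p S, T)) ` ?D) + sum ?g ((\<lambda>(S,T). (S, insert p T)) ` ?D)"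
    using fD by (intro sum.union_disjoint) (auto dest: mem)
  also have "sum ?g (?D \<union> (\<lambda>(S,T). (insert p S, T)) ` ?D) = sum ?g ?D + sum ?g ((\<lambda>(S,T). (insert p S, T)) ` ?D)"
    using fD by (intro sum.union_disjoint) (auto dest: mem)
  also have "sum ?g ((\<lambda>(S,T). (insert p S, T)) ` ?D) = (\<Sum>(S,T)\<in>?D. t * Y (insert p S) T * ((\<Prod>p\<in>S. \<psi> p n) * (\<Prod>p\<in>T. \<phi> p n)))"
    unfolding sum.reindex[OF i1]
  proof (intro sum.cong refl, clarify)
    fix S T assume "(S,T) \<in> ?D"
    from mem[OF this] show "(?g \<circ> (\<lambda>(S,T). (insert p S, T))) (S, T)
       = t * Y (insert p S) T * ((\<Prod>p\<in>S. \<psi> p n) * (\<Prod>p\<in>T. \<phi> p n))" using val by simp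
  qed
  also have "sum ?g ((\<lambda>(S,T). (S, insert p T)) ` ?D) = (\<Sum>(S,T)\<in>?D. - Y S (insert p T) * ((\<Prod>p\<in>S. \<psi> p n) * (\<Prod>p\<in>T. \<phi> p n)))"
    unfolding sum.reindex[OF i2]
  proof (intro sum.cong refl, clarify)
    fix S T assume "(S,T) \<in> ?D"
    from mem[OF this] show "(?g \<circ> (\<lambda>(S,T). (S, insert p T))) (S, T)
       = - Y S (insert p T) * ((\<Prod>p\<in>S. \<psi> p n) * (\<Prod>p\<in>T. \<phi> p n))" using val by simp
  qed
  also have "sum ?g ?D + (\<Sum>(S,T)\<in>?D. t * Y (insert p S) T * ((\<Prod>p\<in>S. \<psi> p n) * (\<Prod>p\<in>T. \<phi> p n)))
      + (\<Sum>(S,T)\<in>?D. - Y S (insert p T) * ((\<Prod>p\<in>S. \<psi> p n) * (\<Prod>p\<in>T. \<phi> p n)))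
      = sieve_fun (P - {p}) (\<lambda>S T. Y S T + t * Y (insert p S) T - Y S (insert p T)) \<psi> \<phi> n"
    unfolding sieve_fun_def sum.distrib[symmetric] by (intro sum.cong refl) (auto simp: algebra_simps)
  finally show ?thesis .
qed

section \<open>The local functions\<close>

definition hits :: "nat set \<Rightarrow> nat \<Rightarrow> nat \<Rightarrow> bool" where
  "hits Hs p n \<longleftrightarrow> (\<exists>h\<in>Hs. p dvd n + h)"

text \<open>A centred indicator of the classes in which some n + h is divisible by p. The value
  \<open>t p\<close> off these classes is left open, because it is chosen to give mean 0 for the
  density at hand.\<close>

definition psi :: "nat set \<Rightarrow> (nat \<Rightarrow> real) \<Rightarrow> nat \<Rightarrow> nat \<Rightarrow> real" where
  "psi Hs t p n = (if hits Hs p n then -1 else t p)"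

text \<open>Mean 0 is forced by the last value. \<open>phi\<close> lives where \<open>psi\<close> is
  constant, so the two are orthogonal; vanishing on hit classes makes it insensitive to the deletion
  of one of them, so the same \<open>phi\<close> serves both densities.\<close>

definition phi :: "nat set \<Rightarrow> nat \<Rightarrow> nat \<Rightarrow> nat \<Rightarrow> real" where
  "phi Hs c p n = (if p dvd n + c then -1 else if hits Hs p n then 0 else 1 / (real p - real (card Hs) - 1))"

lemma dvd_mod_add_iff: "p dvd n mod p + h \<longleftrightarrow> p dvd n + (h::nat)"
  by (simp add: dvd_eq_mod_eq_0 mod_simps)

lemma hits_mod: "hits Hs p (n mod p) = hits Hs p n"
  by (simp add: hits_def dvd_mod_add_iff)

lemma psi_mod: "psi Hs t p (n mod p) = psi Hs t p n"
  by (simp add: psi_def hits_mod)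

lemma phi_mod: "phi Hs c p (n mod p) = phi Hs c p n"
  by (simp add: phi_def hits_mod dvd_mod_add_iff)

text \<open>The K shifts and the centre occupy K + 1 distinct classes modulo p, and the last
  condition keeps p - K - 1 at least p/2. p is not assumed prime here.\<close>

locale prime_forms =
  fixes Hs :: "nat set" and c p :: nat
  assumes fin_Hs: "finite Hs" and c_Hs: "c \<notin> Hs" and small: "\<And>h. h \<in> insert c Hs \<Longrightarrow> h < p"
    and pK: "2 * card Hs + 2 \<le> p"
begin

abbreviation "K \<equiv> real (card Hs)"

lemma dvd_iff_residue:
  assumes "h < p" "b < p"
  shows "p dvd b + h \<longleftrightarrow> b = (p - h) mod p"
proof
  assume "p dvd b + h"
  then obtain k where k: "b + h = p * k" by (elim dvdE)
  have "b + h < p * 2" using assms by linarith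
  then have "k < 2" using k by (metis mult_less_cancel1)
  then consider "k = 0" | "k = 1" by linarith
  then show "b = (p - h) mod p"
  proof cases
    case 1 then show ?thesis using k by simp
  next
    case 2 then have "b = p - h" using k by simp
    then show ?thesis using assms by simp
  qed
next
  assume "b = (p - h) mod p"
  then show "p dvd b + h" using assms
    by (cases "h = 0") auto
qed

lemma residue_inj:
  assumes "h < p" "h' < p" "p dvd b + h" "p dvd b + h'"
  shows "h = h'"
proof -
  have "[b + h = b + h'] (mod p)" using assms(3,4) by (simp add: cong_def dvd_eq_mod_eq_0)
  then have "[h = h'] (mod p)" by (simp add: cong_add_lcancel_nat)
  then show ?thesis using assms by (simp add: cong_def)
qed

lemma not_hits_of_dvd_centre: "p dvd n + c \<Longrightarrow> \<not> hits Hs p n"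
  using residue_inj[of c _ n] small c_Hs by (auto simp: hits_def)

lemma card_hits: "card {b\<in>{..<p}. hits Hs p b} = card Hs"
proof -
  have "{b\<in>{..<p}. hits Hs p b} = (\<lambda>h. (p - h) mod p) ` Hs"
    using small pK by (auto simp: hits_def dvd_iff_residue)
  moreover have "inj_on (\<lambda>h. (p - h) mod p) Hs"
  proof (rule inj_onI)
    fix h h' assume h: "h \<in> Hs" "h' \<in> Hs" "(p - h) mod p = (p - h') mod p"
    have "h < p" "h' < p" "(p - h) mod p < p" using h small pK by auto
    then show "h = h'" using residue_inj[of h h' "(p - h) mod p"] h(3) dvd_iff_residue[of h "(p - h) mod p"]
      dvd_iff_residue[of h' "(p - h) mod p"] by auto
  qed
  ultimately show ?thesis by (simp add: card_image)
qed

lemma card_centre: "card {b\<in>{..<p}. p dvd b + c} = 1"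
proof -
  have "{b\<in>{..<p}. p dvd b + c} = {(p - c) mod p}"
    using small[of c] pK by (auto simp: dvd_iff_residue)
  then show ?thesis by simp
qed

lemma sum_by_type:
  fixes x y z :: real
  assumes f: "\<And>b. f b = (if p dvd b + c then y else if hits Hs p b then x else z)"
  shows "(\<Sum>b<p. f b) = K * x + y + (real p - K - 1) * z"
proof -
  have eq: "f b = z + (x - z) * (if hits Hs p b then 1 else 0) + (y - z) * (if p dvd b + c then 1 else 0)" for b
    using not_hits_of_dvd_centre[of b] by (auto simp: f)
  have "(\<Sum>b<p. f b) = real p * z + (x - z) * (\<Sum>b<p. if hits Hs p b then 1 else 0)
       + (y - z) * (\<Sum>b<p. if p dvd b + c then 1 else 0)"
    unfolding eq by (simp add: sum.distrib sum_distrib_left[symmetric])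
  also have "(\<Sum>b<p. if hits Hs p b then 1 else (0::real)) = K"
    using card_hits by (simp add: sum.If_cases Int_def)
  also have "(\<Sum>b<p. if p dvd b + c then 1 else (0::real)) = 1"
    using card_centre by (simp add: sum.If_cases Int_def)
  finally show ?thesis by (simp add: algebra_simps)
qed

text \<open>Primality of n + h deletes the class of -h, which is one of the hit classes, and
  renormalises to p - 1 classes. Thus K becomes K - 1 while the other types are unchanged.\<close>

lemma sum_by_type_coprime:
  fixes x y z :: real
  assumes h: "h \<in> Hs" and f: "\<And>b. f b = (if p dvd b + c then y else if hits Hs p b then x else z)"
  shows "(\<Sum>b<p. (if p dvd b + h then 0 else 1 / (real p - 1)) * f b) = ((K - 1) * x + y + (real p - K - 1) * z) / (real p - 1)"
proof -
  have hp: "h < p" using small h by auto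
  define r where "r = (p - h) mod p"
  have r: "r < p" using pK by (simp add: r_def)
  have rd: "p dvd r + h" using dvd_iff_residue[OF hp r] by (simp add: r_def)
  then have "hits Hs p r" using h by (auto simp: hits_def)
  then have fr: "f r = x" using not_hits_of_dvd_centre[of r] by (auto simp: f)
  have "(\<Sum>b<p. (if p dvd b + h then 0 else 1 / (real p - 1)) * f b)
      = (\<Sum>b<p. f b / (real p - 1) - (if b = r then f b / (real p - 1) else 0))"
    using dvd_iff_residue[OF hp] by (intro sum.cong) (auto simp: r_def)
  also have "\<dots> = (\<Sum>b<p. f b) / (real p - 1) - f r / (real p - 1)"
    using r by (simp add: sum_subtractf sum_divide_distrib)
  finally show ?thesis using fr sum_by_type[OF f] by (simp add: diff_divide_distrib[symmetric] algebra_simps)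
qed

lemma real_p: "2 * K + 2 \<le> real p"
  using of_nat_mono[OF pK, where 'a = real] by simp

lemma psi_by_type: "psi Hs t p b = (if p dvd b + c then t p else if hits Hs p b then -1 else t p)"
  using not_hits_of_dvd_centre[of b] by (auto simp: psi_def)

lemma phi_by_type: "phi Hs c p b = (if p dvd b + c then -1 else if hits Hs p b then 0 else 1 / (real p - K - 1))"
  by (simp add: phi_def)

lemma psi_bound: "\<bar>t p\<bar> \<le> 1 \<Longrightarrow> \<bar>psi Hs t p n\<bar> \<le> 1"
  by (simp add: psi_def)

lemma phi_bound: "\<bar>phi Hs c p n\<bar> \<le> 1"
  using real_p by (auto simp: phi_def field_simps)

lemma sum_abs_psi:
  assumes "0 \<le> t p" "t p \<le> K / (real p - K)"
  shows "(\<Sum>b<p. \<bar>psi Hs t p b\<bar>) \<le> 2 * K"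
proof -
  have "(\<Sum>b<p. \<bar>psi Hs t p b\<bar>) = K * 1 + t p + (real p - K - 1) * t p"
    by (rule sum_by_type) (use assms in \<open>auto simp: psi_by_type\<close>)
  also have "\<dots> = K + (real p - K) * t p" by (simp add: algebra_simps)
  also have "(real p - K) * t p \<le> (real p - K) * (K / (real p - K))"
    using assms real_p by (intro mult_left_mono) auto
  also have "\<dots> = K" using real_p by simp
  finally show ?thesis by simp
qed

lemma sum_abs_phi: "(\<Sum>b<p. \<bar>phi Hs c p b\<bar>) = 2"
proof -
  have "(\<Sum>b<p. \<bar>phi Hs c p b\<bar>) = K * 0 + 1 + (real p - K - 1) * (1 / (real p - K - 1))"
    by (rule sum_by_type) (use real_p in \<open>auto simp: phi_by_type\<close>)
  then show ?thesis using real_p by simp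
qed

lemma orth_uniform:
  assumes t: "t p = K / (real p - K)"
  shows "(\<Sum>b<p. 1 / real p * psi Hs t p b) = 0"
    "(\<Sum>b<p. 1 / real p * phi Hs c p b) = 0"
    "(\<Sum>b<p. 1 / real p * (psi Hs t p b * phi Hs c p b)) = 0"
    "(\<Sum>b<p. 1 / real p * (psi Hs t p b)\<^sup>2) = K / (real p - K)"
    "(\<Sum>b<p. 1 / real p * (phi Hs c p b)\<^sup>2) = (real p - K) / (real p * (real p - K - 1))"
proof -
  have nz: "real p - K > 0" "real p - K - 1 > 0" "real p > 0" using real_p by auto
  have "(\<Sum>b<p. psi Hs t p b) = K * (-1) + t p + (real p - K - 1) * t p"
    by (rule sum_by_type) (auto simp: psi_by_type)
  also have "\<dots> = 0" using nz t by (simp add: field_simps)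
  finally show "(\<Sum>b<p. 1 / real p * psi Hs t p b) = 0" by (simp add: sum_divide_distrib[symmetric])
  have "(\<Sum>b<p. phi Hs c p b) = K * 0 + (-1) + (real p - K - 1) * (1 / (real p - K - 1))"
    by (rule sum_by_type) (auto simp: phi_by_type)
  also have "\<dots> = 0" using nz by simp
  finally show "(\<Sum>b<p. 1 / real p * phi Hs c p b) = 0" by (simp add: sum_divide_distrib[symmetric])
  have "(\<Sum>b<p. psi Hs t p b * phi Hs c p b) = K * 0 + (- t p) + (real p - K - 1) * (t p / (real p - K - 1))"
    by (rule sum_by_type) (auto simp: phi_by_type psi_by_type)
  also have "\<dots> = 0" using nz by simp
  finally show "(\<Sum>b<p. 1 / real p * (psi Hs t p b * phi Hs c p b)) = 0" by (simp add: sum_divide_distrib[symmetric])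
  have "(\<Sum>b<p. (psi Hs t p b)\<^sup>2) = K * 1 + (t p)\<^sup>2 + (real p - K - 1) * (t p)\<^sup>2"
    by (rule sum_by_type) (auto simp: psi_by_type)
  also have "\<dots> = K + (real p - K) * t p * t p" by (simp add: power2_eq_square algebra_simps)
  also have "(real p - K) * t p = K" using nz by (simp add: t)
  also have "K + K * t p = real p * (K / (real p - K))" using nz by (simp add: t field_simps)
  finally show "(\<Sum>b<p. 1 / real p * (psi Hs t p b)\<^sup>2) = K / (real p - K)"
    using nz by (simp add: sum_divide_distrib[symmetric])
  have "(\<Sum>b<p. (phi Hs c p b)\<^sup>2) = K * 0 + 1 + (real p - K - 1) * (1 / (real p - K - 1))\<^sup>2"
    by (rule sum_by_type) (auto simp: phi_by_type)
  also have "(real p - K - 1) * (1 / (real p - K - 1))\<^sup>2 = 1 / (real p - K - 1)" using nz by (simp add: power2_eq_square)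
  also have "K * 0 + 1 + 1 / (real p - K - 1) = (real p - K) / (real p - K - 1)" using nz by (simp add: field_simps)
  finally show "(\<Sum>b<p. 1 / real p * (phi Hs c p b)\<^sup>2) = (real p - K) / (real p * (real p - K - 1))"
    using nz by (simp add: sum_divide_distrib[symmetric])
qed

text \<open>Among the remaining p - 1 classes K - 1 are hit and p - K are not, so \<open>psi\<close>
  is recentred with K - 1 in place of K; \<open>phi\<close> vanishes on the deleted class and needs
  no change.\<close>

lemma orth_coprime:
  assumes h: "h \<in> Hs" and t: "t p = (K - 1) / (real p - K)"
  defines "g \<equiv> \<lambda>b. if p dvd b + h then 0 else 1 / (real p - 1)"
  shows "(\<Sum>b<p. g b * psi Hs t p b) = 0"
    "(\<Sum>b<p. g b * phi Hs c p b) = 0"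
    "(\<Sum>b<p. g b * (psi Hs t p b * phi Hs c p b)) = 0"
    "(\<Sum>b<p. g b * (psi Hs t p b)\<^sup>2) = (K - 1) / (real p - K)"
    "(\<Sum>b<p. g b * (phi Hs c p b)\<^sup>2) = (real p - K) / ((real p - 1) * (real p - K - 1))"
proof -
  have nz: "real p - K > 0" "real p - K - 1 > 0" "real p > 0" "real p - 1 > 0" using real_p by auto
  have "(\<Sum>b<p. g b * psi Hs t p b) = ((K - 1) * (-1) + t p + (real p - K - 1) * t p) / (real p - 1)"
    unfolding g_def by (rule sum_by_type_coprime[OF h]) (auto simp: psi_by_type)
  also have "(K - 1) * (-1) + t p + (real p - K - 1) * t p = (real p - K) * t p - (K - 1)" by (simp add: algebra_simps)
  also have "\<dots> = 0" using nz t by simp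
  finally show "(\<Sum>b<p. g b * psi Hs t p b) = 0" by simp
  have "(\<Sum>b<p. g b * phi Hs c p b) = ((K - 1) * 0 + (-1) + (real p - K - 1) * (1 / (real p - K - 1))) / (real p - 1)"
    unfolding g_def by (rule sum_by_type_coprime[OF h]) (auto simp: phi_by_type)
  then show "(\<Sum>b<p. g b * phi Hs c p b) = 0" using nz by simp
  have "(\<Sum>b<p. g b * (psi Hs t p b * phi Hs c p b)) = ((K - 1) * 0 + (- t p) + (real p - K - 1) * (t p / (real p - K - 1))) / (real p - 1)"
    unfolding g_def by (rule sum_by_type_coprime[OF h]) (auto simp: phi_by_type psi_by_type)
  then show "(\<Sum>b<p. g b * (psi Hs t p b * phi Hs c p b)) = 0" using nz by simp
  have "(\<Sum>b<p. g b * (psi Hs t p b)\<^sup>2) = ((K - 1) * 1 + (t p)\<^sup>2 + (real p - K - 1) * (t p)\<^sup>2) / (real p - 1)"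
    unfolding g_def by (rule sum_by_type_coprime[OF h]) (auto simp: psi_by_type)
  also have "(K - 1) * 1 + (t p)\<^sup>2 + (real p - K - 1) * (t p)\<^sup>2 = K - 1 + (real p - K) * t p * t p"
    by (simp add: power2_eq_square algebra_simps)
  also have "(real p - K) * t p = K - 1" using nz by (simp add: t)
  also have "K - 1 + (K - 1) * t p = (K - 1) * (1 + t p)" by (simp add: algebra_simps)
  also have "1 + t p = (real p - 1) / (real p - K)" using nz by (simp add: t field_simps)
  finally show "(\<Sum>b<p. g b * (psi Hs t p b)\<^sup>2) = (K - 1) / (real p - K)"
    using nz by simp
  have "(\<Sum>b<p. g b * (phi Hs c p b)\<^sup>2) = ((K - 1) * 0 + 1 + (real p - K - 1) * (1 / (real p - K - 1))\<^sup>2) / (real p - 1)"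
    unfolding g_def by (rule sum_by_type_coprime[OF h]) (auto simp: phi_by_type)
  also have "(real p - K - 1) * (1 / (real p - K - 1))\<^sup>2 = 1 / (real p - K - 1)" using nz by (simp add: power2_eq_square)
  also have "(K - 1) * 0 + 1 + 1 / (real p - K - 1) = (real p - K) / (real p - K - 1)" using nz by (simp add: field_simps)
  finally show "(\<Sum>b<p. g b * (phi Hs c p b)\<^sup>2) = (real p - K) / ((real p - 1) * (real p - K - 1))"
    using nz by simp
qed

text \<open>Both functions take two values on the same partition of the residues and agree with -1
  on the hit classes, so one is an affine function of the other.\<close>

lemma psi_affine:
  assumes "t p = K / (real p - K)" "t' p = (K - 1) / (real p - K)"
  shows "psi Hs t p n = real p / (real p - 1) * psi Hs t' p n + 1 / (real p - 1)"
proof (cases "hits Hs p n")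
  case True
  then show ?thesis using real_p by (simp add: psi_def field_simps)
next
  case False
  have nz: "real p - K > 0" "real p - 1 > 0" using real_p by auto
  have "1 / (real p - 1) = (real p - K) / ((real p - 1) * (real p - K))" using nz by simp
  then have "real p / (real p - 1) * ((K - 1) / (real p - K)) + 1 / (real p - 1)
     = (real p * (K - 1) + (real p - K)) / ((real p - 1) * (real p - K))"
    by (simp only: times_divide_times_eq add_divide_distrib)
  also have "real p * (K - 1) + (real p - K) = (real p - 1) * K" by (simp add: algebra_simps)
  finally show ?thesis using nz False assms by (simp add: psi_def)
qed

end

section \<open>Comparison of the main terms\<close>

lemma sum_ln_eq_lnp:
  assumes "finite P" "\<And>p. p \<in> P \<Longrightarrow> 1 \<le> p" "0 < x" "0 < m"
  shows "(\<Sum>S\<in>{S\<in>Pow P. pr S \<le> x}. prod H S * ln (x / pr S) ^ m) = (\<Sum>S\<in>Pow P. prod H S * lnp (x / pr S) ^ m)"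
proof (rule sum.mono_neutral_cong_left)
  show "\<forall>S\<in>Pow P - {S \<in> Pow P. pr S \<le> x}. prod H S * lnp (x / pr S) ^ m = 0"
  proof
    fix S assume S: "S \<in> Pow P - {S \<in> Pow P. pr S \<le> x}"
    then have "lnp (x / pr S) = 0" using assms by (intro lnp_eq_0) auto
    then show "prod H S * lnp (x / pr S) ^ m = 0" using assms by simp
  qed
  fix S assume S: "S \<in> {S \<in> Pow P. pr S \<le> x}"
  then have "1 \<le> pr S" using assms by (intro pr_ge_1) auto
  then show "prod H S * ln (x / pr S) ^ m = prod H S * lnp (x / pr S) ^ m"
    using S by (subst lnp_eq_ln) auto
qed (use assms in auto)

text \<open>The largest tuple has eight members, so at most seven besides the centre. Primes up to
  \<open>d\<close> are collected in \<open>Q\<close>, and \<open>d\<close> is so large that the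
  corrections of the local factors at the primes of \<open>P\<close> stay well inside the numerical
  margin.\<close>

locale sieve_main =
  fixes K d Q :: nat and R D B :: real and P :: "nat set"
  assumes K: "2 \<le> K" "K \<le> 7" and d: "100000 \<le> d"
    and P_eq: "P = {p. prime p \<and> d < p \<and> real p \<le> R}"
    and Q_eq: "Q = \<Prod>{p. prime p \<and> p \<le> d}"
    and R1: "1 \<le> R" and D1: "1 \<le> D"
    and cheb: "\<And>n::nat. 1 \<le> n \<Longrightarrow> (\<Sum>p\<in>{p. prime p \<and> p \<le> n}. ln (real p)) \<le> B * real n"
    and B0: "0 \<le> B"
begin

definition "V = real (totient Q) / real Q"
text \<open>\<open>hK\<close> and \<open>hs\<close> are the values of \<open>psi\<close> off the hit
  classes and at the same time its squared norms, for the uniform density and for the density of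
  primes. \<open>hc\<close> and \<open>hcs\<close> are the squared norms of \<open>phi\<close> for
  the same two densities.\<close>

definition "hK p = real K / (real p - real K)"
definition "hs p = (real K - 1) / (real p - real K)"
definition "hc p = (real p - real K) / (real p * (real p - real K - 1))"
definition "hcs p = (real p - real K) / ((real p - 1) * (real p - real K - 1))"
definition "lR S = lnp (R / pr S)"
definition "lD T = lnp (D / pr T)"
definition "Y S T = lR S * lD T"
text \<open>Coefficients of the same weight after \<open>sieve_fun_affine\<close> with \<beta> =
  p/(p-1) and \<alpha> = 1/(p-1).\<close>

definition "Ys S T = (\<Prod>p\<in>S. real p / (real p - 1)) * (\<Sum>M\<in>Pow (P - T - S). (\<Prod>p\<in>M. 1 / (real p - 1)) * Y (S \<union> M) T)"
definition "M0 = (\<Sum>(S,T)\<in>disj_pairs P. (Y S T)\<^sup>2 * (prod hK S * prod hc T))"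
definition "M1 = (\<Sum>(S,T)\<in>disj_pairs P. (Ys S T)\<^sup>2 * (prod hs S * prod hcs T))"
text \<open>The common yardstick for \<open>M0\<close> and \<open>M1\<close>: a squared logarithm
  bounds \<open>Ys\<close> below, hence the fourth power, and \<open>hs\<close> is the norm in
  \<open>M1\<close>.\<close>

definition "S4 = (\<Sum>T\<in>Pow P. \<Sum>S\<in>Pow (P - T). prod hc T * lD T ^ 2 * (prod hs S * lR S ^ 4))"

lemma finP [simp]: "finite P"
  by (rule finite_subset[of _ "{..nat \<lfloor>R\<rfloor>}"]) (auto simp: P_eq le_nat_floor)

lemma finite_sub_P: "S \<subseteq> P \<Longrightarrow> finite S"
  using finite_subset finP by blast

lemma P_prime: "p \<in> P \<Longrightarrow> prime p" and P_d: "p \<in> P \<Longrightarrow> d < p"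
  by (auto simp: P_eq)

lemma P_ge_1: "p \<in> P \<Longrightarrow> 1 \<le> p"
  using d P_d by force

lemma pr_ge_1_P: "S \<subseteq> P \<Longrightarrow> 1 \<le> pr S"
  using P_ge_1 by (intro pr_ge_1) auto

lemma real_P: assumes "p \<in> P" shows "100000 < real p" "real d < real p"
  using P_d[OF assms] d by auto

lemma real_K: "2 \<le> real K" "real K \<le> 7" using K by auto

lemma h_nonneg: assumes "p \<in> P" shows "0 \<le> hK p" "0 \<le> hs p" "0 \<le> hc p" "0 \<le> hcs p"
  using real_P[OF assms] real_K by (auto simp: hK_def hs_def hc_def hcs_def)

lemma prod_h_nonneg: assumes "S \<subseteq> P"
  shows "0 \<le> prod hK S" "0 \<le> prod hs S" "0 \<le> prod hc S" "0 \<le> prod hcs S"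
  using assms h_nonneg by (auto intro!: prod_nonneg)

lemma lR_nonneg [simp]: "0 \<le> lR S" and lD_nonneg [simp]: "0 \<le> lD S"
  by (auto simp: lR_def lD_def)

lemma V_eq: "V = (\<Prod>p\<in>{p. prime p \<and> p \<le> d}. 1 - 1 / real p)"
proof -
  have "prime_factors Q = {p. prime p \<and> p \<le> d}"
    unfolding Q_eq by (rule prime_factors_prod_primes) auto
  moreover have "Q \<noteq> 0" unfolding Q_eq by (auto simp: prod_zero_iff)
  ultimately show ?thesis using totient_formula2[of Q] by (simp add: V_def)
qed

lemma Q_gt_1: "1 < Q"
proof -
  have "2 dvd Q" unfolding Q_eq
    by (rule dvd_prodI[where f = "\<lambda>x. x" and a = 2]) (use d in auto)
  moreover have "Q \<noteq> 0" unfolding Q_eq by (auto simp: prod_zero_iff)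
  ultimately show ?thesis by (metis dvd_imp_le gr0I less_le_trans one_less_numeral_iff semiring_norm(76))
qed

lemma V_pos: "0 < V"
  using Q_gt_1 by (simp add: V_def)

lemma coprime_PQ: assumes "p \<in> P" shows "coprime p Q"
  unfolding Q_eq
proof (rule prod_coprime_right)
  fix q assume "q \<in> {p. prime p \<and> p \<le> d}"
  then show "coprime p q" using P_prime[OF assms] P_d[OF assms] by (intro primes_coprime) auto
qed

section \<open>Lower bound for the form at primes\<close>

lemma hc_le: assumes "p \<in> P" shows "hc p \<le> 2 / real p"
proof -
  have "hc p = (1 / real p) * ((real p - real K) / (real p - real K - 1))" by (simp add: hc_def)
  also have "\<dots> \<le> (1 / real p) * 2"
    using real_P[OF assms] real_K by (intro mult_left_mono) (auto simp: field_simps)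
  finally show ?thesis by simp
qed

text \<open>The sum over M runs over squarefree numbers avoiding Q, S and T, so
  \<open>sum_inverse_totient_log_ge\<close> applies with these primes as the excluded set. The Euler
  factors lost at S cancel against the product in front of \<open>Ys\<close>; those at T remain and
  are dealt with in \<open>centre_loss\<close>.\<close>

lemma Ys_ge:
  assumes "(S, T) \<in> disj_pairs P"
  shows "V * (\<Prod>p\<in>T. 1 - 1 / real p) * lD T * (lR S ^ 2 / 2) \<le> Ys S T"
proof -
  have ST: "S \<subseteq> P" "T \<subseteq> P" "S \<inter> T = {}" using assms by (auto simp: disj_pairs_def)
  have f: "finite S" "finite T" using ST finite_sub_P by auto
  let ?Z = "{p. prime p \<and> p \<le> d}"
  have b0: "0 \<le> (\<Prod>p\<in>S. real p / (real p - 1))" using ST P_ge_1 by (intro prod_nonneg) (force simp: field_simps)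
  have key: "V * (\<Prod>p\<in>S. 1 - 1 / real p) * (\<Prod>p\<in>T. 1 - 1 / real p) * (lR S ^ 2 / 2)
     \<le> (\<Sum>M\<in>Pow (P - T - S). (\<Prod>p\<in>M. 1 / (real p - 1)) * lR (S \<union> M))"
  proof (cases "1 \<le> R / pr S")
    case True
    have "(\<Prod>p\<in>?Z \<union> (S \<union> T). 1 - 1 / real p) * (ln (R / pr S) ^ 2 / 2)
      \<le> (\<Sum>M\<in>Pow (P - T - S). (\<Prod>p\<in>M. 1 / (real p - 1)) * lnp (R / pr S / pr M))"
    proof (rule sum_inverse_totient_log_ge)
      fix p assume p: "prime p" "real p \<le> R / pr S"
      have "R / pr S \<le> R / 1" using pr_ge_1_P[OF ST(1)] R1 by (intro divide_left_mono) auto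
      then have "real p \<le> R" using p by simp
      then have "p \<in> P \<or> p \<in> ?Z" using p(1) unfolding P_eq by (simp add: not_less[symmetric])
      then show "p \<in> P - T - S \<union> (?Z \<union> (S \<union> T))" by blast
    next
      have "P \<inter> ?Z = {}" unfolding P_eq by auto
      then show "(P - T - S) \<inter> (?Z \<union> (S \<union> T)) = {}" by blast
      fix p assume "p \<in> P - T - S \<union> (?Z \<union> (S \<union> T))"
      then show "prime p" using ST P_prime by blast
    qed (use f True in simp_all)
    also have "(\<Prod>p\<in>?Z \<union> (S \<union> T). 1 - 1 / real p) = V * ((\<Prod>p\<in>S. 1 - 1 / real p) * (\<Prod>p\<in>T. 1 - 1 / real p))"
    proof -
      have "P \<inter> ?Z = {}" unfolding P_eq by auto
      then have "?Z \<inter> (S \<union> T) = {}" using ST by blast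
      then show ?thesis unfolding V_eq using f ST(3) by (simp add: prod.union_disjoint)
    qed
    also have "(\<Sum>M\<in>Pow (P - T - S). (\<Prod>p\<in>M. 1 / (real p - 1)) * lnp (R / pr S / pr M))
      = (\<Sum>M\<in>Pow (P - T - S). (\<Prod>p\<in>M. 1 / (real p - 1)) * lR (S \<union> M))"
    proof (rule sum.cong)
      fix M assume M: "M \<in> Pow (P - T - S)"
      then have "finite M" using finite_sub_P[of M] by auto
      then have "pr (S \<union> M) = pr S * pr M" using M f by (intro pr_Un_disjoint) auto
      then show "(\<Prod>p\<in>M. 1 / (real p - 1)) * lnp (R / pr S / pr M) = (\<Prod>p\<in>M. 1 / (real p - 1)) * lR (S \<union> M)"
        by (simp add: lR_def)
    qed simp
    finally show ?thesis using True by (simp add: lR_def lnp_eq_ln mult.assoc)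
  next
    case False
    then have "lR S = 0" unfolding lR_def using pr_ge_1_P[OF ST(1)] R1 by (intro lnp_eq_0) auto
    moreover have "0 \<le> (\<Sum>M\<in>Pow (P - T - S). (\<Prod>p\<in>M. 1 / (real p - 1)) * lR (S \<union> M))"
      using P_ge_1 by (intro sum_nonneg mult_nonneg_nonneg prod_nonneg) (force)+
    ultimately show ?thesis by simp
  qed
  have can: "(\<Prod>p\<in>S. real p / (real p - 1)) * (\<Prod>p\<in>S. 1 - 1 / real p) = 1"
    unfolding prod.distrib[symmetric]
  proof (rule prod.neutral, rule ballI)
    fix p assume "p \<in> S"
    then have "100000 < real p" using ST real_P by auto
    then show "real p / (real p - 1) * (1 - 1 / real p) = 1" by (simp add: field_simps)
  qed
  have "V * (\<Prod>p\<in>T. 1 - 1 / real p) * lD T * (lR S ^ 2 / 2)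
     = ((\<Prod>p\<in>S. real p / (real p - 1)) * (\<Prod>p\<in>S. 1 - 1 / real p)) * (V * (\<Prod>p\<in>T. 1 - 1 / real p) * lD T * (lR S ^ 2 / 2))"
    by (simp add: can)
  also have "\<dots> = (\<Prod>p\<in>S. real p / (real p - 1)) * (lD T *
       (V * (\<Prod>p\<in>S. 1 - 1 / real p) * (\<Prod>p\<in>T. 1 - 1 / real p) * (lR S ^ 2 / 2)))"
    by (simp only: mult_ac)
  also have "\<dots> \<le> (\<Prod>p\<in>S. real p / (real p - 1)) * (lD T *
       (\<Sum>M\<in>Pow (P - T - S). (\<Prod>p\<in>M. 1 / (real p - 1)) * lR (S \<union> M)))"
    using b0 key by (intro mult_left_mono) auto
  also have "\<dots> = Ys S T"
    by (simp add: Ys_def Y_def sum_distrib_left mult_ac)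
  finally show ?thesis .
qed

lemma prod_one_minus_ge:
  assumes "finite T" "\<And>p. p \<in> T \<Longrightarrow> 1 \<le> (p::nat)"
  shows "1 - (\<Sum>p\<in>T. 1 / real p) \<le> (\<Prod>p\<in>T. 1 - 1 / real p)"
  using assms
proof (induction T rule: finite_induct)
  case (insert q T)
  have "1 \<le> q" using insert by simp
  then have "1 / real q \<le> 1" by simp
  have "0 \<le> (\<Sum>p\<in>T. 1 / real p)" by (intro sum_nonneg) auto
  have "1 - (\<Sum>p\<in>insert q T. 1 / real p) = 1 - 1 / real q - (\<Sum>p\<in>T. 1 / real p)" using insert by simp
  also have "\<dots> \<le> (1 - 1 / real q) * (1 - (\<Sum>p\<in>T. 1 / real p))"
    using \<open>0 \<le> (\<Sum>p\<in>T. 1 / real p)\<close> by (simp add: algebra_simps)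
  also have "\<dots> \<le> (1 - 1 / real q) * (\<Prod>p\<in>T. 1 - 1 / real p)"
    using insert.IH insert.prems \<open>1 / real q \<le> 1\<close> by (intro mult_left_mono) auto
  also have "\<dots> = (\<Prod>p\<in>insert q T. 1 - 1 / real p)" using insert by simp
  finally show ?case .
qed simp

lemma lD_insert: assumes "p \<in> P" "T \<subseteq> P - {p}"
  shows "lD (insert p T) \<le> lD T" "lD T - lD (insert p T) \<le> (if pr T \<le> D then ln (real p) else 0)"
proof -
  have T: "T \<subseteq> P" "p \<notin> T" "finite T" using assms finite_sub_P by auto
  have t1: "1 \<le> pr T" and p1: "1 \<le> real p" using pr_ge_1_P[OF T(1)] P_ge_1[OF assms(1)] by auto
  have eq: "D / pr (insert p T) = D / pr T / real p" using T by (simp add: pr_insert mult.commute)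
  have "D / pr T / real p \<le> D / pr T" using D1 p1 t1 by (simp add: field_simps)
  then show "lD (insert p T) \<le> lD T"
    unfolding lD_def eq using D1 t1 p1 by (intro lnp_mono) auto
  show "lD T - lD (insert p T) \<le> (if pr T \<le> D then ln (real p) else 0)"
  proof (cases "pr T \<le> D")
    case True
    have "ln (D / pr T / real p) = ln (D / pr T) - ln (real p)"
      using D1 t1 p1 by (subst ln_div) auto
    moreover have "0 \<le> ln (D / pr T)" using True t1 by simp
    ultimately show ?thesis using True p1 unfolding lD_def eq lnp_def by (auto simp: max_def)
  next
    case False
    then have "lD T = 0" unfolding lD_def using D1 t1 by (intro lnp_eq_0) auto
    then show ?thesis using False by simp
  qed
qed

lemma lR_insert_le: assumes "p \<in> P" "S \<subseteq> P - {p}"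
  shows "lR (insert p S) \<le> lR S"
proof -
  have T: "S \<subseteq> P" "p \<notin> S" "finite S" using assms finite_sub_P by auto
  have t1: "1 \<le> pr S" and p1: "1 \<le> real p" using pr_ge_1_P[OF T(1)] P_ge_1[OF assms(1)] by auto
  have eq: "R / pr (insert p S) = R / pr S / real p" using T by (simp add: pr_insert mult.commute)
  have "R / pr S / real p \<le> R / pr S" using R1 p1 t1 by (simp add: field_simps)
  then show ?thesis
    unfolding lR_def eq using R1 t1 p1 by (intro lnp_mono) auto
qed

lemma sum_inverse_square_P: "(\<Sum>p\<in>P. 1 / real p ^ 2) \<le> 1 / real d"
  using d P_d by (intro sum_inverse_square_le) auto

text \<open>The product is at least 1 minus the sum of 1/p over T. Taking p out of T costs hc(p)/p,
  at most 2/p^2, and the sum over p > d is at most 2/d.\<close>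

lemma centre_loss:
  assumes "S \<subseteq> P"
  shows "(1 - 2 / real d) * (\<Sum>T\<in>Pow (P - S). prod hc T * lD T ^ 2)
     \<le> (\<Sum>T\<in>Pow (P - S). prod hc T * (\<Prod>p\<in>T. 1 - 1 / real p) * lD T ^ 2)"
proof -
  let ?P = "P - S"
  let ?G = "\<Sum>T\<in>Pow ?P. prod hc T * lD T ^ 2"
  have hc0: "0 \<le> prod hc T" if "T \<subseteq> P - S" for T using that by (intro prod_h_nonneg) auto
  have G0: "0 \<le> ?G" using hc0 by (intro sum_nonneg mult_nonneg_nonneg) auto
  have "(\<Sum>T\<in>Pow ?P. prod hc T * (\<Sum>p\<in>T. 1 / real p) * lD T ^ 2)
      = (\<Sum>T\<in>Pow ?P. \<Sum>p\<in>T. prod hc T * (1 / real p) * lD T ^ 2)"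
    by (simp add: sum_distrib_left sum_distrib_right)
  also have "\<dots> = (\<Sum>p\<in>?P. \<Sum>T\<in>Pow (?P - {p}). prod hc (insert p T) * (1 / real p) * lD (insert p T) ^ 2)"
    by (rule sum_Pow_element) simp
  also have "\<dots> \<le> (\<Sum>p\<in>?P. \<Sum>T\<in>Pow ?P. 2 * (1 / real p ^ 2) * (prod hc T * lD T ^ 2))"
  proof (rule sum_mono)
    fix p assume p: "p \<in> ?P"
    then have pP: "p \<in> P" by auto
    have "(\<Sum>T\<in>Pow (?P - {p}). prod hc (insert p T) * (1 / real p) * lD (insert p T) ^ 2)
       \<le> (\<Sum>T\<in>Pow (?P - {p}). 2 * (1 / real p ^ 2) * (prod hc T * lD T ^ 2))"
    proof (rule sum_mono)
      fix T assume T: "T \<in> Pow (?P - {p})"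
      then have T': "T \<subseteq> P - {p}" "T \<subseteq> P" "p \<notin> T" "finite T" using finite_sub_P[of T] by auto
      have "prod hc (insert p T) * (1 / real p) * lD (insert p T) ^ 2 = hc p * (1 / real p) * (prod hc T * lD (insert p T) ^ 2)"
        using T' by simp
      also have "\<dots> \<le> (2 / real p) * (1 / real p) * (prod hc T * lD T ^ 2)"
        using hc_le[OF pP] lD_insert(1)[OF pP T'(1)] h_nonneg[OF pP] prod_h_nonneg(3)[OF T'(2)]
        by (intro mult_mono power_mono) auto
      finally show "prod hc (insert p T) * (1 / real p) * lD (insert p T) ^ 2 \<le> 2 * (1 / real p ^ 2) * (prod hc T * lD T ^ 2)"
        by (simp add: power2_eq_square)
    qed
    also have "\<dots> \<le> (\<Sum>T\<in>Pow ?P. 2 * (1 / real p ^ 2) * (prod hc T * lD T ^ 2))"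
      using hc0 by (intro sum_mono2) (auto intro!: mult_nonneg_nonneg divide_nonneg_nonneg)
    finally show "(\<Sum>T\<in>Pow (?P - {p}). prod hc (insert p T) * (1 / real p) * lD (insert p T) ^ 2)
      \<le> (\<Sum>T\<in>Pow ?P. 2 * (1 / real p ^ 2) * (prod hc T * lD T ^ 2))" .
  qed
  also have "\<dots> = 2 * (\<Sum>p\<in>?P. 1 / real p ^ 2) * ?G"
    by (simp only: sum_distrib_left[symmetric] sum_distrib_right[symmetric])
  also have "\<dots> \<le> 2 * (1 / real d) * ?G"
  proof -
    have "(\<Sum>p\<in>?P. 1 / real p ^ 2) \<le> (\<Sum>p\<in>P. 1 / real p ^ 2)" by (intro sum_mono2) auto
    then show ?thesis using sum_inverse_square_P G0 by (intro mult_right_mono mult_left_mono) auto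
  qed
  finally have loss: "(\<Sum>T\<in>Pow ?P. prod hc T * (\<Sum>p\<in>T. 1 / real p) * lD T ^ 2) \<le> 2 / real d * ?G" by simp
  have "(1 - 2 / real d) * ?G \<le> ?G - (\<Sum>T\<in>Pow ?P. prod hc T * (\<Sum>p\<in>T. 1 / real p) * lD T ^ 2)"
    using loss by (simp add: algebra_simps)
  also have "\<dots> = (\<Sum>T\<in>Pow ?P. prod hc T * (1 - (\<Sum>p\<in>T. 1 / real p)) * lD T ^ 2)"
    by (simp add: sum_subtractf[symmetric] algebra_simps)
  also have "\<dots> \<le> (\<Sum>T\<in>Pow ?P. prod hc T * (\<Prod>p\<in>T. 1 - 1 / real p) * lD T ^ 2)"
  proof (intro sum_mono mult_right_mono mult_left_mono prod_one_minus_ge)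
    fix T assume "T \<in> Pow ?P"
    then have "T \<subseteq> P" by auto
    then show "finite T" "0 \<le> prod hc T" "\<And>p. p \<in> T \<Longrightarrow> 1 \<le> p" using finite_sub_P prod_h_nonneg P_ge_1 by auto
  qed auto
  finally show ?thesis .
qed

lemma S4_swap: "S4 = (\<Sum>S\<in>Pow P. \<Sum>T\<in>Pow (P - S). prod hc T * lD T ^ 2 * (prod hs S * lR S ^ 4))"
  unfolding S4_def by (rule sum_Pow_swap[symmetric]) simp

lemma M1_ge: "V\<^sup>2 / 4 * (1 - 2 / real d) * S4 \<le> M1"
proof -
  \<comment> \<open>Squaring the bound of \<open>Ys_ge\<close> gives two factors 1 - 1/p at each
    prime of T: one turns \<open>hcs\<close> into \<open>hc\<close>, the other is left for
    \<open>centre_loss\<close>.\<close>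
  have hcs_hc: "hcs p * (1 - 1 / real p)\<^sup>2 = hc p * (1 - 1 / real p)" if "p \<in> P" for p
  proof -
    have r: "100000 < real p" using real_P that by auto
    have "hcs p * (1 - 1 / real p) = hc p"
    proof -
      have "1 - 1 / real p = (real p - 1) / real p" using r by (simp add: field_simps)
      then show ?thesis using r by (simp add: hcs_def hc_def)
    qed
    then show ?thesis by (simp add: power2_eq_square mult.assoc[symmetric])
  qed
  have "V\<^sup>2 / 4 * (1 - 2 / real d) * S4
    = (\<Sum>S\<in>Pow P. V\<^sup>2 / 4 * (prod hs S * lR S ^ 4) * ((1 - 2 / real d) * (\<Sum>T\<in>Pow (P - S). prod hc T * lD T ^ 2)))"
    unfolding S4_swap by (simp add: sum_distrib_left sum_distrib_right mult_ac)
  also have "\<dots> \<le> (\<Sum>S\<in>Pow P. V\<^sup>2 / 4 * (prod hs S * lR S ^ 4) *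
        (\<Sum>T\<in>Pow (P - S). prod hc T * (\<Prod>p\<in>T. 1 - 1 / real p) * lD T ^ 2))"
    using prod_h_nonneg by (intro sum_mono mult_left_mono centre_loss) (auto intro!: mult_nonneg_nonneg)
  also have "\<dots> = (\<Sum>S\<in>Pow P. \<Sum>T\<in>Pow (P - S).
      (V * (\<Prod>p\<in>T. 1 - 1 / real p) * lD T * (lR S ^ 2 / 2))\<^sup>2 * (prod hs S * prod hcs T))"
    unfolding sum_distrib_left
  proof (intro sum.cong refl)
    fix S T assume T: "T \<in> Pow (P - S)"
    have "prod hc T * (\<Prod>p\<in>T. 1 - 1 / real p) = (\<Prod>p\<in>T. hcs p * (1 - 1 / real p)\<^sup>2)"
      unfolding prod.distrib[symmetric] using T hcs_hc by (intro prod.cong) auto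
    also have "\<dots> = prod hcs T * (\<Prod>p\<in>T. 1 - 1 / real p)\<^sup>2"
      by (simp add: prod.distrib prod_power_distrib)
    finally have eq: "prod hc T * (\<Prod>p\<in>T. 1 - 1 / real p) = prod hcs T * (\<Prod>p\<in>T. 1 - 1 / real p)\<^sup>2" .
    have "lR S ^ 4 = lR S ^ 2 * lR S ^ 2" by (simp flip: power_add)
    then show "V\<^sup>2 / 4 * (prod hs S * lR S ^ 4) * (prod hc T * (\<Prod>p\<in>T. 1 - 1 / real p) * lD T ^ 2)
       = (V * (\<Prod>p\<in>T. 1 - 1 / real p) * lD T * (lR S ^ 2 / 2))\<^sup>2 * (prod hs S * prod hcs T)"
      unfolding eq by (simp add: power2_eq_square mult_ac)
  qed
  also have "\<dots> \<le> (\<Sum>S\<in>Pow P. \<Sum>T\<in>Pow (P - S). (Ys S T)\<^sup>2 * (prod hs S * prod hcs T))"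
  proof (intro sum_mono mult_right_mono power_mono Ys_ge)
    fix S T assume S: "S \<in> Pow P" and T: "T \<in> Pow (P - S)"
    then have T': "T \<subseteq> P" by auto
    show "(S, T) \<in> disj_pairs P" using S T by (auto simp: disj_pairs_def)
    show "0 \<le> prod hs S * prod hcs T" using S prod_h_nonneg(2)[of S] prod_h_nonneg(4)[OF T'] by auto
    have "0 \<le> (\<Prod>p\<in>T. 1 - 1 / real p)" using T' P_ge_1 by (intro prod_nonneg) (force simp: field_simps)
    then show "0 \<le> V * (\<Prod>p\<in>T. 1 - 1 / real p) * lD T * ((lR S)\<^sup>2 / 2)" using V_pos by simp
  qed
  also have "\<dots> = M1" unfolding M1_def sum_disj_pairs[OF finP] ..
  finally show ?thesis .
qed

end

section \<open>Upper bound for the uniform form and comparison of the two forms\<close>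

context sieve_main begin

lemma mertens: "1 \<le> x \<Longrightarrow> P' \<subseteq> P \<Longrightarrow> (\<Sum>p\<in>{p\<in>P'. real p \<le> x}. ln (real p) / real p) \<le> ln x + B"
  using P_prime finite_sub_P[of P'] by (intro mertens_upper[OF cheb]) auto

lemma ln_P: "p \<in> P \<Longrightarrow> 0 \<le> ln (real p)"
  using P_ge_1 by force

lemma sum_h_log_le:
  assumes h: "\<And>p. p \<in> P \<Longrightarrow> h p \<le> \<kappa> / real p" and \<kappa>: "0 \<le> \<kappa>" and x: "1 \<le> x" and P': "P' \<subseteq> P"
  shows "(\<Sum>p\<in>{p\<in>P'. real p \<le> x}. h p * ln (real p)) \<le> \<kappa> * ln x + \<kappa> * B"
proof -
  have "(\<Sum>p\<in>{p\<in>P'. real p \<le> x}. h p * ln (real p)) \<le> (\<Sum>p\<in>{p\<in>P'. real p \<le> x}. \<kappa> / real p * ln (real p))"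
    using h P' ln_P by (intro sum_mono mult_right_mono) auto
  also have "\<dots> = \<kappa> * (\<Sum>p\<in>{p\<in>P'. real p \<le> x}. ln (real p) / real p)"
    by (simp add: sum_distrib_left)
  also have "\<dots> \<le> \<kappa> * (ln x + B)" using \<kappa> x P' by (intro mult_left_mono mertens)
  finally show ?thesis by (simp add: algebra_simps)
qed

text \<open>The dimension K - 1 of \<open>hs\<close>, enlarged to absorb p/(p - K), which is below 1
  + 14/100000 for K at most 7 and p > 100000.\<close>

definition "kap = (real K - 1) * (1 + 14 / 100000)"

lemma hs_le: assumes "p \<in> P" shows "hs p \<le> kap / real p"
proof -
  have r: "100000 < real p" using real_P assms by auto
  have "real p \<le> (1 + 14 / 100000) * (real p - real K)" using r real_K by simp
  then have "1 / (real p - real K) \<le> (1 + 14 / 100000) / real p"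
    using r real_K by (simp add: field_simps)
  then have "(real K - 1) * (1 / (real p - real K)) \<le> (real K - 1) * ((1 + 14 / 100000) / real p)"
    using real_K by (intro mult_left_mono) auto
  then show ?thesis by (simp add: hs_def kap_def)
qed

lemma kap: "0 \<le> kap" "kap \<le> 6.001" "1 + kap / 4 \<le> 1.001 * ((real K + 3) / 4)"
proof -
  show "0 \<le> kap" using real_K by (simp add: kap_def)
  have "kap \<le> 6 * (1 + 14 / 100000)" unfolding kap_def using real_K by (intro mult_right_mono) auto
  then show "kap \<le> 6.001" by simp
  have "kap \<le> (real K - 1) * 1.001" unfolding kap_def using real_K by (intro mult_left_mono) auto
  then show "1 + kap / 4 \<le> 1.001 * ((real K + 3) / 4)" using real_K by (simp add: field_simps)
qed

lemma moment_R:
  assumes P': "P' \<subseteq> P" and m: "0 < m"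
  shows "(ln R - kap * B) * (\<Sum>S\<in>Pow P'. prod hs S * lR S ^ m)
     \<le> (1 + kap / real (m + 1)) * (\<Sum>S\<in>Pow P'. prod hs S * lR S ^ (m + 1))"
proof -
  have "(ln R - kap * B) * (\<Sum>S\<in>{S\<in>Pow P'. pr S \<le> R}. prod hs S * ln (R / pr S) ^ m)
     \<le> (1 + kap / real (m + 1)) * (\<Sum>S\<in>{S\<in>Pow P'. pr S \<le> R}. prod hs S * ln (R / pr S) ^ (m + 1))"
    using P' finite_sub_P P_ge_1 h_nonneg kap B0 R1
    by (intro log_moment_le sum_h_log_le) (auto intro!: hs_le)
  then show ?thesis
    using P' finite_sub_P P_ge_1 R1 m by (subst (asm) (1 2) sum_ln_eq_lnp) (auto simp: lR_def)
qed

text \<open>One of the K dimensions is split off, hK(p) = hs(p) + 1/(p - K), and summed by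
  \<open>sum_shifted_log2_le\<close>. This raises the logarithm from the second to the third power
  and produces the factor V/3.\<close>

lemma inner_M0_le:
  assumes P': "P' \<subseteq> P"
  shows "(\<Sum>S\<in>Pow P'. prod hK S * lR S ^ 2) \<le> exp (14 / 100000) *
    (V / 3 * (\<Sum>S\<in>Pow P'. prod hs S * lR S ^ 3) + (real Q + 1) * (\<Sum>S\<in>Pow P'. prod hs S * lR S ^ 2))"
proof -
  have f: "finite P'" using P' finite_sub_P by auto
  let ?k = "\<lambda>p. 1 / (real p - real K)"
  have hK_eq: "hK p = hs p + ?k p" for p by (simp add: hK_def hs_def diff_divide_distrib)
  have "(\<Sum>S\<in>Pow P'. prod hK S * lR S ^ 2)
      = (\<Sum>S\<in>Pow P'. \<Sum>A\<in>Pow S. prod hs A * prod ?k (S - A) * lR (A \<union> (S - A)) ^ 2)"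
  proof (intro sum.cong refl)
    fix S assume S: "S \<in> Pow P'"
    then have "finite S" using f finite_subset by auto
    then have "prod hK S = (\<Sum>A\<in>Pow S. prod hs A * prod ?k (S - A))" unfolding hK_eq by (rule prod_add)
    then show "prod hK S * lR S ^ 2 = (\<Sum>A\<in>Pow S. prod hs A * prod ?k (S - A) * lR (A \<union> (S - A)) ^ 2)"
      by (auto simp: sum_distrib_right Un_absorb1 intro!: sum.cong)
  qed
  also have "\<dots> = (\<Sum>A\<in>Pow P'. \<Sum>U\<in>Pow (P' - A). prod hs A * prod ?k U * lR (A \<union> U) ^ 2)"
    by (rule sum_Pow_split[OF f])
  also have "\<dots> \<le> (\<Sum>A\<in>Pow P'. prod hs A * (exp (14 / 100000) * (V * (lR A ^ 3 / 3) + (real Q + 1) * lR A ^ 2)))"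
  proof (rule sum_mono)
    fix A assume A: "A \<in> Pow P'"
    then have A': "A \<subseteq> P" "finite A" using P' finite_sub_P by auto
    have eq: "lR (A \<union> U) = lnp (R / pr A / pr U)" if "U \<in> Pow (P' - A)" for U
    proof -
      have "finite U" using that f finite_subset by auto
      moreover have "A \<inter> U = {}" using that by auto
      ultimately show ?thesis using A' by (simp add: lR_def pr_Un_disjoint)
    qed
    have "(\<Sum>U\<in>Pow (P' - A). prod ?k U * lR (A \<union> U) ^ 2) \<le> exp (14 / 100000) * (V * (lR A ^ 3 / 3) + (real Q + 1) * lR A ^ 2)"
    proof (cases "1 \<le> R / pr A")
      case True
      have "(\<Sum>U\<in>Pow (P' - A). prod ?k U * lnp (R / pr A / pr U) ^ 2)
         \<le> exp (2 * real K / real d) * (V * (ln (R / pr A) ^ 3 / 3) + (real Q + 1) * ln (R / pr A) ^ 2)"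
        unfolding V_def using f P' P_prime P_d coprime_PQ K d Q_gt_1 True
        by (intro sum_shifted_log2_le) auto
      also have "\<dots> \<le> exp (14 / 100000) * (V * (ln (R / pr A) ^ 3 / 3) + (real Q + 1) * ln (R / pr A) ^ 2)"
      proof (rule mult_right_mono)
        have "2 * real K / real d \<le> 14 / 100000" using real_K d by (intro frac_le) auto
        then show "exp (2 * real K / real d) \<le> exp (14 / 100000)" by simp
        show "0 \<le> V * (ln (R / pr A) ^ 3 / 3) + (real Q + 1) * ln (R / pr A) ^ 2"
          using True V_pos by (intro add_nonneg_nonneg mult_nonneg_nonneg) auto
      qed
      finally show ?thesis using eq True by (simp add: lR_def lnp_eq_ln)
    next
      case False
      have "lR (A \<union> U) = 0" if U: "U \<in> Pow (P' - A)" for U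
      proof -
        have u: "1 \<le> pr U" using U P' by (intro pr_ge_1_P) auto
        have a: "1 \<le> pr A" using A' by (intro pr_ge_1_P)
        have "R / pr A / pr U \<le> 1 / 1" using False a u R1 by (intro frac_le) auto
        then show ?thesis unfolding eq[OF U] using a u R1 by (intro lnp_eq_0) auto
      qed
      moreover have "0 \<le> exp (14 / 100000) * (V * (lR A ^ 3 / 3) + (real Q + 1) * lR A ^ 2)"
        using V_pos by (intro mult_nonneg_nonneg add_nonneg_nonneg) auto
      ultimately show ?thesis by simp
    qed
    then have "prod hs A * (\<Sum>U\<in>Pow (P' - A). prod ?k U * lR (A \<union> U) ^ 2)
      \<le> prod hs A * (exp (14 / 100000) * (V * (lR A ^ 3 / 3) + (real Q + 1) * lR A ^ 2))"
      using prod_h_nonneg(2)[OF A'(1)] by (intro mult_left_mono)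
    then show "(\<Sum>U\<in>Pow (P' - A). prod hs A * prod ?k U * lR (A \<union> U) ^ 2)
      \<le> prod hs A * (exp (14 / 100000) * (V * (lR A ^ 3 / 3) + (real Q + 1) * lR A ^ 2))"
      by (simp add: sum_distrib_left mult.assoc)
  qed
  also have "\<dots> = exp (14 / 100000) *
    (V / 3 * (\<Sum>S\<in>Pow P'. prod hs S * lR S ^ 3) + (real Q + 1) * (\<Sum>S\<in>Pow P'. prod hs S * lR S ^ 2))"
    by (simp add: sum_distrib_left sum.distrib[symmetric] algebra_simps)
  finally show ?thesis .
qed

text \<open>Two exchanges lead from \<open>hK\<close> with a squared logarithm to \<open>hs\<close>
  with a fourth power: \<open>inner_M0_le\<close> gives V/3, and the moment inequality from 3 to 4
  gives (K+3)/(4 ln R), hence 12 = 3 * 4. The term with Q is a logarithm smaller, by the moment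
  inequality from 2 to 3.\<close>

lemma inner_ratio:
  assumes P': "P' \<subseteq> P" and R: "10000 * (B + 1) \<le> ln R" "10000 * (real Q + 1) / V \<le> ln R"
  shows "12 * ln R * (\<Sum>S\<in>Pow P'. prod hK S * lR S ^ 2) \<le> 1.005 * V * (real K + 3) * (\<Sum>S\<in>Pow P'. prod hs S * lR S ^ 4)"
proof -
  define s2 where "s2 = (\<Sum>S\<in>Pow P'. prod hs S * lR S ^ 2)"
  define s3 where "s3 = (\<Sum>S\<in>Pow P'. prod hs S * lR S ^ 3)"
  define s4 where "s4 = (\<Sum>S\<in>Pow P'. prod hs S * lR S ^ 4)"
  have hs0: "0 \<le> prod hs S" if "S \<in> Pow P'" for S using that P' by (intro prod_h_nonneg) auto
  have nn: "0 \<le> s2" "0 \<le> s3" "0 \<le> s4" unfolding s2_def s3_def s4_def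
    using hs0 by (auto intro!: sum_nonneg mult_nonneg_nonneg)
  have "0 < 10000 * (B + 1)" using B0 by simp
  then have l: "0 < ln R" using R(1) by (rule less_le_trans)
  have "kap * B \<le> 6.001 * B" using kap B0 by (intro mult_right_mono) auto
  then have lw: "0.999 * ln R \<le> ln R - kap * B" using R(1) B0 by simp
  have m3: "0.999 * ln R * s3 \<le> 1.001 * ((real K + 3) / 4) * s4"
  proof -
    have "0.999 * ln R * s3 \<le> (ln R - kap * B) * s3" using lw nn by (intro mult_right_mono)
    also have "\<dots> \<le> (1 + kap / 4) * s4" using moment_R[OF P', of 3] by (simp add: s3_def s4_def)
    also have "\<dots> \<le> 1.001 * ((real K + 3) / 4) * s4" using kap nn by (intro mult_right_mono)
    finally show ?thesis .
  qed
  have m2: "0.999 * ln R * s2 \<le> 3.1 * s3"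
  proof -
    have "0.999 * ln R * s2 \<le> (ln R - kap * B) * s2" using lw nn by (intro mult_right_mono)
    also have "\<dots> \<le> (1 + kap / 3) * s3" using moment_R[OF P', of 2] by (simp add: s2_def s3_def numeral_3_eq_3)
    also have "\<dots> \<le> 3.1 * s3" using kap nn by (intro mult_right_mono) auto
    finally show ?thesis .
  qed
  have q: "(real Q + 1) * s2 \<le> 0.001 * (V / 3) * s3"
  proof -
    have "(real Q + 1) * s2 * 10000 \<le> V * ln R * s2"
    proof -
      have "10000 * (real Q + 1) \<le> V * ln R" using R(2) V_pos by (simp add: field_simps)
      then have "10000 * (real Q + 1) * s2 \<le> V * ln R * s2" using nn by (intro mult_right_mono)
      then show ?thesis by (simp add: mult_ac)
    qed
    also have "\<dots> = V * (ln R * s2)" by simp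
    also have "\<dots> \<le> V * (3.1 / 0.999 * s3)" using m2 V_pos by (intro mult_left_mono) (auto simp: mult.commute)
    finally have 1: "(real Q + 1) * s2 * 10000 \<le> 3.1 / 0.999 * (V * s3)" by simp
    have "0 \<le> V * s3" using V_pos nn by simp
    define w where "w = (real Q + 1) * s2"
    define v where "v = V * s3"
    have "w * 10000 \<le> 3.1 / 0.999 * v" "0 \<le> v" using 1 \<open>0 \<le> V * s3\<close> by (simp_all only: w_def v_def)
    then have "w \<le> 0.001 * (v / 3)" by simp
    then show ?thesis by (simp add: w_def v_def)
  qed
  have e: "exp (14 / 100000 :: real) \<le> 1.001"
  proof -
    have "exp (14 / 100000 :: real) \<le> 1 + 14 / 100000 + (14 / 100000)\<^sup>2" by (rule exp_bound) auto
    also have "\<dots> \<le> 1.001" by (simp add: power2_eq_square)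
    finally show ?thesis .
  qed
  have "(\<Sum>S\<in>Pow P'. prod hK S * lR S ^ 2) \<le> exp (14 / 100000) * (V / 3 * s3 + (real Q + 1) * s2)"
    using inner_M0_le[OF P'] by (simp add: s2_def s3_def)
  also have "\<dots> \<le> 1.001 * (1.001 * (V / 3) * s3)"
    using e q V_pos nn by (intro mult_mono) (auto simp: mult.commute)
  finally have "12 * ln R * (\<Sum>S\<in>Pow P'. prod hK S * lR S ^ 2) \<le> 12 * ln R * (1.001 * (1.001 * (V / 3) * s3))"
    using l by (intro mult_left_mono) auto
  also have "\<dots> = 4 * 1.001 * 1.001 / 0.999 * V * (0.999 * ln R * s3)" by simp
  also have "\<dots> \<le> 4 * 1.001 * 1.001 / 0.999 * V * (1.001 * ((real K + 3) / 4) * s4)"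
    using m3 V_pos by (intro mult_left_mono) auto
  also have "\<dots> = 1.001 * 1.001 * 1.001 / 0.999 * (V * (real K + 3) * s4)" by simp
  \<comment> \<open>The accumulated slack 1.001^3/0.999 is below 1.0041.\<close>
  also have "\<dots> \<le> 1.005 * (V * (real K + 3) * s4)"
    using V_pos nn by (intro mult_right_mono) auto
  finally show ?thesis by (simp add: s4_def mult.assoc)
qed

lemma M0_eq: "M0 = (\<Sum>T\<in>Pow P. prod hc T * lD T ^ 2 * (\<Sum>S\<in>Pow (P - T). prod hK S * lR S ^ 2))"
proof -
  have "M0 = (\<Sum>T\<in>Pow P. \<Sum>S\<in>Pow (P - T). (Y S T)\<^sup>2 * (prod hK S * prod hc T))"
    unfolding M0_def sum_disj_pairs[OF finP] by (rule sum_Pow_swap[OF finP])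
  also have "\<dots> = (\<Sum>T\<in>Pow P. prod hc T * lD T ^ 2 * (\<Sum>S\<in>Pow (P - T). prod hK S * lR S ^ 2))"
    by (simp add: Y_def sum_distrib_left power_mult_distrib mult_ac)
  finally show ?thesis .
qed

lemma M0_eq': "M0 = (\<Sum>S\<in>Pow P. prod hK S * lR S ^ 2 * (\<Sum>T\<in>Pow (P - S). prod hc T * lD T ^ 2))"
  unfolding M0_def sum_disj_pairs[OF finP]
  by (simp add: Y_def sum_distrib_left power_mult_distrib mult_ac)

lemma M0_nonneg: "0 \<le> M0"
  unfolding M0_eq
proof (intro sum_nonneg mult_nonneg_nonneg)
  fix T S assume "S \<in> Pow (P - T)"
  then show "0 \<le> prod hK S" by (intro prod_h_nonneg) auto
qed (auto intro!: prod_h_nonneg)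

text \<open>The ideal constant is 3 = 12/4. The value 2.98 is what the accumulated slack permits:
  2.98 * 1.005/12 must not exceed 0.999/4.\<close>

lemma main_ratio:
  assumes R: "10000 * (B + 1) \<le> ln R" "10000 * (real Q + 1) / V \<le> ln R"
  shows "2.98 * V * ln R * M0 \<le> (real K + 3) * M1"
proof -
  have "12 * ln R * M0 = (\<Sum>T\<in>Pow P. prod hc T * lD T ^ 2 * (12 * ln R * (\<Sum>S\<in>Pow (P - T). prod hK S * lR S ^ 2)))"
    unfolding M0_eq by (simp add: sum_distrib_left mult_ac)
  also have "\<dots> \<le> (\<Sum>T\<in>Pow P. prod hc T * lD T ^ 2 * (1.005 * V * (real K + 3) * (\<Sum>S\<in>Pow (P - T). prod hs S * lR S ^ 4)))"
    using R prod_h_nonneg(3) by (intro sum_mono mult_left_mono inner_ratio) auto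
  also have "\<dots> = 1.005 * V * (real K + 3) * S4"
  proof -
    have S4: "S4 = (\<Sum>T\<in>Pow P. prod hc T * lD T ^ 2 * (\<Sum>S\<in>Pow (P - T). prod hs S * lR S ^ 4))"
      unfolding S4_def by (simp add: sum_distrib_left)
    show ?thesis unfolding S4 by (subst sum_distrib_left, intro sum.cong refl) (simp only: mult_ac)
  qed
  finally have 1: "12 * ln R * M0 \<le> 1.005 * V * (real K + 3) * S4" .
  have S40: "0 \<le> S4" unfolding S4_def
  proof (intro sum_nonneg mult_nonneg_nonneg)
    fix T S assume "S \<in> Pow (P - T)"
    then show "0 \<le> prod hs S" by (intro prod_h_nonneg) auto
  qed (auto intro!: prod_h_nonneg)
  have "V\<^sup>2 / 4 * 0.999 * S4 \<le> V\<^sup>2 / 4 * (1 - 2 / real d) * S4"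
  proof (intro mult_right_mono mult_left_mono)
    have "2 / real d \<le> 2 / 100000" using d by (intro divide_left_mono) auto
    then show "0.999 \<le> 1 - 2 / real d" by simp
  qed (use S40 in auto)
  also have "\<dots> \<le> M1" by (rule M1_ge)
  finally have 2: "V\<^sup>2 / 4 * 0.999 * S4 \<le> M1" .
  have "2.98 * V * ln R * M0 = 2.98 * V / 12 * (12 * ln R * M0)" by simp
  also have "\<dots> \<le> 2.98 * V / 12 * (1.005 * V * (real K + 3) * S4)"
    using 1 V_pos by (intro mult_left_mono) auto
  also have "\<dots> = (2.98 * 1.005 / 12) * ((real K + 3) * (V\<^sup>2 * S4))" by (simp add: power2_eq_square)
  also have "\<dots> \<le> (0.999 / 4) * ((real K + 3) * (V\<^sup>2 * S4))"
    using S40 by (intro mult_right_mono) auto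
  also have "\<dots> = (real K + 3) * (V\<^sup>2 / 4 * 0.999 * S4)" by simp
  also have "\<dots> \<le> (real K + 3) * M1" using 2 by (intro mult_left_mono) auto
  finally show ?thesis .
qed

section \<open>Loss from small prime factors of the centre\<close>

definition "Yb p S T = Y S T + hK p * Y (insert p S) T - Y S (insert p T)"
text \<open>The diagonal form of the weight restricted to n with p dividing n + c: \<open>Yb\<close>
  is the merged coefficient of \<open>sieve_fun_remove\<close>, where \<open>hK p\<close> and -1 are
  the values of \<open>psi\<close> and \<open>phi\<close> there.\<close>

definition "Mb p = (\<Sum>(S,T)\<in>disj_pairs (P - {p}). (Yb p S T)\<^sup>2 * (prod hK S * prod hc T))"

text \<open>Two steps of the moment inequality with the crude dimension 2 from \<open>hc_le\<close>,
  from exponent 0 to 2. The factors are 3 and 2, each doubled because 2B is at most half of ln D: 24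
  = 6 * 4.\<close>

lemma count_D_le:
  assumes P': "P' \<subseteq> P" and D: "4 * B \<le> ln D" "0 < ln D"
  shows "ln D ^ 2 * (\<Sum>T\<in>{T\<in>Pow P'. pr T \<le> D}. prod hc T) \<le> 24 * (\<Sum>T\<in>Pow P'. prod hc T * lD T ^ 2)"
proof -
  have hc0: "0 \<le> prod hc S" if "S \<in> Pow P'" for S using that P' by (intro prod_h_nonneg) auto
  define s0 where "s0 = (\<Sum>T\<in>{T\<in>Pow P'. pr T \<le> D}. prod hc T)"
  define s1 where "s1 = (\<Sum>T\<in>Pow P'. prod hc T * lD T ^ 1)"
  define s2 where "s2 = (\<Sum>T\<in>Pow P'. prod hc T * lD T ^ 2)"
  have nn: "0 \<le> s0" "0 \<le> s1" "0 \<le> s2" unfolding s0_def s1_def s2_def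
    using hc0 by (auto intro!: sum_nonneg mult_nonneg_nonneg)
  have mom: "(ln D - 2 * B) * (\<Sum>S\<in>{S\<in>Pow P'. pr S \<le> D}. prod hc S * ln (D / pr S) ^ m)
     \<le> (1 + 2 / real (m + 1)) * (\<Sum>S\<in>{S\<in>Pow P'. pr S \<le> D}. prod hc S * ln (D / pr S) ^ (m + 1))" for m
    using P' finite_sub_P P_ge_1 h_nonneg B0 D1
    by (intro log_moment_le sum_h_log_le) (auto intro!: hc_le)
  have conv: "(\<Sum>S\<in>{S\<in>Pow P'. pr S \<le> D}. prod hc S * ln (D / pr S) ^ m) = (\<Sum>S\<in>Pow P'. prod hc S * lD S ^ m)"
    if "0 < m" for m
    unfolding lD_def using that P' finite_sub_P P_ge_1 D1 by (intro sum_ln_eq_lnp) auto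
  have 0: "(ln D - 2 * B) * s0 \<le> 3 * s1"
    using mom[of 0] conv[of 1] by (simp add: s0_def s1_def)
  have 1: "(ln D - 2 * B) * s1 \<le> 2 * s2"
    using mom[of 1] conv[of 1] conv[of 2] by (simp add: s1_def s2_def numeral_2_eq_2)
  have h: "ln D / 2 \<le> ln D - 2 * B" using D by simp
  have "ln D / 2 * s0 \<le> (ln D - 2 * B) * s0" using h nn by (intro mult_right_mono)
  then have a: "ln D * s0 \<le> 6 * s1" using 0 by simp
  have "ln D / 2 * s1 \<le> (ln D - 2 * B) * s1" using h nn by (intro mult_right_mono)
  then have b: "ln D * s1 \<le> 4 * s2" using 1 by simp
  have "ln D ^ 2 * s0 = ln D * (ln D * s0)" by (simp add: power2_eq_square)
  also have "\<dots> \<le> ln D * (6 * s1)" using a D by (intro mult_left_mono) auto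
  also have "\<dots> = 6 * (ln D * s1)" by simp
  also have "\<dots> \<le> 6 * (4 * s2)" using b by (intro mult_left_mono) auto
  finally show ?thesis by (simp add: s0_def s2_def)
qed

text \<open>In \<open>Yb\<close> the difference of the cutoffs with and without p is at most ln p,
  against values of size ln D in \<open>Y\<close>. Squared and summed with 1/p over p up to z, this
  saves a factor of order (ln z/ln D)^2 by Mertens' bound. The term with \<open>hK p\<close> is
  harmless because its square is of order 1/p^2.\<close>

lemma bad_le:
  assumes D: "4 * B \<le> ln D" and z: "1 \<le> z" "B \<le> ln z" "1000 * ln z \<le> ln D" "0 < ln D"
  shows "(\<Sum>p\<in>{p\<in>P. real p \<le> z}. 1 / real p * Mb p) \<le> 0.01 * M0"
proof -
  define C1 where "C1 = (\<Sum>S\<in>Pow P. prod hK S * lR S ^ 2 * (\<Sum>T\<in>{T\<in>Pow (P - S). pr T \<le> D}. prod hc T))"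
  have C1_le: "ln D ^ 2 * C1 \<le> 24 * M0"
  proof -
    have "ln D ^ 2 * C1 = (\<Sum>S\<in>Pow P. prod hK S * lR S ^ 2 * (ln D ^ 2 * (\<Sum>T\<in>{T\<in>Pow (P - S). pr T \<le> D}. prod hc T)))"
      unfolding C1_def by (simp add: sum_distrib_left mult_ac)
    also have "\<dots> \<le> (\<Sum>S\<in>Pow P. prod hK S * lR S ^ 2 * (24 * (\<Sum>T\<in>Pow (P - S). prod hc T * lD T ^ 2)))"
      using D z prod_h_nonneg(1) by (intro sum_mono mult_left_mono count_D_le) auto
    also have "\<dots> = 24 * M0" unfolding M0_eq' by (simp add: sum_distrib_left mult_ac)
    finally show ?thesis .
  qed
  have C10: "0 \<le> C1" unfolding C1_def
  proof (intro sum_nonneg mult_nonneg_nonneg)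
    fix S T assume "T \<in> {T\<in>Pow (P - S). pr T \<le> D}"
    then show "0 \<le> prod hc T" by (intro prod_h_nonneg) auto
  qed (auto intro!: prod_h_nonneg)
  have Mb: "Mb p \<le> 2 * ln (real p) ^ 2 * C1 + 2 * hK p ^ 2 * M0" if p: "p \<in> P" for p
  proof -
    let ?g = "\<lambda>S T. prod hK S * lR S ^ 2 * prod hc T * (2 * ln (real p) ^ 2 * (if pr T \<le> D then 1 else 0) + 2 * hK p ^ 2 * lD T ^ 2)"
    have g0: "0 \<le> ?g S T" if "S \<subseteq> P" "T \<subseteq> P" for S T
      using that prod_h_nonneg by (intro mult_nonneg_nonneg add_nonneg_nonneg) auto
    have "Mb p \<le> (\<Sum>(S,T)\<in>disj_pairs (P - {p}). ?g S T)"
      unfolding Mb_def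
    proof (rule sum_mono, clarify)
      fix S T assume "(S,T) \<in> disj_pairs (P - {p})"
      then have ST: "S \<subseteq> P - {p}" "T \<subseteq> P - {p}" "S \<subseteq> P" "T \<subseteq> P" by (auto simp: disj_pairs_def)
      define i where "i = (if pr T \<le> D then 1 else (0::real))"
      have i: "i ^ 2 = i" by (simp add: i_def)
      have a: "0 \<le> lD T - lD (insert p T)" "lD T - lD (insert p T) \<le> ln (real p) * i"
        using lD_insert[OF p ST(2)] by (auto simp: i_def)
      have Yb: "Yb p S T = lR S * (lD T - lD (insert p T)) + hK p * lR (insert p S) * lD T"
        by (simp add: Yb_def Y_def algebra_simps)
      have "Yb p S T \<le> lR S * (ln (real p) * i) + hK p * lR S * lD T"
        unfolding Yb using a(2) lR_insert_le[OF p ST(1)] h_nonneg[OF p]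
        by (intro add_mono mult_left_mono mult_right_mono) auto
      also have "\<dots> = lR S * (ln (real p) * i + hK p * lD T)" by (simp add: algebra_simps)
      finally have up: "Yb p S T \<le> lR S * (ln (real p) * i + hK p * lD T)" .
      have lo: "0 \<le> Yb p S T" unfolding Yb using a(1) h_nonneg[OF p] by auto
      have "(Yb p S T)\<^sup>2 \<le> (lR S * (ln (real p) * i + hK p * lD T))\<^sup>2" using up lo by (intro power_mono)
      also have "\<dots> = lR S ^ 2 * (ln (real p) * i + hK p * lD T)\<^sup>2" by (simp add: power_mult_distrib)
      also have "\<dots> \<le> lR S ^ 2 * (2 * (ln (real p) * i)\<^sup>2 + 2 * (hK p * lD T)\<^sup>2)"
      proof (rule mult_left_mono)
        have "0 \<le> (ln (real p) * i - hK p * lD T)\<^sup>2" by simp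
        then show "(ln (real p) * i + hK p * lD T)\<^sup>2 \<le> 2 * (ln (real p) * i)\<^sup>2 + 2 * (hK p * lD T)\<^sup>2"
          by (simp add: power2_sum power2_diff)
      qed simp
      also have "\<dots> = lR S ^ 2 * (2 * ln (real p) ^ 2 * i + 2 * hK p ^ 2 * lD T ^ 2)"
        by (simp add: power_mult_distrib i)
      finally have "(Yb p S T)\<^sup>2 * (prod hK S * prod hc T) \<le> lR S ^ 2 * (2 * ln (real p) ^ 2 * i + 2 * hK p ^ 2 * lD T ^ 2) * (prod hK S * prod hc T)"
        using prod_h_nonneg(1)[OF ST(3)] prod_h_nonneg(3)[OF ST(4)] by (intro mult_right_mono) auto
      then show "(Yb p S T)\<^sup>2 * (prod hK S * prod hc T) \<le> ?g S T" by (simp add: i_def mult_ac)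
    qed
    also have "\<dots> \<le> (\<Sum>(S,T)\<in>disj_pairs P. ?g S T)"
    proof (rule sum_mono2)
      show "disj_pairs (P - {p}) \<subseteq> disj_pairs P" by (auto simp: disj_pairs_def)
      fix x assume "x \<in> disj_pairs P - disj_pairs (P - {p})"
      then show "0 \<le> (case x of (S,T) \<Rightarrow> ?g S T)" using g0 by (cases x) (auto simp: disj_pairs_def)
    qed simp
    also have "\<dots> = (\<Sum>S\<in>Pow P. \<Sum>T\<in>Pow (P - S). ?g S T)" by (rule sum_disj_pairs) simp
    also have "\<dots> = 2 * ln (real p) ^ 2 * (\<Sum>S\<in>Pow P. prod hK S * lR S ^ 2 * (\<Sum>T\<in>Pow (P - S). prod hc T * (if pr T \<le> D then 1 else 0)))
        + 2 * hK p ^ 2 * M0"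
      unfolding M0_eq' by (simp only: sum_distrib_left sum.distrib[symmetric] distrib_left mult_ac)
    also have "(\<Sum>S\<in>Pow P. prod hK S * lR S ^ 2 * (\<Sum>T\<in>Pow (P - S). prod hc T * (if pr T \<le> D then 1 else 0))) = C1"
      unfolding C1_def
    proof (rule sum.cong[OF refl])
      fix S
      have "(\<Sum>T\<in>Pow (P - S). prod hc T * (if pr T \<le> D then 1 else 0)) = (\<Sum>T\<in>Pow (P - S). if pr T \<le> D then prod hc T else 0)"
        by (intro sum.cong) auto
      also have "\<dots> = (\<Sum>T\<in>{T\<in>Pow (P - S). pr T \<le> D}. prod hc T)"
        by (rule sum.inter_filter[symmetric]) simp
      finally show "prod hK S * lR S ^ 2 * (\<Sum>T\<in>Pow (P - S). prod hc T * (if pr T \<le> D then 1 else 0))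
         = prod hK S * lR S ^ 2 * (\<Sum>T\<in>{T\<in>Pow (P - S). pr T \<le> D}. prod hc T)" by (rule arg_cong)
    qed
    finally show ?thesis .
  qed
  have s1: "(\<Sum>p\<in>{p\<in>P. real p \<le> z}. ln (real p) ^ 2 / real p) \<le> 2 * ln z ^ 2"
  proof -
    have "(\<Sum>p\<in>{p\<in>P. real p \<le> z}. ln (real p) ^ 2 / real p) \<le> (\<Sum>p\<in>{p\<in>P. real p \<le> z}. ln z * (ln (real p) / real p))"
    proof (rule sum_mono)
      fix p assume p: "p \<in> {p\<in>P. real p \<le> z}"
      then have "1 \<le> p" using P_ge_1 by auto
      have "ln (real p) \<le> ln z" using p \<open>1 \<le> p\<close> z by simp
      then have "ln (real p) * (ln (real p) / real p) \<le> ln z * (ln (real p) / real p)"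
        using \<open>1 \<le> p\<close> by (intro mult_right_mono) auto
      then show "ln (real p) ^ 2 / real p \<le> ln z * (ln (real p) / real p)" by (simp add: power2_eq_square)
    qed
    also have "\<dots> = ln z * (\<Sum>p\<in>{p\<in>P. real p \<le> z}. ln (real p) / real p)" by (simp add: sum_distrib_left)
    also have "\<dots> \<le> ln z * (ln z + B)" using z by (intro mult_left_mono mertens) auto
    also have "\<dots> \<le> ln z * (2 * ln z)" using z by (intro mult_left_mono) auto
    finally show ?thesis by (simp add: power2_eq_square)
  qed
  have s2: "(\<Sum>p\<in>{p\<in>P. real p \<le> z}. hK p ^ 2 / real p) \<le> 0.002"
  proof -
    have "(\<Sum>p\<in>{p\<in>P. real p \<le> z}. hK p ^ 2 / real p) \<le> (\<Sum>p\<in>P. hK p ^ 2 / real p)"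
      by (intro sum_mono2) auto
    also have "\<dots> \<le> (\<Sum>p\<in>P. 100 * (1 / real p ^ 2))"
    proof (rule sum_mono)
      fix p assume p: "p \<in> P"
      have r: "100000 < real p" using real_P p by auto
      have "hK p \<le> 7 / (real p - 7)" unfolding hK_def using r real_K by (intro frac_le) auto
      also have "\<dots> \<le> 10 / real p" using r by (simp add: field_simps)
      finally have "hK p \<le> 10 / real p" .
      then have "hK p ^ 2 \<le> (10 / real p) ^ 2" using h_nonneg[OF p] by (intro power_mono) auto
      then have "hK p ^ 2 / real p \<le> (10 / real p) ^ 2 / 1" using r by (intro frac_le) auto
      then show "hK p ^ 2 / real p \<le> 100 * (1 / real p ^ 2)" by (simp add: power_divide)
    qed
    also have "\<dots> = 100 * (\<Sum>p\<in>P. 1 / real p ^ 2)" by (simp add: sum_distrib_left)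
    also have "\<dots> \<le> 100 * (1 / real d)" using sum_inverse_square_P by (intro mult_left_mono) auto
    also have "\<dots> \<le> 0.002" using d by (simp add: field_simps)
    finally show ?thesis .
  qed
  have "(\<Sum>p\<in>{p\<in>P. real p \<le> z}. 1 / real p * Mb p) \<le> (\<Sum>p\<in>{p\<in>P. real p \<le> z}. 1 / real p * (2 * ln (real p) ^ 2 * C1 + 2 * hK p ^ 2 * M0))"
    using Mb by (intro sum_mono mult_left_mono) auto
  also have "\<dots> = 2 * C1 * (\<Sum>p\<in>{p\<in>P. real p \<le> z}. ln (real p) ^ 2 / real p) + 2 * M0 * (\<Sum>p\<in>{p\<in>P. real p \<le> z}. hK p ^ 2 / real p)"
    by (simp add: sum_distrib_left sum.distrib[symmetric] algebra_simps)
  also have "\<dots> \<le> 2 * C1 * (2 * ln z ^ 2) + 2 * M0 * 0.002"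
    using s1 s2 C10 M0_nonneg by (intro add_mono mult_left_mono) auto
  \<comment> \<open>With ln z at most ln D/1000 and \<open>C1_le\<close> the factor is 4 * 24/10^6,
    below 0.001.\<close>
  also have "2 * C1 * (2 * ln z ^ 2) \<le> 0.001 * M0"
  proof -
    have "(1000 * ln z) ^ 2 \<le> ln D ^ 2" using z by (intro power_mono) auto
    then have "1000000 * ln z ^ 2 \<le> ln D ^ 2" by (simp add: power_mult_distrib)
    then have "1000000 * ln z ^ 2 * C1 \<le> ln D ^ 2 * C1" using C10 by (intro mult_right_mono)
    then show ?thesis using C1_le M0_nonneg by (simp add: mult_ac)
  qed
  finally show ?thesis using M0_nonneg by simp
qed

text \<open>The single term with both sets empty. It shows that additive errors of size N are small
  against the main term N M0/Q.\<close>

lemma M0_ge: "(ln R * ln D)\<^sup>2 \<le> M0"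
proof -
  have "(\<Sum>x\<in>{({},{})}. case x of (S,T) \<Rightarrow> (Y S T)\<^sup>2 * (prod hK S * prod hc T)) \<le> M0"
    unfolding M0_def
  proof (rule sum_mono2)
    fix x assume "x \<in> disj_pairs P - {({},{})}"
    then show "0 \<le> (case x of (S,T) \<Rightarrow> (Y S T)\<^sup>2 * (prod hK S * prod hc T))"
    proof (cases x)
      case (Pair S T)
      then have "S \<subseteq> P" "T \<subseteq> P" using \<open>x \<in> _\<close> by (auto simp: disj_pairs_def)
      then show ?thesis using Pair prod_h_nonneg(1)[of S] prod_h_nonneg(3)[of T] by simp
    qed
  next
    show "{({},{})} \<subseteq> disj_pairs P" by (simp add: disj_pairs_def)
  qed simp
  moreover have "lR {} = ln R" "lD {} = ln D" using R1 D1 by (simp_all add: lR_def lD_def lnp_eq_ln)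
  ultimately show ?thesis by (simp add: Y_def)
qed

end

section \<open>Residue classes and error terms\<close>

lemma residue_class_exists:
  assumes "coprime A B" "v < A" "b < (B::nat)"
  obtains t where "t < A * B" "\<And>n. n mod (A * B) = t \<longleftrightarrow> n mod A = v \<and> n mod B = b"
proof -
  have pos: "0 < A" "0 < B" using assms by auto
  note bij = bij_betw_mod_pair[OF assms(1) pos]
  have "(v, b) \<in> (\<lambda>x. (x mod A, x mod B)) ` {..<A * B}"
    using bij assms by (simp add: bij_betw_def)
  then obtain t where t: "t < A * B" "t mod A = v" "t mod B = b" by auto
  have mm: "n mod (A * B) mod A = n mod A" "n mod (A * B) mod B = n mod B" for n
    by (simp_all add: mod_mod_cancel)
  show ?thesis
  proof (rule that[OF t(1)])
    fix n
    show "n mod (A * B) = t \<longleftrightarrow> n mod A = v \<and> n mod B = b"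
    proof
      assume "n mod (A * B) = t"
      then show "n mod A = v \<and> n mod B = b" using t mm[of n] by simp
    next
      assume n: "n mod A = v \<and> n mod B = b"
      have "n mod (A * B) < A * B" using pos by simp
      then show "n mod (A * B) = t"
        using bij_betw_imp_inj_on[OF bij, THEN inj_onD, of "n mod (A * B)" t] n t mm[of n] by auto
    qed
  qed
qed

lemma card_residue_class:
  assumes "t < (q::nat)"
  shows "\<bar>real (card {n. n < M \<and> n mod q = t}) - real M / real q\<bar> \<le> 1"
proof -
  have q: "0 < q" using assms by simp
  have inj: "inj (\<lambda>k. t + k * q)" using q by (auto intro!: injI)
  have up: "{n. n < M \<and> n mod q = t} \<subseteq> (\<lambda>k. t + k * q) ` {..M div q}"
  proof
    fix n assume n: "n \<in> {n. n < M \<and> n mod q = t}"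
    then have "n = t + (n div q) * q" using mod_div_mult_eq[of n q] by simp
    moreover have "n div q \<le> M div q" using n by (intro div_le_mono) auto
    ultimately show "n \<in> (\<lambda>k. t + k * q) ` {..M div q}" by blast
  qed
  have lo: "(\<lambda>k. t + k * q) ` {..<M div q} \<subseteq> {n. n < M \<and> n mod q = t}"
  proof clarify
    fix k assume k: "k < M div q"
    have "t + k * q < Suc k * q" using assms by simp
    also have "\<dots> \<le> (M div q) * q" using k by (intro mult_le_mono1) simp
    also have "\<dots> \<le> M" by simp
    finally show "t + k * q < M \<and> (t + k * q) mod q = t" using assms by simp
  qed
  have "card {n. n < M \<and> n mod q = t} \<le> card ((\<lambda>k. t + k * q) ` {..M div q})"
    using up by (intro card_mono) auto
  also have "\<dots> \<le> M div q + 1" using card_image_le[of "{..M div q}" "\<lambda>k. t + k * q"] by simp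
  finally have 1: "card {n. n < M \<and> n mod q = t} \<le> M div q + 1" .
  have "card ((\<lambda>k. t + k * q) ` {..<M div q}) \<le> card {n. n < M \<and> n mod q = t}"
    using lo by (intro card_mono) auto
  then have 2: "M div q \<le> card {n. n < M \<and> n mod q = t}"
    using inj by (subst (asm) card_image) (auto intro: inj_on_subset)
  have 3: "real (M div q) \<le> real M / real q" by (rule of_nat_div_le_of_nat)
  have "real M < real (M div q) * real q + real q"
  proof -
    have "M < M div q * q + q" using dividend_less_times_div[of q M] q by (simp add: mult.commute add.commute)
    then have "real M < real (M div q * q + q)" by (simp only: of_nat_less_iff)
    then show ?thesis by (simp only: of_nat_add of_nat_mult)
  qed
  then have 4: "real M / real q \<le> real (M div q) + 1" using q by (simp add: field_simps)
  have 5: "real (card {n. n < M \<and> n mod q = t}) \<le> real (M div q) + 1" using 1 by linarith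
  have 6: "real (M div q) \<le> real (card {n. n < M \<and> n mod q = t})" using 2 by simp
  show ?thesis using 3 4 5 6 by linarith
qed

lemma card_residue_class_interval:
  assumes "t < (q::nat)"
  shows "\<bar>real (card {n\<in>{N<..2*N}. n mod q = t}) - real N / real q\<bar> \<le> 2"
proof -
  define A where "A = {n. n < 2*N+1 \<and> n mod q = t}"
  define A' where "A' = {n. n < N+1 \<and> n mod q = t}"
  define A'' where "A'' = {n\<in>{N<..2*N}. n mod q = t}"
  have "A = A' \<union> A''" unfolding A_def A'_def A''_def by auto
  moreover have "card (A' \<union> A'') = card A' + card A''"
    by (rule card_Un_disjoint) (auto simp: A'_def A''_def)
  ultimately have "card {n. n < 2*N+1 \<and> n mod q = t} = card {n. n < N+1 \<and> n mod q = t} + card {n\<in>{N<..2*N}. n mod q = t}"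
    by (simp only: A_def A'_def A''_def)
  moreover have "real (2*N+1) / real q - real (N+1) / real q = real N / real q"
    by (simp add: diff_divide_distrib[symmetric])
  ultimately show ?thesis
    using card_residue_class[OF assms, of "2*N+1"] card_residue_class[OF assms, of "N+1"] by linarith
qed

lemma totient_prod_primes:
  assumes "finite W" "\<And>p. p \<in> W \<Longrightarrow> prime (p::nat)"
  shows "real (totient (\<Prod>W)) = (\<Prod>p\<in>W. real p - 1)"
  using assms
proof (induction W rule: finite_induct)
  case (insert p W)
  have p: "prime p" using insert by simp
  have "coprime p (\<Prod>W)"
  proof (rule prod_coprime_right)
    fix r assume r: "r \<in> W"
    then have "p \<noteq> r" "prime r" using insert by auto
    then show "coprime p r" using p by (intro primes_coprime)
  qed
  then have "totient (\<Prod>(insert p W)) = (p - 1) * totient (\<Prod>W)"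
    using insert.hyps p by (simp add: totient_mult_coprime totient_prime)
  then show ?case using insert p prime_ge_1_nat[OF p] by (simp add: of_nat_diff)
qed simp

section \<open>Divisor-weighted sums of error terms\<close>

lemma sum_card_power_le:
  assumes "finite P" "\<And>p. p \<in> P \<Longrightarrow> prime p" "1 \<le> x"
  shows "(\<Sum>W\<in>{W\<in>Pow P. pr W \<le> x}. real C ^ card W) \<le> x * (1 + ln x) ^ C"
proof -
  have pr0: "0 < pr W" if "W \<subseteq> P" for W unfolding pr_def
    using that assms(2) prime_gt_0_nat by (intro prod_pos) auto
  have "(\<Sum>W\<in>{W\<in>Pow P. pr W \<le> x}. real C ^ card W) \<le> (\<Sum>W\<in>{W\<in>Pow P. pr W \<le> x}. x * (real C ^ card W / pr W))"
  proof (rule sum_mono)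
    fix W assume W: "W \<in> {W\<in>Pow P. pr W \<le> x}"
    have "real C ^ card W = pr W * (real C ^ card W / pr W)" using W pr0[of W] by simp
    also have "\<dots> \<le> x * (real C ^ card W / pr W)" using W pr0[of W] by (intro mult_right_mono) auto
    finally show "real C ^ card W \<le> x * (real C ^ card W / pr W)" .
  qed
  also have "\<dots> = x * (\<Sum>W\<in>{W\<in>Pow P. pr W \<le> x}. real C ^ card W / pr W)" by (simp add: sum_distrib_left)
  also have "\<dots> \<le> x * (1 + ln x) ^ C" using assms by (intro mult_left_mono sum_Pow_card_power_le) auto
  finally show ?thesis .
qed

text \<open>The distribution conditions control the unweighted sum of errors, but squaring the sieve
  introduces \<open>C ^ card W\<close>. Cauchy-Schwarz separates the two: the weight, paired with
  the trivial bound, costs a power of the logarithm, which the arbitrary power saved in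
  \<open>Sb\<close> outweighs.\<close>

lemma weighted_error_sum_le:
  assumes P: "finite P" "\<And>p. p \<in> P \<Longrightarrow> prime p" "1 \<le> x"
    and E: "\<And>W. W \<subseteq> P \<Longrightarrow> pr W \<le> x \<Longrightarrow> 0 \<le> E W" "\<And>W. W \<subseteq> P \<Longrightarrow> pr W \<le> x \<Longrightarrow> E W \<le> Tb * 2 ^ card W / pr W"
    and S: "(\<Sum>W\<in>{W\<in>Pow P. pr W \<le> x}. E W) \<le> Sb" and Tb: "0 \<le> Tb"
  shows "(\<Sum>W\<in>{W\<in>Pow P. pr W \<le> x}. real C ^ card W * E W)\<^sup>2 \<le> Tb * (1 + ln x) ^ (2 * C\<^sup>2) * Sb"
proof -
  let ?A = "{W\<in>Pow P. pr W \<le> x}"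
  have pr0: "0 < pr W" if "W \<subseteq> P" for W unfolding pr_def
    using that assms(2) prime_gt_0_nat by (intro prod_pos) auto
  have E0: "0 \<le> E W" if "W \<in> ?A" for W using E that by auto
  have "(\<Sum>W\<in>?A. real C ^ card W * E W) = (\<Sum>W\<in>?A. (real C ^ card W * sqrt (E W)) * sqrt (E W))"
    using E0 by (intro sum.cong) auto
  then have "(\<Sum>W\<in>?A. real C ^ card W * E W)\<^sup>2 = (\<Sum>W\<in>?A. (real C ^ card W * sqrt (E W)) * sqrt (E W))\<^sup>2" by simp
  also have "\<dots> \<le> (\<Sum>W\<in>?A. (real C ^ card W * sqrt (E W))\<^sup>2) * (\<Sum>W\<in>?A. (sqrt (E W))\<^sup>2)"
    by (rule Cauchy_Schwarz_ineq_sum)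
  also have "(\<Sum>W\<in>?A. (sqrt (E W))\<^sup>2) = (\<Sum>W\<in>?A. E W)" using E0 by (intro sum.cong) auto
  also have "(\<Sum>W\<in>?A. (real C ^ card W * sqrt (E W))\<^sup>2) * (\<Sum>W\<in>?A. E W) \<le> (Tb * (1 + ln x) ^ (2 * C\<^sup>2)) * Sb"
  proof (rule mult_mono)
    have "(\<Sum>W\<in>?A. (real C ^ card W * sqrt (E W))\<^sup>2) \<le> (\<Sum>W\<in>?A. Tb * (real (2 * C\<^sup>2) ^ card W / pr W))"
    proof (rule sum_mono)
      fix W assume W: "W \<in> ?A"
      have "(real C ^ card W * sqrt (E W))\<^sup>2 = (real C ^ 2) ^ card W * E W"
        using E0[OF W] by (simp add: power_mult_distrib power_mult[symmetric] mult.commute)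
      also have "\<dots> \<le> (real C ^ 2) ^ card W * (Tb * 2 ^ card W / pr W)"
        using W E by (intro mult_left_mono) auto
      also have "\<dots> = Tb * (real (2 * C\<^sup>2) ^ card W / pr W)" by (simp add: power_mult_distrib)
      finally show "(real C ^ card W * sqrt (E W))\<^sup>2 \<le> Tb * (real (2 * C\<^sup>2) ^ card W / pr W)" .
    qed
    also have "\<dots> = Tb * (\<Sum>W\<in>?A. real (2 * C\<^sup>2) ^ card W / pr W)" by (simp add: sum_distrib_left)
    also have "\<dots> \<le> Tb * (1 + ln x) ^ (2 * C\<^sup>2)" using P Tb by (intro mult_left_mono sum_Pow_card_power_le)
    finally show "(\<Sum>W\<in>?A. (real C ^ card W * sqrt (E W))\<^sup>2) \<le> Tb * (1 + ln x) ^ (2 * C\<^sup>2)" .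
    show "0 \<le> Tb * (1 + ln x) ^ (2 * C\<^sup>2)" using Tb P(3) by simp
  qed (use S E0 in \<open>auto intro!: sum_nonneg\<close>)
  finally show ?thesis .
qed

text \<open>Different prime sets give different moduli, so the errors that occur form part of the
  full sum over moduli in the distribution conditions.\<close>

lemma sum_moduli_le:
  fixes g :: "nat \<Rightarrow> real"
  assumes P: "finite P" "\<And>p. p \<in> P \<Longrightarrow> prime p" and Q: "0 < Q" "real Q * x \<le> y" and g: "\<And>q. 1 \<le> q \<Longrightarrow> 0 \<le> g q"
  shows "(\<Sum>W\<in>{W\<in>Pow P. pr W \<le> x}. g (Q * \<Prod>W)) \<le> (\<Sum>q\<in>{q::nat. 1 \<le> q \<and> real q \<le> y}. g q)"
proof -
  let ?A = "{W\<in>Pow P. pr W \<le> x}"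
  have inj: "inj_on (\<lambda>W. Q * \<Prod>W) ?A"
  proof (rule inj_onI)
    fix W W' assume "W \<in> ?A" "W' \<in> ?A" "Q * \<Prod>W = Q * \<Prod>W'"
    then show "W = W'" using Q inj_on_prod_primes[OF P, THEN inj_onD, of W W'] by simp
  qed
  have "(\<Sum>W\<in>?A. g (Q * \<Prod>W)) = (\<Sum>q\<in>(\<lambda>W. Q * \<Prod>W) ` ?A. g q)"
    by (subst sum.reindex[OF inj]) (simp add: o_def)
  also have "\<dots> \<le> (\<Sum>q\<in>{q::nat. 1 \<le> q \<and> real q \<le> y}. g q)"
  proof (rule sum_mono2)
    have "{q::nat. 1 \<le> q \<and> real q \<le> y} \<subseteq> {..nat \<lfloor>y\<rfloor>}" by (auto simp: le_nat_floor)
    then show "finite {q::nat. 1 \<le> q \<and> real q \<le> y}" by (rule finite_subset) simp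
    show "(\<lambda>W. Q * \<Prod>W) ` ?A \<subseteq> {q::nat. 1 \<le> q \<and> real q \<le> y}"
    proof clarify
      fix W assume W: "W \<subseteq> P" "pr W \<le> x"
      have "0 < \<Prod>W" using W P prime_gt_0_nat by (intro prod_pos) auto
      then have "1 \<le> Q * \<Prod>W" using Q by (simp add: Suc_le_eq)
      moreover have "real Q * pr W \<le> real Q * x" using W by (intro mult_left_mono) auto
      then have "real Q * pr W \<le> y" using Q(2) by (rule order.trans)
      then have "real (Q * \<Prod>W) \<le> y" by (simp add: pr_def)
      ultimately show "1 \<le> Q * \<Prod>W \<and> real (Q * \<Prod>W) \<le> y" by (rule conjI)
    qed
  qed (use g in auto)
  finally show ?thesis .
qed

section \<open>The weighted sums\<close>

text \<open>Fixing n modulo Q keeps all n + h and n + c free of primes up to d. As no shift exceeds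
  d, every prime of \<open>P\<close> separates the shifts.\<close>

locale sieve_setup = sieve_main +
  fixes Hs :: "nat set" and c v N :: nat
  assumes card_Hs: "card Hs = K" and c_Hs: "c \<notin> Hs" and small: "\<And>h. h \<in> insert c Hs \<Longrightarrow> h \<le> d"
    and v_lt: "v < Q" and v_cop: "\<And>h. h \<in> insert c Hs \<Longrightarrow> coprime (v + h) Q"
    and R_le: "R \<le> real N" and D_le: "D \<le> real N" and lnN: "1 \<le> ln (real N)"
begin

definition "f n = sieve_fun P Y (psi Hs hK) (phi Hs c) n"
definition "I = {n\<in>{N<..2*N}. n mod Q = v}"
text \<open>Bounds \<open>Y\<close> and, up to \<open>2 ^ card S\<close>, also \<open>Ys\<close>: a
  factor at most (2 ln N)^2 from the sum over M and another (ln N)^2 from \<open>Y\<close>.\<close>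

definition "Ym = 4 * ln (real N) ^ 4"
definition "L = R * D"
text \<open>64 * C from \<open>sieve_square_sum\<close>, where C = 2K bounds the l1 norms of the
  local functions.\<close>

definition "CC = 128 * K"

lemma finI [simp]: "finite I"
  by (simp add: I_def)

lemma fin_Hs: "finite Hs"
  using card_Hs K card.infinite[of Hs] by fastforce

lemma prime_forms_P: "p \<in> P \<Longrightarrow> prime_forms Hs c p"
proof
  assume p: "p \<in> P"
  show "finite Hs" by (rule fin_Hs)
  show "c \<notin> Hs" by (rule c_Hs)
  show "h < p" if "h \<in> insert c Hs" for h using small[OF that] P_d[OF p] by simp
  show "2 * card Hs + 2 \<le> p" using card_Hs K P_d[OF p] d by simp
qed

lemma N_pos: "0 < real N"
proof -
  have "N \<noteq> 0" using lnN by (intro notI) simp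
  then show ?thesis by simp
qed

lemma lR_le: assumes "S \<subseteq> P" shows "lR S \<le> ln (real N)"
proof -
  have "R / pr S \<le> R / 1" using pr_ge_1_P[OF assms] R1 by (intro divide_left_mono) auto
  then have "lR S \<le> lnp R" unfolding lR_def using pr_ge_1_P[OF assms] R1 by (intro lnp_mono) auto
  also have "\<dots> \<le> ln (real N)" using R1 R_le by (simp add: lnp_eq_ln)
  finally show ?thesis .
qed

lemma lD_le: assumes "T \<subseteq> P" shows "lD T \<le> ln (real N)"
proof -
  have "D / pr T \<le> D / 1" using pr_ge_1_P[OF assms] D1 by (intro divide_left_mono) auto
  then have "lD T \<le> lnp D" unfolding lD_def using pr_ge_1_P[OF assms] D1 by (intro lnp_mono) auto
  also have "\<dots> \<le> ln (real N)" using D1 D_le by (simp add: lnp_eq_ln)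
  finally show ?thesis .
qed

lemma lR_zero: assumes "S \<subseteq> P" "lR S \<noteq> 0" shows "pr S \<le> R"
proof (rule ccontr)
  assume "\<not> pr S \<le> R"
  then have "lR S = 0" unfolding lR_def using pr_ge_1_P[OF assms(1)] R1 by (intro lnp_eq_0) auto
  then show False using assms by simp
qed

lemma lD_zero: assumes "S \<subseteq> P" "lD S \<noteq> 0" shows "pr S \<le> D"
proof (rule ccontr)
  assume "\<not> pr S \<le> D"
  then have "lD S = 0" unfolding lD_def using pr_ge_1_P[OF assms(1)] D1 by (intro lnp_eq_0) auto
  then show False using assms by simp
qed

lemma Y_nonneg: "0 \<le> Y S T"
  by (simp add: Y_def)

lemma Y_le: assumes "S \<subseteq> P" "T \<subseteq> P" shows "Y S T \<le> ln (real N) ^ 2"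
  unfolding Y_def power2_eq_square using lR_le[OF assms(1)] lD_le[OF assms(2)] lnN by (intro mult_mono) auto

lemma ln2_le: "ln (real N) ^ 2 \<le> ln (real N) ^ 4"
  using lnN by (intro power_increasing) auto

lemma Ym_pos: "0 \<le> Ym" by (simp add: Ym_def)

lemma mult_ge_le:
  assumes "S \<subseteq> P" "T \<subseteq> P" "pr S \<le> R" "pr T \<le> D"
  shows "pr S * pr T \<le> L"
  unfolding L_def using assms pr_ge_1_P[OF assms(1)] pr_ge_1_P[OF assms(2)] R1 by (intro mult_mono) auto

lemma Y_supp: assumes "S \<subseteq> P" "T \<subseteq> P" "Y S T \<noteq> 0" shows "pr S * pr T \<le> L"
  using assms by (intro mult_ge_le lR_zero lD_zero) (auto simp: Y_def)

lemma hK_le1: assumes "p \<in> P" shows "hK p \<le> 1" "hs p \<le> 1" "hs p \<le> hK p"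
proof -
  have r: "100000 < real p" using real_P assms by auto
  show "hK p \<le> 1" "hs p \<le> 1" "hs p \<le> hK p" using r real_K
    by (auto simp: hK_def hs_def field_simps intro!: divide_right_mono)
qed

text \<open>A common instance of \<open>sieve_square_sum\<close>: \<open>P'\<close> may lack a prime
  (the case of p dividing n + c), and \<gamma> and \<open>t\<close> cover both densities. The
  squared norm of \<open>psi\<close> equals its value \<open>t\<close>.\<close>

lemma square_sum:
  fixes a :: "nat \<Rightarrow> real"
  assumes J: "finite J" and P': "P' \<subseteq> P" and t: "t = hK \<or> t = hs"
    and orth: "\<And>p. p \<in> P' \<Longrightarrow> (\<Sum>b<p. \<gamma> p b * psi Hs t p b) = 0" "\<And>p. p \<in> P' \<Longrightarrow> (\<Sum>b<p. \<gamma> p b * phi Hs c p b) = 0"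
      "\<And>p. p \<in> P' \<Longrightarrow> (\<Sum>b<p. \<gamma> p b * (psi Hs t p b * phi Hs c p b)) = 0"
      "\<And>p. p \<in> P' \<Longrightarrow> (\<Sum>b<p. \<gamma> p b * (psi Hs t p b)\<^sup>2) = t p" "\<And>p. p \<in> P' \<Longrightarrow> (\<Sum>b<p. \<gamma> p b * (phi Hs c p b)\<^sup>2) = h\<phi> p"
    and supp: "\<And>S T. S \<subseteq> P' \<Longrightarrow> T \<subseteq> P' \<Longrightarrow> Z S T \<noteq> 0 \<Longrightarrow> pr S * pr T \<le> L"
    and Zm: "\<And>S T. S \<subseteq> P' \<Longrightarrow> T \<subseteq> P' \<Longrightarrow> \<bar>Z S T\<bar> \<le> Ym * 2 ^ card S"
    and E: "\<And>W b. W \<subseteq> P' \<Longrightarrow> pr W \<le> L\<^sup>2 \<Longrightarrow> b < \<Prod>W \<Longrightarrow>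
        \<bar>(\<Sum>n\<in>{n\<in>J. n mod \<Prod>W = b}. a n) - X * (\<Prod>p\<in>W. \<gamma> p (b mod p))\<bar> \<le> E W"
    and E0: "\<And>W. W \<subseteq> P \<Longrightarrow> 0 \<le> E W"
  shows "\<bar>(\<Sum>n\<in>J. a n * (sieve_fun P' Z (psi Hs t) (phi Hs c) n)\<^sup>2)
           - X * (\<Sum>(S,T)\<in>disj_pairs P'. (Z S T)\<^sup>2 * (prod t S * prod h\<phi> T))\<bar>
     \<le> Ym\<^sup>2 * (\<Sum>W\<in>{W\<in>Pow P. pr W \<le> L\<^sup>2}. real CC ^ card W * E W)"
proof -
  have KH: "real (card Hs) = real K" using card_Hs by simp
  have tp: "0 \<le> t p" "t p \<le> 1" "t p \<le> real (card Hs) / (real p - real (card Hs))" if "p \<in> P" for p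
    using that t h_nonneg[OF that] hK_le1[OF that] unfolding KH hK_def[symmetric] by auto
  have "\<bar>(\<Sum>n\<in>J. a n * (sieve_fun P' Z (psi Hs t) (phi Hs c) n)\<^sup>2)
           - X * (\<Sum>(S,T)\<in>disj_pairs P'. (Z S T)\<^sup>2 * (prod t S * prod h\<phi> T))\<bar>
     \<le> Ym\<^sup>2 * (\<Sum>W\<in>{W\<in>Pow P'. pr W \<le> L\<^sup>2}. (64 * (2 * real K)) ^ card W * E W)"
  proof (rule sieve_square_sum[where \<gamma> = \<gamma>])
    show "finite P'" using P' finite_sub_P by auto
    fix p assume "p \<in> P'"
    then have p: "p \<in> P" using P' by auto
    interpret pf: prime_forms Hs c p by (rule prime_forms_P[OF p])
    show "prime p" by (rule P_prime[OF p])
    show "\<bar>psi Hs t p n\<bar> \<le> 1" for n using tp[OF p] by (intro pf.psi_bound) auto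
    show "\<bar>phi Hs c p n\<bar> \<le> 1" for n by (rule pf.phi_bound)
    show "(\<Sum>b<p. \<bar>psi Hs t p b\<bar>) \<le> 2 * real K" using pf.sum_abs_psi[of t, OF tp(1,3)[OF p]] KH by simp
    show "(\<Sum>b<p. \<bar>phi Hs c p b\<bar>) \<le> 2 * real K" using pf.sum_abs_phi real_K by simp
    show "psi Hs t p (n mod p) = psi Hs t p n" for n by (rule psi_mod)
    show "phi Hs c p (n mod p) = phi Hs c p n" for n by (rule phi_mod)
  qed (use J orth supp Zm E E0 P' in auto)
  also have "\<dots> \<le> Ym\<^sup>2 * (\<Sum>W\<in>{W\<in>Pow P. pr W \<le> L\<^sup>2}. real CC ^ card W * E W)"
  proof (rule mult_left_mono)
    have "64 * (2 * real K) = real CC" by (simp add: CC_def)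
    then show "(\<Sum>W\<in>{W\<in>Pow P'. pr W \<le> L\<^sup>2}. (64 * (2 * real K)) ^ card W * E W) \<le> (\<Sum>W\<in>{W\<in>Pow P. pr W \<le> L\<^sup>2}. real CC ^ card W * E W)"
      using P' E0 by (simp only:) (intro sum_mono2, auto)
  qed simp
  finally show ?thesis .
qed

lemma coprime_prodW: assumes "W \<subseteq> P" shows "coprime Q (\<Prod>W)"
  using assms coprime_PQ by (intro prod_coprime_right) (auto simp: coprime_commute)

lemma prodW_pos: "W \<subseteq> P \<Longrightarrow> 0 < \<Prod>W"
  using P_ge_1 by (intro prod_pos) force

lemma class_count:
  assumes A: "0 < A" "u < A" "coprime A (\<Prod>W)" and W: "W \<subseteq> P" "b < \<Prod>W"
  shows "\<bar>(\<Sum>n\<in>{n\<in>{n\<in>{N<..2*N}. n mod A = u}. n mod \<Prod>W = b}. (1::real)) - real N / real A * (\<Prod>p\<in>W. 1 / real p)\<bar> \<le> 2"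
proof -
  obtain t where t: "t < A * \<Prod>W" "\<And>n. n mod (A * \<Prod>W) = t \<longleftrightarrow> n mod A = u \<and> n mod \<Prod>W = b"
    using residue_class_exists[OF A(3,2) W(2)] by blast
  have "{n\<in>{n\<in>{N<..2*N}. n mod A = u}. n mod \<Prod>W = b} = {n\<in>{N<..2*N}. n mod (A * \<Prod>W) = t}"
    using t(2) by blast
  then have "(\<Sum>n\<in>{n\<in>{n\<in>{N<..2*N}. n mod A = u}. n mod \<Prod>W = b}. (1::real)) = real (card {n\<in>{N<..2*N}. n mod (A * \<Prod>W) = t})"
    by (simp only: sum_constant mult_1_right)
  moreover have "real N / real A * (\<Prod>p\<in>W. 1 / real p) = real N / real (A * \<Prod>W)"
    by (simp add: prod_dividef)
  ultimately show ?thesis using card_residue_class_interval[OF t(1), of N] by presburger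
qed

lemma total_sum_bound:
  "\<bar>(\<Sum>n\<in>I. (f n)\<^sup>2) - real N / real Q * M0\<bar> \<le> Ym\<^sup>2 * (\<Sum>W\<in>{W\<in>Pow P. pr W \<le> L\<^sup>2}. real CC ^ card W * 2)"
proof -
  have "\<bar>(\<Sum>n\<in>I. 1 * (sieve_fun P Y (psi Hs hK) (phi Hs c) n)\<^sup>2)
           - real N / real Q * (\<Sum>(S,T)\<in>disj_pairs P. (Y S T)\<^sup>2 * (prod hK S * prod hc T))\<bar>
     \<le> Ym\<^sup>2 * (\<Sum>W\<in>{W\<in>Pow P. pr W \<le> L\<^sup>2}. real CC ^ card W * 2)"
  proof (rule square_sum[where \<gamma> = "\<lambda>p b. 1 / real p"])
    fix p assume p: "p \<in> P"
    interpret pf: prime_forms Hs c p by (rule prime_forms_P[OF p])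
    have h: "hK p = real (card Hs) / (real p - real (card Hs))" by (simp add: hK_def card_Hs)
    note o = pf.orth_uniform[of hK, OF h]
    show "(\<Sum>b<p. 1 / real p * psi Hs hK p b) = 0" "(\<Sum>b<p. 1 / real p * phi Hs c p b) = 0"
      "(\<Sum>b<p. 1 / real p * (psi Hs hK p b * phi Hs c p b)) = 0"
      by (rule o)+
    show "(\<Sum>b<p. 1 / real p * (psi Hs hK p b)\<^sup>2) = hK p" unfolding h by (rule o)
    show "(\<Sum>b<p. 1 / real p * (phi Hs c p b)\<^sup>2) = hc p" using o(5) by (simp add: hc_def card_Hs)
  next
    fix S T assume ST: "S \<subseteq> P" "T \<subseteq> P"
    have "\<bar>Y S T\<bar> \<le> ln (real N) ^ 4" using Y_nonneg[of S T] Y_le[OF ST] ln2_le by simp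
    also have "\<dots> \<le> Ym * 1" by (simp add: Ym_def)
    also have "\<dots> \<le> Ym * 2 ^ card S" using Ym_pos by (intro mult_left_mono) auto
    finally show "\<bar>Y S T\<bar> \<le> Ym * 2 ^ card S" .
  next
    fix W b assume W: "W \<subseteq> P" "b < \<Prod>W"
    show "\<bar>(\<Sum>n\<in>{n\<in>I. n mod \<Prod>W = b}. 1) - real N / real Q * (\<Prod>p\<in>W. 1 / real p)\<bar> \<le> 2"
      unfolding I_def using W v_lt coprime_prodW Q_gt_1 by (intro class_count) auto
  qed (use Y_supp in auto)
  then show ?thesis by (simp add: f_def M0_def)
qed

text \<open>The class of v modulo Q and that of -c modulo p combine into one class modulo Qp, and
  the weight no longer involves p. The density of the class accounts for the factor 1/p in front of
  \<open>Mb p\<close>.\<close>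

lemma small_factor_sum_bound:
  assumes p: "p \<in> P"
  shows "\<bar>(\<Sum>n\<in>{n\<in>I. p dvd n + c}. (f n)\<^sup>2) - real N / real Q * (1 / real p * Mb p)\<bar>
     \<le> Ym\<^sup>2 * (\<Sum>W\<in>{W\<in>Pow P. pr W \<le> L\<^sup>2}. real CC ^ card W * 2)"
proof -
  let ?J = "{n\<in>I. p dvd n + c}"
  let ?P = "P - {p}"
  interpret pp: prime_forms Hs c p by (rule prime_forms_P[OF p])
  have pc: "c < p" using pp.small by simp
  have p1: "0 < p" using P_ge_1[OF p] by simp
  obtain u where u: "u < Q * p" "\<And>n. n mod (Q * p) = u \<longleftrightarrow> n mod Q = v \<and> n mod p = (p - c) mod p"
    using residue_class_exists[of Q p v "(p - c) mod p"] coprime_PQ[OF p] v_lt p1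
    by (metis coprime_commute mod_less_divisor)
  have dv: "p dvd n + c \<longleftrightarrow> n mod p = (p - c) mod p" for n
    using pp.dvd_iff_residue[OF pc, of "n mod p"] p1 dvd_mod_add_iff[of p n c] by simp
  have J: "?J = {n\<in>{N<..2*N}. n mod (Q * p) = u}"
    using u(2) dv by (auto simp: I_def)
  have feq: "f n = sieve_fun ?P (Yb p) (psi Hs hK) (phi Hs c) n" if "p dvd n + c" for n
  proof -
    have "\<not> hits Hs p n" using that by (rule pp.not_hits_of_dvd_centre)
    then have "psi Hs hK p n = hK p" by (simp add: psi_def)
    moreover have "phi Hs c p n = -1" using that by (simp add: phi_def)
    ultimately show ?thesis unfolding f_def by (subst sieve_fun_remove[OF finP p]) (simp_all add: Yb_def[abs_def])
  qed
  have bd: "\<bar>(\<Sum>n\<in>?J. 1 * (sieve_fun ?P (Yb p) (psi Hs hK) (phi Hs c) n)\<^sup>2)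
           - real N / real (Q * p) * (\<Sum>(S,T)\<in>disj_pairs ?P. (Yb p S T)\<^sup>2 * (prod hK S * prod hc T))\<bar>
     \<le> Ym\<^sup>2 * (\<Sum>W\<in>{W\<in>Pow P. pr W \<le> L\<^sup>2}. real CC ^ card W * 2)"
  proof (rule square_sum[where \<gamma> = "\<lambda>p b. 1 / real p"])
    fix q assume "q \<in> ?P"
    then have q: "q \<in> P" by simp
    interpret pf: prime_forms Hs c q by (rule prime_forms_P[OF q])
    have h: "hK q = real (card Hs) / (real q - real (card Hs))" by (simp add: hK_def card_Hs)
    note o = pf.orth_uniform[of hK, OF h]
    show "(\<Sum>b<q. 1 / real q * psi Hs hK q b) = 0" "(\<Sum>b<q. 1 / real q * phi Hs c q b) = 0"
      "(\<Sum>b<q. 1 / real q * (psi Hs hK q b * phi Hs c q b)) = 0"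
      by (rule o)+
    show "(\<Sum>b<q. 1 / real q * (psi Hs hK q b)\<^sup>2) = hK q" unfolding h by (rule o)
    show "(\<Sum>b<q. 1 / real q * (phi Hs c q b)\<^sup>2) = hc q" using o(5) by (simp add: hc_def card_Hs)
  next
    fix S T assume ST: "S \<subseteq> ?P" "T \<subseteq> ?P"
    then have ST': "S \<subseteq> P" "T \<subseteq> P" "insert p S \<subseteq> P" "insert p T \<subseteq> P" using p by auto
    have pr_ins: "pr S \<le> pr (insert p S)" "pr T \<le> pr (insert p T)"
      using ST' finite_sub_P P_ge_1 by (auto intro!: pr_mono)
    have hY: "0 \<le> hK p * Y (insert p S) T" "hK p * Y (insert p S) T \<le> 1 * ln (real N) ^ 2"
      using h_nonneg[OF p] Y_nonneg mult_mono[OF hK_le1(1)[OF p] Y_le[OF ST'(3,2)]] by auto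
    have "\<bar>Yb p S T\<bar> \<le> 2 * ln (real N) ^ 2"
      unfolding Yb_def using Y_nonneg[of S T] Y_nonneg[of S "insert p T"] Y_le[OF ST'(1,2)] Y_le[OF ST'(1,4)] hY
      by linarith
    also have "\<dots> \<le> Ym * 1" unfolding Ym_def using ln2_le zero_le_power[of "ln (real N)" 4] lnN by linarith
    also have "\<dots> \<le> Ym * 2 ^ card S" using Ym_pos by (intro mult_left_mono) auto
    finally show "\<bar>Yb p S T\<bar> \<le> Ym * 2 ^ card S" .
    show "pr S * pr T \<le> L" if nz: "Yb p S T \<noteq> 0"
    proof -
      consider "Y S T \<noteq> 0" | "Y (insert p S) T \<noteq> 0" | "Y S (insert p T) \<noteq> 0"
        using nz unfolding Yb_def by fastforce
      then show ?thesis
      proof cases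
        case 1 then show ?thesis using ST' by (intro Y_supp)
      next
        case 2
        then have "pr (insert p S) * pr T \<le> L" using ST' by (intro Y_supp)
        moreover have "pr S * pr T \<le> pr (insert p S) * pr T" using pr_ins pr_ge_1_P[OF ST'(2)] by (intro mult_right_mono) auto
        ultimately show ?thesis by linarith
      next
        case 3
        then have "pr S * pr (insert p T) \<le> L" using ST' by (intro Y_supp)
        moreover have "pr S * pr T \<le> pr S * pr (insert p T)" using pr_ins pr_ge_1_P[OF ST'(1)] by (intro mult_left_mono) auto
        ultimately show ?thesis by linarith
      qed
    qed
  next
    fix W b assume W: "W \<subseteq> ?P" "b < \<Prod>W"
    have "coprime p (\<Prod>W)"
    proof (rule prod_coprime_right)
      fix r assume "r \<in> W"
      then show "coprime p r" using W P_prime p by (intro primes_coprime) auto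
    qed
    then have "coprime (Q * p) (\<Prod>W)" using W coprime_prodW[of W] by auto
    then show "\<bar>(\<Sum>n\<in>{n\<in>?J. n mod \<Prod>W = b}. 1) - real N / real (Q * p) * (\<Prod>p\<in>W. 1 / real p)\<bar> \<le> 2"
      unfolding J using W u(1) Q_gt_1 p1 by (intro class_count) auto
  qed auto
  have e1: "(\<Sum>n\<in>?J. 1 * (sieve_fun ?P (Yb p) (psi Hs hK) (phi Hs c) n)\<^sup>2) = (\<Sum>n\<in>?J. (f n)\<^sup>2)"
    using feq by (intro sum.cong) auto
  have e2: "real N / real (Q * p) * (\<Sum>(S,T)\<in>disj_pairs ?P. (Yb p S T)\<^sup>2 * (prod hK S * prod hc T))
      = real N / real Q * (1 / real p * Mb p)"
    by (simp add: Mb_def)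
  show ?thesis using bd unfolding e1 e2 .
qed

text \<open>For a sequence that is small in every class: \<open>square_sum\<close> with
  \<open>X = 0\<close>. It will be applied to the Liouville function at n + c.\<close>

lemma twisted_sum_bound:
  assumes E: "\<And>W b. W \<subseteq> P \<Longrightarrow> pr W \<le> L\<^sup>2 \<Longrightarrow> b < \<Prod>W \<Longrightarrow> \<bar>\<Sum>n\<in>{n\<in>I. n mod \<Prod>W = b}. a n\<bar> \<le> E W"
    and E0: "\<And>W. W \<subseteq> P \<Longrightarrow> 0 \<le> E W"
  shows "\<bar>\<Sum>n\<in>I. a n * (f n)\<^sup>2\<bar> \<le> Ym\<^sup>2 * (\<Sum>W\<in>{W\<in>Pow P. pr W \<le> L\<^sup>2}. real CC ^ card W * E W)"
proof -
  have "\<bar>(\<Sum>n\<in>I. a n * (sieve_fun P Y (psi Hs hK) (phi Hs c) n)\<^sup>2)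
           - 0 * (\<Sum>(S,T)\<in>disj_pairs P. (Y S T)\<^sup>2 * (prod hK S * prod hc T))\<bar>
     \<le> Ym\<^sup>2 * (\<Sum>W\<in>{W\<in>Pow P. pr W \<le> L\<^sup>2}. real CC ^ card W * E W)"
  proof (rule square_sum[where \<gamma> = "\<lambda>p b. 1 / real p"])
    fix p assume p: "p \<in> P"
    interpret pf: prime_forms Hs c p by (rule prime_forms_P[OF p])
    have h: "hK p = real (card Hs) / (real p - real (card Hs))" by (simp add: hK_def card_Hs)
    note o = pf.orth_uniform[of hK, OF h]
    show "(\<Sum>b<p. 1 / real p * psi Hs hK p b) = 0" "(\<Sum>b<p. 1 / real p * phi Hs c p b) = 0"
      "(\<Sum>b<p. 1 / real p * (psi Hs hK p b * phi Hs c p b)) = 0"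
      by (rule o)+
    show "(\<Sum>b<p. 1 / real p * (psi Hs hK p b)\<^sup>2) = hK p" unfolding h by (rule o)
    show "(\<Sum>b<p. 1 / real p * (phi Hs c p b)\<^sup>2) = hc p" using o(5) by (simp add: hc_def card_Hs)
  next
    fix S T assume ST: "S \<subseteq> P" "T \<subseteq> P"
    have "\<bar>Y S T\<bar> \<le> ln (real N) ^ 4" using Y_nonneg[of S T] Y_le[OF ST] ln2_le by simp
    also have "\<dots> \<le> Ym * 1" by (simp add: Ym_def)
    also have "\<dots> \<le> Ym * 2 ^ card S" using Ym_pos by (intro mult_left_mono) auto
    finally show "\<bar>Y S T\<bar> \<le> Ym * 2 ^ card S" .
  qed (use Y_supp E E0 in auto)
  then show ?thesis by (simp add: f_def)
qed

lemma inv_totient_le: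
  assumes "M \<subseteq> P"
  shows "0 \<le> (\<Prod>p\<in>M. 1 / (real p - 1))" "(\<Prod>p\<in>M. 1 / (real p - 1)) \<le> 2 ^ card M / pr M"
proof -
  have half: "real p / 2 \<le> real p - 1" "1 < real p" if "p \<in> M" for p using real_P[of p] assms that by auto
  show "0 \<le> (\<Prod>p\<in>M. 1 / (real p - 1))" using half by (intro prod_nonneg) force
  have "(\<Prod>p\<in>M. 1 / (real p - 1)) \<le> (\<Prod>p\<in>M. 2 / real p)"
  proof (rule prod_mono)
    fix p assume "p \<in> M"
    note h = half[OF this]
    have "1 / (real p - 1) \<le> 1 / (real p / 2)" using h by (intro divide_left_mono) auto
    then show "0 \<le> 1 / (real p - 1) \<and> 1 / (real p - 1) \<le> 2 / real p" using h by simp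
  qed
  then show "(\<Prod>p\<in>M. 1 / (real p - 1)) \<le> 2 ^ card M / pr M" by (simp add: prod_dividef pr_def)
qed

text \<open>The sum over M loses only a power of the logarithm, and p/(p - 1) at most 2 gives
  \<open>2 ^ card S\<close>; this growth is why \<open>sieve_square_sum\<close> admits it. The
  support does not grow, because \<open>Ys\<close> averages \<open>Y\<close> over supersets of
  S.\<close>

lemma Ys_bound:
  assumes ST: "S \<subseteq> P" "T \<subseteq> P"
  shows "\<bar>Ys S T\<bar> \<le> Ym * 2 ^ card S" "Ys S T \<noteq> 0 \<Longrightarrow> pr S * pr T \<le> L"
proof -
  have half: "real p / 2 \<le> real p - 1" "1 < real p" if "p \<in> P" for p using real_P[OF that] by auto
  have sub: "S \<union> M \<subseteq> P" "M \<subseteq> P" if "M \<in> Pow (P - T - S)" for M using that ST by auto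
  note a0 = inv_totient_le
  have b: "0 \<le> (\<Prod>p\<in>S. real p / (real p - 1))" "(\<Prod>p\<in>S. real p / (real p - 1)) \<le> 2 ^ card S"
  proof -
    show "0 \<le> (\<Prod>p\<in>S. real p / (real p - 1))" using half ST by (intro prod_nonneg) force
    have "(\<Prod>p\<in>S. real p / (real p - 1)) \<le> (\<Prod>p\<in>S. 2)"
    proof (rule prod_mono)
      fix p assume "p \<in> S"
      then have "p \<in> P" using ST by auto
      note h = half[OF this]
      show "0 \<le> real p / (real p - 1) \<and> real p / (real p - 1) \<le> 2" using h by (simp add: field_simps)
    qed
    then show "(\<Prod>p\<in>S. real p / (real p - 1)) \<le> 2 ^ card S" by simp
  qed
  have pr0: "0 < pr M" if "M \<subseteq> P" for M using pr_ge_1_P[OF that] by simp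
  have Mle: "pr M \<le> R" "pr S \<le> R" "pr T \<le> D" if M: "M \<in> Pow (P - T - S)" and nz: "Y (S \<union> M) T \<noteq> 0" for M
  proof -
    have "lR (S \<union> M) \<noteq> 0" "lD T \<noteq> 0" using nz by (auto simp: Y_def)
    then have "pr (S \<union> M) \<le> R" "pr T \<le> D" using lR_zero[OF sub(1)[OF M]] lD_zero[OF ST(2)] by auto
    moreover have "pr M \<le> pr (S \<union> M)" "pr S \<le> pr (S \<union> M)"
      using sub[OF M] finite_sub_P P_ge_1 by (auto intro!: pr_mono)
    ultimately show "pr M \<le> R" "pr S \<le> R" "pr T \<le> D" by auto
  qed
  let ?s = "\<Sum>M\<in>Pow (P - T - S). (\<Prod>p\<in>M. 1 / (real p - 1)) * Y (S \<union> M) T"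
  have s0: "0 \<le> ?s" using a0 sub Y_nonneg by (intro sum_nonneg mult_nonneg_nonneg) auto
  have "?s = (\<Sum>M\<in>{M\<in>Pow (P - T - S). pr M \<le> R}. (\<Prod>p\<in>M. 1 / (real p - 1)) * Y (S \<union> M) T)"
    using Mle(1) by (intro sum.mono_neutral_right) auto
  also have "\<dots> \<le> (\<Sum>M\<in>{M\<in>Pow (P - T - S). pr M \<le> R}. real 2 ^ card M / pr M * ln (real N) ^ 2)"
  proof (rule sum_mono)
    fix M assume "M \<in> {M\<in>Pow (P - T - S). pr M \<le> R}"
    then have M: "M \<in> Pow (P - T - S)" by simp
    show "(\<Prod>p\<in>M. 1 / (real p - 1)) * Y (S \<union> M) T \<le> real 2 ^ card M / pr M * ln (real N) ^ 2"
      using a0[OF sub(2)[OF M]] Y_le[OF sub(1)[OF M] ST(2)] Y_nonneg pr0[OF sub(2)[OF M]]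
      by (intro mult_mono) auto
  qed
  also have "\<dots> \<le> (\<Sum>M\<in>{M\<in>Pow P. pr M \<le> R}. real 2 ^ card M / pr M * ln (real N) ^ 2)"
  proof (rule sum_mono2)
    fix M assume "M \<in> {M\<in>Pow P. pr M \<le> R} - {M\<in>Pow (P - T - S). pr M \<le> R}"
    then have "M \<subseteq> P" by auto
    from pr0[OF this] show "0 \<le> real 2 ^ card M / pr M * ln (real N) ^ 2" by simp
  qed auto
  also have "\<dots> = (\<Sum>M\<in>{M\<in>Pow P. pr M \<le> R}. real 2 ^ card M / pr M) * ln (real N) ^ 2"
    by (simp add: sum_distrib_right)
  also have "\<dots> \<le> (1 + ln R) ^ 2 * ln (real N) ^ 2"
    using P_prime R1 by (intro mult_right_mono sum_Pow_card_power_le) auto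
  also have "\<dots> \<le> (2 * ln (real N)) ^ 2 * ln (real N) ^ 2"
  proof -
    have "ln R \<le> ln (real N)" using R1 R_le by simp
    then have "1 + ln R \<le> 2 * ln (real N)" using lnN by linarith
    then show ?thesis using R1 by (intro mult_right_mono power_mono) auto
  qed
  also have "\<dots> = Ym" by (simp add: Ym_def power_mult_distrib flip: power_add)
  finally have s: "?s \<le> Ym" .
  have "\<bar>Ys S T\<bar> = (\<Prod>p\<in>S. real p / (real p - 1)) * ?s" using b(1) s0 by (simp add: Ys_def)
  also have "\<dots> \<le> 2 ^ card S * Ym" using b s s0 by (intro mult_mono) auto
  finally show "\<bar>Ys S T\<bar> \<le> Ym * 2 ^ card S" by (simp add: mult.commute)
  show "pr S * pr T \<le> L" if "Ys S T \<noteq> 0"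
  proof -
    have "?s \<noteq> 0" using that by (auto simp: Ys_def)
    then obtain M where M: "M \<in> Pow (P - T - S)" "(\<Prod>p\<in>M. 1 / (real p - 1)) * Y (S \<union> M) T \<noteq> 0"
      by (meson sum.not_neutral_contains_not_neutral)
    then have "Y (S \<union> M) T \<noteq> 0" by auto
    then show ?thesis using Mle[OF M(1)] ST by (intro mult_ge_le) auto
  qed
qed

text \<open>The same weight in the basis adapted to primes. Neither \<open>psi Hs hs\<close> nor
  \<open>Ys\<close> depends on which shift is prime, so one expansion and one form \<open>M1\<close>
  serve all h.\<close>

lemma f_star: "f n = sieve_fun P Ys (psi Hs hs) (phi Hs c) n"
proof -
  have "sieve_fun P Y (psi Hs hK) (phi Hs c) n = sieve_fun P (\<lambda>S T. (\<Prod>p\<in>S. real p / (real p - 1)) *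
     (\<Sum>M\<in>Pow (P - T - S). (\<Prod>p\<in>M. 1 / (real p - 1)) * Y (S \<union> M) T)) (psi Hs hs) (phi Hs c) n"
  proof (rule sieve_fun_affine)
    fix p assume p: "p \<in> P"
    interpret pf: prime_forms Hs c p by (rule prime_forms_P[OF p])
    show "psi Hs hK p n = real p / (real p - 1) * psi Hs hs p n + 1 / (real p - 1)"
      by (rule pf.psi_affine) (simp_all add: hK_def hs_def card_Hs)
  qed simp
  then show ?thesis by (simp add: f_def Ys_def[abs_def])
qed

lemma prime_sum_bound:
  assumes h: "h \<in> Hs"
    and E: "\<And>W b. W \<subseteq> P \<Longrightarrow> pr W \<le> L\<^sup>2 \<Longrightarrow> b < \<Prod>W \<Longrightarrow>
      \<bar>(\<Sum>n\<in>{n\<in>I. n mod \<Prod>W = b}. a n) - X * (\<Prod>p\<in>W. if p dvd b mod p + h then 0 else 1 / (real p - 1))\<bar> \<le> E W"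
    and E0: "\<And>W. W \<subseteq> P \<Longrightarrow> 0 \<le> E W"
  shows "\<bar>(\<Sum>n\<in>I. a n * (f n)\<^sup>2) - X * M1\<bar> \<le> Ym\<^sup>2 * (\<Sum>W\<in>{W\<in>Pow P. pr W \<le> L\<^sup>2}. real CC ^ card W * E W)"
  unfolding f_star M1_def
proof (rule square_sum[where \<gamma> = "\<lambda>p b. if p dvd b + h then 0 else 1 / (real p - 1)"])
  fix p assume p: "p \<in> P"
  interpret pf: prime_forms Hs c p by (rule prime_forms_P[OF p])
  have t: "hs p = (real (card Hs) - 1) / (real p - real (card Hs))" by (simp add: hs_def card_Hs)
  note o = pf.orth_coprime[of h hs, OF h t]
  show "(\<Sum>b<p. (if p dvd b + h then 0 else 1 / (real p - 1)) * psi Hs hs p b) = 0"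
    "(\<Sum>b<p. (if p dvd b + h then 0 else 1 / (real p - 1)) * phi Hs c p b) = 0"
    "(\<Sum>b<p. (if p dvd b + h then 0 else 1 / (real p - 1)) * (psi Hs hs p b * phi Hs c p b)) = 0"
    by (rule o)+
  show "(\<Sum>b<p. (if p dvd b + h then 0 else 1 / (real p - 1)) * (psi Hs hs p b)\<^sup>2) = hs p"
    unfolding t by (rule o)
  show "(\<Sum>b<p. (if p dvd b + h then 0 else 1 / (real p - 1)) * (phi Hs c p b)\<^sup>2) = hcs p"
    using o(5) by (simp add: hcs_def card_Hs)
qed (use Ys_bound E E0 in auto)

end

section \<open>Primes and the Liouville function in residue classes\<close>

text \<open>The inner maxima of the two conditions word for word, so that folding these definitions
  turns \<open>condA\<close> and \<open>condB\<close> into bounds for sums of \<open>EA\<close> and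
  \<open>EB\<close>.\<close>

definition EA :: "real \<Rightarrow> nat \<Rightarrow> real" where
  "EA x q = Max ((\<lambda>a. \<bar>theta_ap x q a - x / real (totient q)\<bar>) ` {a. a < q \<and> coprime a q})"

definition EB :: "real \<Rightarrow> nat \<Rightarrow> real" where
  "EB x q = Max ((\<lambda>(m, a). \<bar>\<Sum>n\<in>{n. 1 \<le> n \<and> n \<le> m \<and> [n = a] (mod q)}. liouville n\<bar>) ` ({0..nat \<lfloor>x\<rfloor>} \<times> {..<q}))"

lemma EA_ge: "a < q \<Longrightarrow> coprime a q \<Longrightarrow> \<bar>theta_ap x q a - x / real (totient q)\<bar> \<le> EA x q"
  unfolding EA_def by (intro Max_ge) auto

lemma totatives_nonempty: assumes "1 \<le> (q::nat)" shows "\<exists>a<q. coprime a q"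
proof (cases "q = 1")
  case False
  then have "1 < q" using assms by simp
  then show ?thesis by (intro exI[of _ 1]) auto
qed auto

lemma EA_nonneg: assumes "1 \<le> q" shows "0 \<le> EA x q"
proof -
  obtain a where "a < q" "coprime a q" using totatives_nonempty[OF assms] by auto
  from EA_ge[OF this, of x] show ?thesis by linarith
qed

lemma EB_ge:
  assumes "real m \<le> x" "a < q"
  shows "\<bar>\<Sum>n\<in>{n. 1 \<le> n \<and> n \<le> m \<and> [n = a] (mod q)}. liouville n\<bar> \<le> EB x q"
  unfolding EB_def
proof (rule Max_ge)
  have "(m, a) \<in> {0..nat \<lfloor>x\<rfloor>} \<times> {..<q}" using assms by (auto simp: le_nat_floor)
  then show "\<bar>\<Sum>n\<in>{n. 1 \<le> n \<and> n \<le> m \<and> [n = a] (mod q)}. liouville n\<bar>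
    \<in> (\<lambda>(m, a). \<bar>\<Sum>n\<in>{n. 1 \<le> n \<and> n \<le> m \<and> [n = a] (mod q)}. liouville n\<bar>) ` ({0..nat \<lfloor>x\<rfloor>} \<times> {..<q})"
    by (intro image_eqI[of _ _ "(m, a)"]) auto
qed auto

lemma EB_nonneg: assumes "1 \<le> q" "0 \<le> x" shows "0 \<le> EB x q"
  using EB_ge[of 0 x 0 q] assms by simp

lemma card_class_le:
  assumes "1 \<le> (q::nat)" "real q \<le> x" "1 \<le> x" "a < q"
  shows "real (card {n. real n \<le> x \<and> [n = a] (mod q)}) \<le> 3 * x / real q"
proof -
  define M where "M = nat \<lfloor>x\<rfloor> + 1"
  have "real n \<le> x \<longleftrightarrow> n < M" for n
  proof
    assume "real n \<le> x"
    then show "n < M" using le_nat_floor[of n x] by (simp add: M_def)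
  next
    assume "n < M"
    then have "real n \<le> real (nat \<lfloor>x\<rfloor>)" by (simp add: M_def)
    also have "\<dots> \<le> x" using assms by (intro of_nat_floor) simp
    finally show "real n \<le> x" .
  qed
  then have "{n. real n \<le> x \<and> [n = a] (mod q)} = {n. n < M \<and> n mod q = a}"
    using assms by (auto simp: cong_def)
  moreover have "real M \<le> x + 1" using assms by (simp add: M_def)
  ultimately have "real (card {n. real n \<le> x \<and> [n = a] (mod q)}) \<le> (x + 1) / real q + 1"
    using card_residue_class[OF assms(4), of M] divide_right_mono[of "real M" "x + 1" "real q"] by auto
  also have "\<dots> \<le> 2 * x / real q + x / real q"
    using assms by (intro add_mono divide_right_mono) auto
  finally show ?thesis by (simp add: add_divide_distrib[symmetric])
qed

lemma theta_ap_le: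
  assumes "1 \<le> (q::nat)" "real q \<le> x" "1 \<le> x" "a < q"
  shows "theta_ap x q a \<le> 3 * x * ln x / real q" "0 \<le> theta_ap x q a"
proof -
  let ?A = "{p. prime p \<and> real p \<le> x \<and> [p = a] (mod q)}"
  have fin: "finite {n::nat. real n \<le> x \<and> [n = a] (mod q)}"
    by (rule finite_subset[of _ "{..nat \<lfloor>x\<rfloor>}"]) (auto simp: le_nat_floor)
  have "theta_ap x q a \<le> (\<Sum>p\<in>?A. ln x)" unfolding theta_ap_def
  proof (rule sum_mono)
    fix p assume "p \<in> ?A"
    then show "ln (real p) \<le> ln x" using assms prime_gt_0_nat[of p] by simp
  qed
  also have "\<dots> = real (card ?A) * ln x" by simp
  also have "\<dots> \<le> real (card {n. real n \<le> x \<and> [n = a] (mod q)}) * ln x"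
    using assms fin by (intro mult_right_mono of_nat_mono card_mono) auto
  also have "\<dots> \<le> 3 * x / real q * ln x" using assms by (intro mult_right_mono card_class_le) auto
  finally show "theta_ap x q a \<le> 3 * x * ln x / real q" by simp
  show "0 \<le> theta_ap x q a" unfolding theta_ap_def
  proof (rule sum_nonneg)
    fix p assume "p \<in> ?A"
    then show "0 \<le> ln (real p)" using prime_ge_1_nat[of p] by simp
  qed
qed

text \<open>The trivial bound from counting integers in the class, as required for the weighted
  factor in \<open>weighted_error_sum_le\<close>.\<close>

lemma EA_le:
  assumes "1 \<le> (q::nat)" "real q \<le> x" "1 \<le> x"
  shows "EA x q \<le> 3 * x * ln x / real q + x / real (totient q)"
  unfolding EA_def
proof (rule Max.boundedI)
  show "(\<lambda>a. \<bar>theta_ap x q a - x / real (totient q)\<bar>) ` {a. a < q \<and> coprime a q} \<noteq> {}"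
    using totatives_nonempty[OF assms(1)] by auto
  fix y assume "y \<in> (\<lambda>a. \<bar>theta_ap x q a - x / real (totient q)\<bar>) ` {a. a < q \<and> coprime a q}"
  then obtain a where a: "a < q" "y = \<bar>theta_ap x q a - x / real (totient q)\<bar>" by auto
  have "0 \<le> x / real (totient q)" using assms by simp
  then show "y \<le> 3 * x * ln x / real q + x / real (totient q)"
    using theta_ap_le[OF assms a(1)] a(2) by linarith
qed simp

lemma liouville_abs: "\<bar>liouville n\<bar> = 1"
  by (simp add: liouville_def power_abs)

lemma EB_le:
  assumes "1 \<le> (q::nat)" "real q \<le> x" "1 \<le> x"
  shows "EB x q \<le> 3 * x / real q"
  unfolding EB_def
proof (rule Max.boundedI)
  have "(0, 0) \<in> {0..nat \<lfloor>x\<rfloor>} \<times> {..<q}" using assms by auto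
  then show "(\<lambda>(m, a). \<bar>\<Sum>n\<in>{n. 1 \<le> n \<and> n \<le> m \<and> [n = a] (mod q)}. liouville n\<bar>) ` ({0..nat \<lfloor>x\<rfloor>} \<times> {..<q}) \<noteq> {}"
    by blast
  fix y assume "y \<in> (\<lambda>(m, a). \<bar>\<Sum>n\<in>{n. 1 \<le> n \<and> n \<le> m \<and> [n = a] (mod q)}. liouville n\<bar>) ` ({0..nat \<lfloor>x\<rfloor>} \<times> {..<q})"
  then obtain m a where ma: "m \<le> nat \<lfloor>x\<rfloor>" "a < q" "y = \<bar>\<Sum>n\<in>{n. 1 \<le> n \<and> n \<le> m \<and> [n = a] (mod q)}. liouville n\<bar>" by auto
  have mx: "real m \<le> x" using ma(1) assms(3) by linarith
  have fin: "finite {n::nat. real n \<le> x \<and> [n = a] (mod q)}"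
    by (rule finite_subset[of _ "{..nat \<lfloor>x\<rfloor>}"]) (auto simp: le_nat_floor)
  have "y \<le> (\<Sum>n\<in>{n. 1 \<le> n \<and> n \<le> m \<and> [n = a] (mod q)}. 1)"
    unfolding ma(3) by (rule order.trans[OF sum_abs]) (simp add: liouville_abs)
  also have "\<dots> \<le> real (card {n. real n \<le> x \<and> [n = a] (mod q)})"
  proof -
    have "{n. 1 \<le> n \<and> n \<le> m \<and> [n = a] (mod q)} \<subseteq> {n. real n \<le> x \<and> [n = a] (mod q)}"
      using mx by auto
    then show ?thesis using card_mono[OF fin] by simp
  qed
  also have "\<dots> \<le> 3 * x / real q" by (rule card_class_le) (use assms ma in auto)
  finally show "y \<le> 3 * x / real q" .
qed auto

section \<open>Discrepancy of primes and of the Liouville function in the sieve classes\<close>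

context sieve_setup begin

lemma class_union:
  assumes W: "W \<subseteq> P" "b < \<Prod>W"
  obtains t where "t < Q * \<Prod>W" "{n\<in>I. n mod \<Prod>W = b} = {n\<in>{N<..2*N}. n mod (Q * \<Prod>W) = t}"
    "t mod Q = v" "t mod \<Prod>W = b"
proof -
  obtain t where t: "t < Q * \<Prod>W" "\<And>n. n mod (Q * \<Prod>W) = t \<longleftrightarrow> n mod Q = v \<and> n mod \<Prod>W = b"
    using residue_class_exists[OF coprime_prodW[OF W(1)] v_lt W(2)] by blast
  show ?thesis
  proof (rule that[OF t(1)])
    show "{n\<in>I. n mod \<Prod>W = b} = {n\<in>{N<..2*N}. n mod (Q * \<Prod>W) = t}" using t(2) by (auto simp: I_def)
    show "t mod Q = v" "t mod \<Prod>W = b" using t(2)[of t] t(1) by auto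
  qed
qed

lemma shifted_class:
  assumes "t < (q::nat)"
  shows "(n + h) mod q = (t + h) mod q \<longleftrightarrow> n mod q = t"
proof -
  have "[n + h = t + h] (mod q) \<longleftrightarrow> [n = t] (mod q)" by (rule cong_add_rcancel_nat)
  then show ?thesis using assms by (simp add: cong_def)
qed

text \<open>The class is either coprime to the modulus after the shift by h, and then the sum is a
  difference of two values of \<open>theta_ap\<close>, or some p in W divides every n + h, and both
  the sum and the density vanish.\<close>

lemma prime_discrepancy:
  assumes h: "h \<in> Hs" and W: "W \<subseteq> P" "b < \<Prod>W"
  shows "\<bar>(\<Sum>n\<in>{n\<in>I. n mod \<Prod>W = b}. if prime (n + h) then ln (real (n + h)) else 0)
      - real N / real (totient Q) * (\<Prod>p\<in>W. if p dvd b mod p + h then 0 else 1 / (real p - 1))\<bar>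
     \<le> EA (real (N + h)) (Q * \<Prod>W) + EA (real (2 * N + h)) (Q * \<Prod>W)"
proof -
  let ?q = "Q * \<Prod>W"
  obtain t where t: "t < ?q" "{n\<in>I. n mod \<Prod>W = b} = {n\<in>{N<..2*N}. n mod ?q = t}" "t mod Q = v" "t mod \<Prod>W = b"
    using class_union[OF W] by blast
  have q1: "1 \<le> ?q" using t(1) by linarith
  have fW: "finite W" using W finite_sub_P by auto
  define u where "u = (t + h) mod ?q"
  have u: "u < ?q" using q1 by (simp add: u_def)
  have tp: "t mod p = b mod p" if "p \<in> W" for p
    using mod_Prod_mod[OF fW that, of t] t(4) by simp
  have dvd_iff: "p dvd t + h \<longleftrightarrow> p dvd b mod p + h" if "p \<in> W" for p
    using dvd_mod_add_iff[of p t h] tp[OF that] by simp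
  have copQ: "coprime (t + h) Q"
  proof -
    have Q0: "Q \<noteq> 0" using v_lt by simp
    have "(t + h) mod Q = (v + h) mod Q" using mod_add_left_eq[of t Q h] t(3) by simp
    moreover have "coprime ((v + h) mod Q) Q" using v_cop[of h] h Q0 by simp
    ultimately have "coprime ((t + h) mod Q) Q" by simp
    then show ?thesis using Q0 by simp
  qed
  show ?thesis
  proof (cases "\<exists>p\<in>W. p dvd b mod p + h")
    case True
    then obtain p where p: "p \<in> W" "p dvd b mod p + h" by auto
    have pP: "p \<in> P" using p W by auto
    have np: "\<not> prime (n + h)" if "n \<in> {n\<in>I. n mod \<Prod>W = b}" for n
    proof
      assume pr: "prime (n + h)"
      have "n mod p = b mod p" using that mod_Prod_mod[OF fW p(1), of n] by simp
      then have "p dvd n + h" using p(2) dvd_mod_add_iff[of p n h] by simp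
      \<comment> \<open>A prime n + h divisible by p would be p itself, but p is at most R, hence at
        most N, while n > N.\<close>
      then have "p = n + h" using pr P_prime[OF pP] by (simp add: primes_dvd_imp_eq)
      moreover have "real p \<le> R" using pP by (simp add: P_eq)
      ultimately show False using that R_le by (simp add: I_def)
    qed
    have "(\<Sum>n\<in>{n\<in>I. n mod \<Prod>W = b}. if prime (n + h) then ln (real (n + h)) else 0) = 0"
      using np by (intro sum.neutral) auto
    moreover have "(\<Prod>p\<in>W. if p dvd b mod p + h then 0 else 1 / (real p - 1)) = 0"
      using fW p by (intro prod_zero) auto
    ultimately show ?thesis using EA_nonneg[OF q1] by simp
  next
    case False
    have "coprime (t + h) (\<Prod>W)"
    proof (rule prod_coprime_right)
      fix p assume p: "p \<in> W"
      then have "\<not> p dvd t + h" using False dvd_iff by auto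
      then show "coprime (t + h) p" using P_prime[of p] p W
        by (subst coprime_commute) (auto intro: prime_imp_coprime)
    qed
    then have "coprime (t + h) ?q" using copQ by simp
    moreover have "?q \<noteq> 0" using q1 by linarith
    ultimately have cop: "coprime u ?q" unfolding u_def by (simp only: coprime_mod_left_iff not_False_eq_True)
    let ?A = "\<lambda>x::nat. {p. prime p \<and> real p \<le> real x \<and> [p = u] (mod ?q)}"
    have fA: "finite (?A x)" for x by (rule finite_subset[of _ "{..x}"]) auto
    have "(\<Sum>n\<in>{n\<in>I. n mod \<Prod>W = b}. if prime (n + h) then ln (real (n + h)) else 0)
      = (\<Sum>n\<in>{n\<in>{n\<in>{N<..2*N}. n mod ?q = t}. prime (n + h)}. ln (real (n + h)))"
      unfolding t(2) by (intro sum.inter_filter[symmetric]) auto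
    also have "\<dots> = (\<Sum>p\<in>?A (2*N+h) - ?A (N+h). ln (real p))"
    proof (rule sum.reindex_bij_witness[of _ "\<lambda>p. p - h" "\<lambda>n. n + h"])
      fix n assume n: "n \<in> {n\<in>{n\<in>{N<..2*N}. n mod ?q = t}. prime (n + h)}"
      then have "[n + h = u] (mod ?q)" using shifted_class[OF t(1), of n h] by (simp add: cong_def u_def)
      then show "n + h \<in> ?A (2*N+h) - ?A (N+h)" using n by auto
    next
      fix p assume p: "p \<in> ?A (2*N+h) - ?A (N+h)"
      then have p': "N + h < p" "p \<le> 2*N + h" "prime p" "[p = u] (mod ?q)" by auto
      then have "[p - h + h = u] (mod ?q)" by simp
      then have "(p - h) mod ?q = t" using shifted_class[OF t(1), of "p - h" h] by (simp add: cong_def u_def)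
      then show "p - h \<in> {n\<in>{n\<in>{N<..2*N}. n mod ?q = t}. prime (n + h)}" using p' by auto
      show "p - h + h = p" using p' by simp
    qed auto
    also have "\<dots> = theta_ap (real (2*N+h)) ?q u - theta_ap (real (N+h)) ?q u"
      unfolding theta_ap_def by (rule sum_diff[OF fA]) auto
    finally have sum_eq: "(\<Sum>n\<in>{n\<in>I. n mod \<Prod>W = b}. if prime (n + h) then ln (real (n + h)) else 0)
      = theta_ap (real (2*N+h)) ?q u - theta_ap (real (N+h)) ?q u" .
    have "(\<Prod>p\<in>W. if p dvd b mod p + h then 0 else 1 / (real p - 1)) = (\<Prod>p\<in>W. 1 / (real p - 1))"
      using False by (intro prod.cong) auto
    also have "\<dots> = 1 / real (totient (\<Prod>W))"
    proof -
      have "real (totient (\<Prod>W)) = (\<Prod>p\<in>W. real p - 1)"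
        using W P_prime by (intro totient_prod_primes[OF fW]) auto
      then show ?thesis by (simp add: prod_dividef)
    qed
    finally have "real N / real (totient Q) * (\<Prod>p\<in>W. if p dvd b mod p + h then 0 else 1 / (real p - 1))
       = real N / real (totient ?q)"
      using coprime_prodW[OF W(1)] by (simp add: totient_mult_coprime)
    also have "\<dots> = real (2*N+h) / real (totient ?q) - real (N+h) / real (totient ?q)"
      by (simp add: diff_divide_distrib[symmetric])
    finally have m: "real N / real (totient Q) * (\<Prod>p\<in>W. if p dvd b mod p + h then 0 else 1 / (real p - 1))
       = real (2*N+h) / real (totient ?q) - real (N+h) / real (totient ?q)" .
    have tri: "\<bar>(y - x) - (b' - a')\<bar> \<le> e + e'" if "\<bar>x - a'\<bar> \<le> e" "\<bar>y - b'\<bar> \<le> e'" for x y a' b' e e' :: real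
      using that by linarith
    show ?thesis
      unfolding sum_eq m by (rule tri[OF EA_ge[OF u cop] EA_ge[OF u cop]])
  qed
qed

text \<open>The maximum over y in condition (B) covers both endpoints with one \<open>x\<close>.
  Condition (A) has no such maximum, so \<open>prime_discrepancy\<close> needs \<open>EA\<close> at
  each endpoint.\<close>

lemma liouville_discrepancy:
  assumes W: "W \<subseteq> P" "b < \<Prod>W" and x: "real (2 * N + c) \<le> x"
  shows "\<bar>\<Sum>n\<in>{n\<in>I. n mod \<Prod>W = b}. liouville (n + c)\<bar> \<le> 2 * EB x (Q * \<Prod>W)"
proof -
  let ?q = "Q * \<Prod>W"
  obtain t where t: "t < ?q" "{n\<in>I. n mod \<Prod>W = b} = {n\<in>{N<..2*N}. n mod ?q = t}"
    using class_union[OF W] by blast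
  define u where "u = (t + c) mod ?q"
  have u: "u < ?q" unfolding u_def using t(1) by (intro mod_less_divisor) linarith
  let ?A = "\<lambda>x::nat. {n. 1 \<le> n \<and> n \<le> x \<and> [n = u] (mod ?q)}"
  have fA: "finite (?A x)" for x by (rule finite_subset[of _ "{..x}"]) auto
  have "(\<Sum>n\<in>{n\<in>I. n mod \<Prod>W = b}. liouville (n + c)) = (\<Sum>n\<in>?A (2*N+c) - ?A (N+c). liouville n)"
    unfolding t(2)
  proof (rule sum.reindex_bij_witness[of _ "\<lambda>p. p - c" "\<lambda>n. n + c"])
    fix n assume n: "n \<in> {n\<in>{N<..2*N}. n mod ?q = t}"
    then have "[n + c = u] (mod ?q)" using shifted_class[OF t(1), of n c] by (simp add: cong_def u_def)
    then show "n + c \<in> ?A (2*N+c) - ?A (N+c)" using n by auto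
  next
    fix p assume p: "p \<in> ?A (2*N+c) - ?A (N+c)"
    then have p': "N + c < p" "p \<le> 2*N + c" "[p = u] (mod ?q)" by auto
    then have "[p - c + c = u] (mod ?q)" by simp
    then have "(p - c) mod ?q = t" using shifted_class[OF t(1), of "p - c" c] by (simp add: cong_def u_def)
    then show "p - c \<in> {n\<in>{N<..2*N}. n mod ?q = t}" using p' by auto
    show "p - c + c = p" using p' by simp
  qed auto
  also have "\<dots> = (\<Sum>n\<in>?A (2*N+c). liouville n) - (\<Sum>n\<in>?A (N+c). liouville n)"
    by (rule sum_diff[OF fA]) auto
  finally have "\<bar>\<Sum>n\<in>{n\<in>I. n mod \<Prod>W = b}. liouville (n + c)\<bar>
     \<le> \<bar>\<Sum>n\<in>?A (2*N+c). liouville n\<bar> + \<bar>\<Sum>n\<in>?A (N+c). liouville n\<bar>" by linarith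
  moreover have "\<bar>\<Sum>n\<in>?A (2*N+c). liouville n\<bar> \<le> EB x ?q" "\<bar>\<Sum>n\<in>?A (N+c). liouville n\<bar> \<le> EB x ?q"
    by (rule EB_ge; use x u in simp)+
  ultimately show ?thesis by linarith
qed

end

section \<open>Error budget and the contradictory inequality\<close>

context sieve_setup begin

lemma L_ge_1: "1 \<le> L"
  unfolding L_def using mult_mono[OF R1 D1] R1 by simp

lemma error_le_N:
  assumes L: "L\<^sup>2 \<le> real N"
    and E: "\<And>W. W \<subseteq> P \<Longrightarrow> 0 \<le> E W"
      "\<And>W. W \<subseteq> P \<Longrightarrow> pr W \<le> L\<^sup>2 \<Longrightarrow> E W \<le> 60 * real N * ln (real N) * 2 ^ card W / pr W"
    and S: "(\<Sum>W\<in>{W\<in>Pow P. pr W \<le> L\<^sup>2}. E W) \<le> Sc * real N / ln (real N) ^ (2 * CC\<^sup>2 + 18)"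
    and Sc: "0 \<le> Sc" "15360 * 2 ^ (2 * CC\<^sup>2) * Sc \<le> ln (real N)"
  shows "Ym\<^sup>2 * (\<Sum>W\<in>{W\<in>Pow P. pr W \<le> L\<^sup>2}. real CC ^ card W * E W) \<le> real N"
proof -
  define l where "l = ln (real N)"
  define m where "m = 2 * CC\<^sup>2"
  define s where "s = (\<Sum>W\<in>{W\<in>Pow P. pr W \<le> L\<^sup>2}. real CC ^ card W * E W)"
  have l1: "1 \<le> l" using lnN by (simp add: l_def)
  have L1: "1 \<le> L\<^sup>2" using L_ge_1 by simp
  have "s\<^sup>2 \<le> 60 * real N * l * (1 + ln (L\<^sup>2)) ^ m * (Sc * real N / l ^ (m + 18))"
    unfolding s_def m_def l_def
  proof (rule weighted_error_sum_le)
    show "E W \<le> 60 * real N * ln (real N) * 2 ^ card W / pr W" if "W \<subseteq> P" "pr W \<le> L\<^sup>2" for W using E(2)[OF that] .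
  qed (use P_prime L1 E S lnN in auto)
  also have "\<dots> \<le> 60 * real N * l * (2 * l) ^ m * (Sc * real N / l ^ (m + 18))"
  proof -
    have "ln (L\<^sup>2) \<le> l" unfolding l_def using L L1 N_pos by (subst ln_le_cancel_iff) auto
    then have "(1 + ln (L\<^sup>2)) ^ m \<le> (2 * l) ^ m" using l1 L1 by (intro power_mono) auto
    then show ?thesis using l1 Sc N_pos by (intro mult_right_mono mult_left_mono) auto
  qed
  finally have s2: "s\<^sup>2 \<le> 60 * real N * l * (2 * l) ^ m * (Sc * real N / l ^ (m + 18))" .
  have "(Ym\<^sup>2 * s)\<^sup>2 = (256 * l ^ 16) * s\<^sup>2"
    by (simp add: Ym_def l_def power_mult_distrib power_mult[symmetric])
  also have "\<dots> \<le> (256 * l ^ 16) * (60 * real N * l * (2 * l) ^ m * (Sc * real N / l ^ (m + 18)))"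
    using s2 l1 by (intro mult_left_mono) auto
  \<comment> \<open>15360 = 256 * 60. In the exponent m + 18, m is spent on the divisor weight, 16
    on the fourth power of \<open>Ym\<close> and 1 on the trivial bound; the last logarithm absorbs
    the constants.\<close>
  also have "\<dots> = 15360 * 2 ^ m * Sc * (real N)\<^sup>2 * (l ^ (m + 17) / l ^ (m + 18))"
  proof -
    have *: "l ^ (m + 17) = l ^ 16 * (l * l ^ m)" by (simp add: power_add eval_nat_numeral)
    show ?thesis unfolding * by (simp add: power_mult_distrib power2_eq_square)
  qed
  also have "l ^ (m + 17) / l ^ (m + 18) = 1 / l"
  proof -
    have "l ^ (m + 18) = l ^ (m + 17) * l" by (simp add: eval_nat_numeral)
    then show ?thesis using l1 by simp
  qed
  also have "15360 * 2 ^ m * Sc * (real N)\<^sup>2 * (1 / l) \<le> l * (real N)\<^sup>2 * (1 / l)"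
    using Sc l1 by (intro mult_right_mono) (auto simp: m_def l_def)
  also have "\<dots> = (real N)\<^sup>2" using l1 by simp
  finally have "(Ym\<^sup>2 * s)\<^sup>2 \<le> (real N)\<^sup>2" .
  then have "Ym\<^sup>2 * s \<le> real N" by (rule power2_le_imp_le) simp
  then show ?thesis by (simp add: s_def)
qed

text \<open>Summing \<open>pt\<close> against the weight bounds the K prime sums by about half the
  total mass times ln N, while \<open>main_ratio\<close> makes them larger. Here \<open>m\<close> is
  the total mass per integer up to the factor N; being at least 1000, it makes all errors of size N
  negligible.\<close>

lemma contradiction:
  assumes Rcond: "10000 * (B + 1) \<le> ln R" "10000 * (real Q + 1) / V \<le> ln R"
    and Dcond: "4 * B \<le> ln D" and z: "1 \<le> z" "B \<le> ln z" "1000 * ln z \<le> ln D" "0 < ln D"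
    and err: "z * (Ym\<^sup>2 * (\<Sum>W\<in>{W\<in>Pow P. pr W \<le> L\<^sup>2}. real CC ^ card W * 2)) \<le> real N"
    and lam: "\<bar>\<Sum>n\<in>I. liouville (n + c) * (f n)\<^sup>2\<bar> \<le> real N"
    and prm: "\<And>h. h \<in> Hs \<Longrightarrow> \<bar>(\<Sum>n\<in>I. (if prime (n + h) then ln (real (n + h)) else 0) * (f n)\<^sup>2)
        - real N / real (totient Q) * M1\<bar> \<le> real N"
    and pt: "\<And>n. n \<in> I \<Longrightarrow> (\<Sum>h\<in>Hs. if prime (n + h) then ln (real (n + h)) else 0)
        \<le> ln (3 * real N) * ((1 + liouville (n + c)) / 2 + real (card {p\<in>{p\<in>P. real p \<le> z}. p dvd n + c}))"
    and num: "ln R = \<rho> * ln (real N)" "0.538 * (real K + 3) \<le> 2.98 * real K * \<rho>"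
      "ln (3 * real N) \<le> 1.02 * ln (real N)" "1000 * real Q \<le> (ln R * ln D)\<^sup>2"
  shows False
proof -
  define l where "l = ln (real N)"
  define m where "m = M0 / real Q"
  define e0 where "e0 = Ym\<^sup>2 * (\<Sum>W\<in>{W\<in>Pow P. pr W \<le> L\<^sup>2}. real CC ^ card W * 2)"
  let ?Pz = "{p\<in>P. real p \<le> z}"
  have l1: "1 \<le> l" using lnN by (simp add: l_def)
  have l3: "0 \<le> ln (3 * real N)"
  proof -
    have "real N \<le> 3 * real N" by simp
    then have "ln (real N) \<le> ln (3 * real N)" using N_pos by (subst ln_le_cancel_iff) auto
    then show ?thesis using lnN by linarith
  qed
  have Q0: "0 < real Q" using Q_gt_1 by simp
  have m1000: "1000 \<le> m" unfolding m_def using M0_ge num(4) Q0 by (simp add: field_simps)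
  have e00: "0 \<le> e0" unfolding e0_def by (intro mult_nonneg_nonneg sum_nonneg) auto
  have e0N: "e0 \<le> real N"
  proof -
    have "1 * e0 \<le> z * e0" using z(1) e00 by (intro mult_right_mono)
    then show ?thesis using err by (simp add: e0_def)
  qed
  have T0: "(\<Sum>n\<in>I. (f n)\<^sup>2) \<le> real N * m + real N"
  proof -
    have "\<bar>(\<Sum>n\<in>I. (f n)\<^sup>2) - real N / real Q * M0\<bar> \<le> e0" unfolding e0_def by (rule total_sum_bound)
    then have "(\<Sum>n\<in>I. (f n)\<^sup>2) \<le> real N / real Q * M0 + real N" using e0N by linarith
    then show ?thesis by (simp add: m_def)
  qed
  have fPz: "finite ?Pz" by simp
  have cPz: "real (card ?Pz) \<le> z"
  proof -
    have "?Pz \<subseteq> {1..nat \<lfloor>z\<rfloor>}" using P_ge_1 by (auto simp: le_nat_floor)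
    then have "card ?Pz \<le> nat \<lfloor>z\<rfloor>" using card_mono[of "{1..nat \<lfloor>z\<rfloor>}" ?Pz] by simp
    then show ?thesis using z(1) by linarith
  qed
  have Tb: "(\<Sum>p\<in>?Pz. \<Sum>n\<in>{n\<in>I. p dvd n + c}. (f n)\<^sup>2) \<le> real N * (0.01 * m) + real N"
  proof -
    have "(\<Sum>p\<in>?Pz. \<Sum>n\<in>{n\<in>I. p dvd n + c}. (f n)\<^sup>2) \<le> (\<Sum>p\<in>?Pz. real N / real Q * (1 / real p * Mb p) + e0)"
    proof (rule sum_mono)
      fix p assume "p \<in> ?Pz"
      then have "\<bar>(\<Sum>n\<in>{n\<in>I. p dvd n + c}. (f n)\<^sup>2) - real N / real Q * (1 / real p * Mb p)\<bar> \<le> e0"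
        unfolding e0_def by (intro small_factor_sum_bound) simp
      then show "(\<Sum>n\<in>{n\<in>I. p dvd n + c}. (f n)\<^sup>2) \<le> real N / real Q * (1 / real p * Mb p) + e0"
        by linarith
    qed
    also have "\<dots> = real N / real Q * (\<Sum>p\<in>?Pz. 1 / real p * Mb p) + real (card ?Pz) * e0"
      by (simp only: sum.distrib sum_distrib_left sum_constant)
    also have "real N / real Q * (\<Sum>p\<in>?Pz. 1 / real p * Mb p) \<le> real N / real Q * (0.01 * M0)"
      using Dcond z by (intro mult_left_mono bad_le) auto
    also have "real (card ?Pz) * e0 \<le> z * e0" using cPz e00 by (intro mult_right_mono)
    also have "z * e0 \<le> real N" using err by (simp add: e0_def)
    finally show ?thesis by (simp add: m_def)
  qed
  have "real K * (real N / real (totient Q) * M1 - real N) = (\<Sum>h\<in>Hs. real N / real (totient Q) * M1 - real N)"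
    by (simp add: card_Hs)
  also have "\<dots> \<le> (\<Sum>h\<in>Hs. \<Sum>n\<in>I. (if prime (n + h) then ln (real (n + h)) else 0) * (f n)\<^sup>2)"
  proof (rule sum_mono)
    fix h assume "h \<in> Hs"
    from prm[OF this] show "real N / real (totient Q) * M1 - real N
      \<le> (\<Sum>n\<in>I. (if prime (n + h) then ln (real (n + h)) else 0) * (f n)\<^sup>2)" by linarith
  qed
  also have "\<dots> = (\<Sum>n\<in>I. (\<Sum>h\<in>Hs. if prime (n + h) then ln (real (n + h)) else 0) * (f n)\<^sup>2)"
    by (subst sum.swap) (simp only: sum_distrib_right)
  also have "\<dots> \<le> (\<Sum>n\<in>I. (ln (3 * real N) * ((1 + liouville (n + c)) / 2 + real (card {p\<in>?Pz. p dvd n + c}))) * (f n)\<^sup>2)"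
    by (intro sum_mono mult_right_mono pt) auto
  also have "\<dots> = ln (3 * real N) * ((\<Sum>n\<in>I. (f n)\<^sup>2) / 2 + (\<Sum>n\<in>I. liouville (n + c) * (f n)\<^sup>2) / 2
      + (\<Sum>n\<in>I. real (card {p\<in>?Pz. p dvd n + c}) * (f n)\<^sup>2))"
    by (simp add: sum_distrib_left sum.distrib sum_divide_distrib algebra_simps add_divide_distrib)
  also have "(\<Sum>n\<in>I. real (card {p\<in>?Pz. p dvd n + c}) * (f n)\<^sup>2) = (\<Sum>n\<in>I. \<Sum>p\<in>?Pz. if p dvd n + c then (f n)\<^sup>2 else 0)"
  proof (rule sum.cong[OF refl])
    fix n
    have "(\<Sum>p\<in>?Pz. if p dvd n + c then (f n)\<^sup>2 else 0) = (\<Sum>p\<in>{p\<in>?Pz. p dvd n + c}. (f n)\<^sup>2)"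
      by (rule sum.inter_filter[OF fPz, symmetric])
    then show "real (card {p\<in>?Pz. p dvd n + c}) * (f n)\<^sup>2 = (\<Sum>p\<in>?Pz. if p dvd n + c then (f n)\<^sup>2 else 0)"
      by (simp only: sum_constant)
  qed
  also have "\<dots> = (\<Sum>p\<in>?Pz. \<Sum>n\<in>I. if p dvd n + c then (f n)\<^sup>2 else 0)" by (rule sum.swap)
  also have "\<dots> = (\<Sum>p\<in>?Pz. \<Sum>n\<in>{n\<in>I. p dvd n + c}. (f n)\<^sup>2)"
    by (intro sum.cong refl sum.inter_filter[symmetric]) simp
  also have "ln (3 * real N) * ((\<Sum>n\<in>I. (f n)\<^sup>2) / 2 + (\<Sum>n\<in>I. liouville (n + c) * (f n)\<^sup>2) / 2
      + (\<Sum>p\<in>?Pz. \<Sum>n\<in>{n\<in>I. p dvd n + c}. (f n)\<^sup>2))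
     \<le> ln (3 * real N) * ((real N * m + real N) / 2 + real N / 2 + (real N * (0.01 * m) + real N))"
  proof (rule mult_left_mono[OF _ l3])
    have "(\<Sum>n\<in>I. liouville (n + c) * (f n)\<^sup>2) \<le> real N" using lam by linarith
    then show "(\<Sum>n\<in>I. (f n)\<^sup>2) / 2 + (\<Sum>n\<in>I. liouville (n + c) * (f n)\<^sup>2) / 2
      + (\<Sum>p\<in>?Pz. \<Sum>n\<in>{n\<in>I. p dvd n + c}. (f n)\<^sup>2) \<le> (real N * m + real N) / 2 + real N / 2 + (real N * (0.01 * m) + real N)"
      using T0 Tb by (intro add_mono divide_right_mono) simp_all
  qed
  \<comment> \<open>0.51 is 1/2 from the parity term plus 0.01 from small factors of the
    centre.\<close>
  also have "(real N * m + real N) / 2 + real N / 2 + (real N * (0.01 * m) + real N) = real N * (0.51 * m + 2)"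
    by (simp add: field_simps)
  also have "ln (3 * real N) * (real N * (0.51 * m + 2)) = real N * (ln (3 * real N) * (0.51 * m + 2))"
    by (rule mult.left_commute)
  also have "\<dots> \<le> real N * (1.02 * l * (0.51 * m + 2))"
    using num(3) m1000 by (intro mult_left_mono mult_right_mono) (auto simp: l_def)
  finally have "real N * (real K * (M1 / real (totient Q) - 1)) \<le> real N * (1.02 * l * (0.51 * m + 2))"
    by (simp add: algebra_simps)
  then have main: "real K * (M1 / real (totient Q) - 1) \<le> 1.02 * l * (0.51 * m + 2)"
    by (simp only: mult_le_cancel_left_pos[OF N_pos])
  have phi0: "0 < real (totient Q)" using Q_gt_1 by simp
  have lm0: "0 \<le> l * m" using l1 m1000 by simp
  have "0.538 * (real K + 3) * (l * m) \<le> 2.98 * real K * \<rho> * (l * m)"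
    using num(2) lm0 by (intro mult_right_mono)
  also have "\<dots> = real K / real (totient Q) * (2.98 * V * ln R * M0)"
    using phi0 Q0 by (simp add: m_def V_def num(1) l_def)
  also have "\<dots> \<le> real K / real (totient Q) * ((real K + 3) * M1)"
    using main_ratio[OF Rcond] by (intro mult_left_mono) auto
  also have "\<dots> = (real K + 3) * (real K * (M1 / real (totient Q)))" by simp
  finally have "(real K + 3) * (0.538 * (l * m)) \<le> (real K + 3) * (real K * (M1 / real (totient Q)))"
    by (simp only: mult_ac)
  moreover have "0 < real K + 3" by simp
  ultimately have "0.538 * (l * m) \<le> real K * (M1 / real (totient Q))"
    by (simp only: mult_le_cancel_left_pos)
  \<comment> \<open>0.5202 = 1.02 * 0.51, where 1.02 bounds ln(3N)/ln N. The whole argument needs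
    0.538 to exceed this.\<close>
  then have "0.538 * (l * m) - real K \<le> 0.5202 * (l * m) + 2.04 * l"
    using main by (simp add: algebra_simps)
  then have "5380 * (l * m) - 10000 * real K \<le> 5202 * (l * m) + 20400 * l" by simp
  \<comment> \<open>K at most 7 and l at least 1 turn 10000 K into at most 70000 l. The result
    forces m below 508, against m at least 1000.\<close>
  then have "178 * (l * m) \<le> 90400 * l" using real_K l1 by linarith
  then have "l * (178 * m) \<le> l * 90400" by (simp add: mult_ac)
  then have "178 * m \<le> 90400" using l1 by simp
  then show False using m1000 by simp
qed

lemma power_le_ln_powr:
  assumes "real N \<le> x" "x \<le> 3 * real N"
  shows "kk * x / ln x powr real j \<le> 3 * \<bar>kk\<bar> * real N / ln (real N) ^ j"
proof -
  have lx: "ln (real N) \<le> ln x" using assms N_pos by simp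
  have "kk * x / ln x powr real j = kk * x / ln x ^ j"
    using lx lnN by (subst powr_realpow) auto
  also have "\<dots> \<le> (\<bar>kk\<bar> * (3 * real N)) / ln (real N) ^ j"
  proof (rule frac_le)
    have "kk * x \<le> \<bar>kk\<bar> * x" using assms N_pos by (intro mult_right_mono) auto
    also have "\<dots> \<le> \<bar>kk\<bar> * (3 * real N)" using assms by (intro mult_left_mono) auto
    finally show "kk * x \<le> \<bar>kk\<bar> * (3 * real N)" .
    show "ln (real N) ^ j \<le> ln x ^ j" using lx lnN by (intro power_mono) auto
  qed (use lnN in auto)
  finally show ?thesis by (simp add: mult_ac)
qed

lemma modulus: assumes "W \<subseteq> P" "pr W \<le> L\<^sup>2" "real Q * L\<^sup>2 \<le> real N"
  shows "1 \<le> Q * \<Prod>W" "real (Q * \<Prod>W) \<le> real N" "pr W \<le> real (Q * \<Prod>W)"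
proof -
  show "1 \<le> Q * \<Prod>W" using Q_gt_1 prodW_pos[OF assms(1)] by (simp add: Suc_le_eq)
  have eq: "real (Q * \<Prod>W) = real Q * pr W" by (simp add: pr_def)
  have "real Q * pr W \<le> real Q * L\<^sup>2" using assms(2) by (intro mult_left_mono) auto
  then show "real (Q * \<Prod>W) \<le> real N" using assms(3) unfolding eq by linarith
  have "1 * pr W \<le> real Q * pr W" using Q_gt_1 pr_ge_1_P[OF assms(1)] by (intro mult_right_mono) auto
  then show "pr W \<le> real (Q * \<Prod>W)" unfolding eq by simp
qed

lemma L2_le: "real Q * L\<^sup>2 \<le> real N \<Longrightarrow> L\<^sup>2 \<le> real N"
proof -
  assume *: "real Q * L\<^sup>2 \<le> real N"
  have "1 * L\<^sup>2 \<le> real Q * L\<^sup>2" using Q_gt_1 by (intro mult_right_mono) auto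
  then show ?thesis using * by simp
qed

text \<open>All values n + c lie below 3N since c is at most N, so condition (B) is used once, at
  3N.\<close>

lemma liouville_sum_le:
  assumes QL: "real Q * L\<^sup>2 \<le> real N" "real Q * L\<^sup>2 \<le> (3 * real N) powr t"
    and cN: "c \<le> N"
    and S: "(\<Sum>q\<in>{q::nat. 1 \<le> q \<and> real q \<le> (3 * real N) powr t}. EB (3 * real N) q)
        \<le> kb * (3 * real N) / ln (3 * real N) powr real (2 * CC\<^sup>2 + 18)"
    and l: "15360 * 2 ^ (2 * CC\<^sup>2) * (6 * \<bar>kb\<bar>) \<le> ln (real N)"
  shows "\<bar>\<Sum>n\<in>I. liouville (n + c) * (f n)\<^sup>2\<bar> \<le> real N"
proof -
  define E where "E W = 2 * EB (3 * real N) (Q * \<Prod>W)" for W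
  have x1: "1 \<le> 3 * real N" using N_pos by simp
  have E0: "0 \<le> E W" if "W \<subseteq> P" for W
    unfolding E_def using Q_gt_1 prodW_pos[OF that] by (intro mult_nonneg_nonneg EB_nonneg) (auto simp: Suc_le_eq)
  have "\<bar>\<Sum>n\<in>I. liouville (n + c) * (f n)\<^sup>2\<bar> \<le> Ym\<^sup>2 * (\<Sum>W\<in>{W\<in>Pow P. pr W \<le> L\<^sup>2}. real CC ^ card W * E W)"
  proof (rule twisted_sum_bound)
    fix W b assume "W \<subseteq> P" "pr W \<le> L\<^sup>2" "b < \<Prod>W"
    then show "\<bar>\<Sum>n\<in>{n\<in>I. n mod \<Prod>W = b}. liouville (n + c)\<bar> \<le> E W"
      unfolding E_def using cN by (intro liouville_discrepancy) auto
  qed (rule E0)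
  also have "\<dots> \<le> real N"
  proof (rule error_le_N[where Sc = "6 * \<bar>kb\<bar>"])
    show "L\<^sup>2 \<le> real N" by (rule L2_le[OF QL(1)])
    fix W assume W: "W \<subseteq> P" "pr W \<le> L\<^sup>2"
    note q = modulus[OF W QL(1)]
    have p0: "0 < pr W" using pr_ge_1_P[OF W(1)] by simp
    have "E W \<le> 2 * (3 * (3 * real N) / real (Q * \<Prod>W))"
      unfolding E_def using q x1 N_pos by (intro mult_left_mono EB_le) auto
    also have "\<dots> = 18 * real N / real (Q * \<Prod>W)" by simp
    also have "\<dots> \<le> 18 * real N / pr W" using q p0 N_pos by (intro divide_left_mono mult_pos_pos) auto
    also have "\<dots> \<le> 60 * real N * ln (real N) * 2 ^ card W / pr W"
    proof (rule divide_right_mono)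
      have "18 * real N * 1 * 1 \<le> 60 * real N * ln (real N) * 2 ^ card W"
        using lnN N_pos by (intro mult_mono) auto
      then show "18 * real N \<le> 60 * real N * ln (real N) * 2 ^ card W" by simp
    qed (use p0 in simp)
    finally show "E W \<le> 60 * real N * ln (real N) * 2 ^ card W / pr W" .
  next
    have "(\<Sum>W\<in>{W\<in>Pow P. pr W \<le> L\<^sup>2}. EB (3 * real N) (Q * \<Prod>W)) \<le> (\<Sum>q\<in>{q::nat. 1 \<le> q \<and> real q \<le> (3 * real N) powr t}. EB (3 * real N) q)"
      using P_prime Q_gt_1 QL(2) x1 by (intro sum_moduli_le EB_nonneg) auto
    also have "\<dots> \<le> 3 * \<bar>kb\<bar> * real N / ln (real N) ^ (2 * CC\<^sup>2 + 18)"
      using power_le_ln_powr[of "3 * real N" kb "2 * CC\<^sup>2 + 18"] S by simp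
    finally show "(\<Sum>W\<in>{W\<in>Pow P. pr W \<le> L\<^sup>2}. E W) \<le> 6 * \<bar>kb\<bar> * real N / ln (real N) ^ (2 * CC\<^sup>2 + 18)"
      by (simp add: E_def sum_distrib_left[symmetric])
  qed (use E0 l in auto)
  finally show ?thesis .
qed

lemma prime_sum_le:
  assumes h: "h \<in> Hs" and QL: "real Q * L\<^sup>2 \<le> real N" "real Q * L\<^sup>2 \<le> real N powr t" "0 \<le> t"
    and hN: "h \<le> N" and l3: "ln (3 * real N) \<le> 1.02 * ln (real N)"
    and S: "\<And>x. real N \<le> x \<Longrightarrow> (\<Sum>q\<in>{q::nat. 1 \<le> q \<and> real q \<le> x powr t}. EA x q)
        \<le> ka * x / ln x powr real (2 * CC\<^sup>2 + 18)"
    and l: "15360 * 2 ^ (2 * CC\<^sup>2) * (6 * \<bar>ka\<bar>) \<le> ln (real N)"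
  shows "\<bar>(\<Sum>n\<in>I. (if prime (n + h) then ln (real (n + h)) else 0) * (f n)\<^sup>2) - real N / real (totient Q) * M1\<bar> \<le> real N"
proof -
  define E where "E W = EA (real (N + h)) (Q * \<Prod>W) + EA (real (2 * N + h)) (Q * \<Prod>W)" for W
  have E0: "0 \<le> E W" if "W \<subseteq> P" for W
    unfolding E_def using Q_gt_1 prodW_pos[OF that] by (intro add_nonneg_nonneg EA_nonneg) (auto simp: Suc_le_eq)
  have "\<bar>(\<Sum>n\<in>I. (if prime (n + h) then ln (real (n + h)) else 0) * (f n)\<^sup>2) - real N / real (totient Q) * M1\<bar>
    \<le> Ym\<^sup>2 * (\<Sum>W\<in>{W\<in>Pow P. pr W \<le> L\<^sup>2}. real CC ^ card W * E W)"
    unfolding E_def by (rule prime_sum_bound[OF h prime_discrepancy[OF h]]) (use E0 in \<open>auto simp: E_def\<close>)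
  also have "\<dots> \<le> real N"
  proof (rule error_le_N[where Sc = "6 * \<bar>ka\<bar>"])
    show "L\<^sup>2 \<le> real N" by (rule L2_le[OF QL(1)])
    fix W assume W: "W \<subseteq> P" "pr W \<le> L\<^sup>2"
    note q = modulus[OF W QL(1)]
    have p0: "0 < pr W" using pr_ge_1_P[OF W(1)] by simp
    have N1: "1 \<le> real N" using N_pos by simp
    have bd: "EA x (Q * \<Prod>W) \<le> 30 * real N * ln (real N) * 2 ^ card W / pr W" if x: "real N \<le> x" "x \<le> 3 * real N" for x
    proof -
      have "EA x (Q * \<Prod>W) \<le> 3 * x * ln x / real (Q * \<Prod>W) + x / real (totient (Q * \<Prod>W))"
        using q x N1 by (intro EA_le) auto
      also have "3 * x * ln x / real (Q * \<Prod>W) \<le> (3 * (3 * real N) * (1.02 * ln (real N))) / pr W"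
      proof (rule frac_le)
        have "ln x \<le> ln (3 * real N)" using x N1 by simp
        then have "ln x \<le> 1.02 * ln (real N)" using l3 by linarith
        then show "3 * x * ln x \<le> 3 * (3 * real N) * (1.02 * ln (real N))"
          using x N1 by (intro mult_mono) auto
      qed (use q p0 lnN N1 in auto)
      also have "\<dots> \<le> (10 * real N * ln (real N) * 2 ^ card W) / pr W"
      proof (rule divide_right_mono)
        have "9.18 * (real N * ln (real N)) * 1 \<le> 10 * (real N * ln (real N)) * 2 ^ card W"
          using lnN N1 by (intro mult_mono) auto
        then show "3 * (3 * real N) * (1.02 * ln (real N)) \<le> 10 * real N * ln (real N) * 2 ^ card W" by simp
      qed (use p0 in simp)
      also have "x / real (totient (Q * \<Prod>W)) \<le> (3 * real N * ln (real N) * 2 ^ card W) / pr W"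
      proof -
        have fW: "finite W" using finite_sub_P[OF W(1)] .
        have tW: "real (totient (\<Prod>W)) = (\<Prod>p\<in>W. real p - 1)"
          using W P_prime by (intro totient_prod_primes[OF fW]) auto
        have "1 \<le> totient Q" using Q_gt_1 by (simp add: Suc_le_eq)
        then have tq: "real (totient (\<Prod>W)) \<le> real (totient (Q * \<Prod>W))"
          using coprime_prodW[OF W(1)] mult_right_mono[of 1 "real (totient Q)" "real (totient (\<Prod>W))"]
          by (simp add: totient_mult_coprime)
        have "0 < totient (\<Prod>W)" using prodW_pos[OF W(1)] by simp
        then have "x / real (totient (Q * \<Prod>W)) \<le> (3 * real N) / real (totient (\<Prod>W))"
          using tq x N1 by (intro frac_le) auto
        also have "\<dots> = (3 * real N) * (\<Prod>p\<in>W. 1 / (real p - 1))" by (simp add: tW prod_dividef)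
        also have "\<dots> \<le> (3 * real N) * (2 ^ card W / pr W)" using inv_totient_le(2)[OF W(1)] by (intro mult_left_mono) auto
        also have "\<dots> = (3 * real N * 1 * 2 ^ card W) / pr W" by simp
        also have "\<dots> \<le> (3 * real N * ln (real N) * 2 ^ card W) / pr W"
          using lnN N1 p0 by (intro divide_right_mono mult_right_mono mult_left_mono) auto
        finally show ?thesis .
      qed
      finally have "EA x (Q * \<Prod>W) \<le> 13 * (real N * ln (real N) * 2 ^ card W / pr W)" by (simp add: add_divide_distrib[symmetric])
      moreover have "0 \<le> real N * ln (real N) * 2 ^ card W / pr W" using lnN p0 by auto
      then have "13 * (real N * ln (real N) * 2 ^ card W / pr W) \<le> 30 * (real N * ln (real N) * 2 ^ card W / pr W)"
        by (intro mult_right_mono) auto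
      ultimately have "EA x (Q * \<Prod>W) \<le> 30 * (real N * ln (real N) * 2 ^ card W / pr W)" by (rule order.trans)
      then show ?thesis by (simp add: mult.assoc)
    qed
    have "E W \<le> 30 * real N * ln (real N) * 2 ^ card W / pr W + 30 * real N * ln (real N) * 2 ^ card W / pr W"
      unfolding E_def using hN by (intro add_mono bd) auto
    then show "E W \<le> 60 * real N * ln (real N) * 2 ^ card W / pr W" by simp
  next
    have one: "(\<Sum>W\<in>{W\<in>Pow P. pr W \<le> L\<^sup>2}. EA x (Q * \<Prod>W)) \<le> 3 * \<bar>ka\<bar> * real N / ln (real N) ^ (2 * CC\<^sup>2 + 18)"
      if x: "real N \<le> x" "x \<le> 3 * real N" for x
    proof -
      have "real N powr t \<le> x powr t" using x QL(3) by (intro powr_mono2) auto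
      then have "real Q * L\<^sup>2 \<le> x powr t" using QL(2) by linarith
      then have "(\<Sum>W\<in>{W\<in>Pow P. pr W \<le> L\<^sup>2}. EA x (Q * \<Prod>W)) \<le> (\<Sum>q\<in>{q::nat. 1 \<le> q \<and> real q \<le> x powr t}. EA x q)"
        using P_prime Q_gt_1 by (intro sum_moduli_le EA_nonneg) auto
      also have "\<dots> \<le> ka * x / ln x powr real (2 * CC\<^sup>2 + 18)" by (rule S[OF x(1)])
      also have "\<dots> \<le> 3 * \<bar>ka\<bar> * real N / ln (real N) ^ (2 * CC\<^sup>2 + 18)" by (rule power_le_ln_powr[OF x])
      finally show ?thesis .
    qed
    have "(\<Sum>W\<in>{W\<in>Pow P. pr W \<le> L\<^sup>2}. E W) \<le> 3 * \<bar>ka\<bar> * real N / ln (real N) ^ (2 * CC\<^sup>2 + 18) + 3 * \<bar>ka\<bar> * real N / ln (real N) ^ (2 * CC\<^sup>2 + 18)"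
      unfolding E_def sum.distrib using hN by (intro add_mono one) auto
    then show "(\<Sum>W\<in>{W\<in>Pow P. pr W \<le> L\<^sup>2}. E W) \<le> 6 * \<bar>ka\<bar> * real N / ln (real N) ^ (2 * CC\<^sup>2 + 18)"
      by simp
  qed (use E0 l in auto)
  finally show ?thesis .
qed

end

section \<open>Choice of the parameters\<close>

text \<open>The single modulus q = 1 in condition (A) is already an estimate for the Chebyshev
  function, so no separate proof of Chebyshev's bound is needed.\<close>

lemma chebyshev_of_condA:
  assumes "condA \<theta>" "0 < \<theta>"
  obtains B where "0 \<le> B" "\<And>n::nat. 1 \<le> n \<Longrightarrow> (\<Sum>p\<in>{p. prime p \<and> p \<le> n}. ln (real p)) \<le> B * real n"
proof -
  have "\<theta> / 2 > 0" "(1::real) > 0" using assms(2) by auto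
  then obtain k where k: "\<And>x. 2 \<le> x \<Longrightarrow>
     (\<Sum>q\<in>{q::nat. 1 \<le> q \<and> real q \<le> x powr (\<theta> - \<theta> / 2)}. EA x q) \<le> k * x / ln x powr 1"
    using assms(1) unfolding condA_def EA_def[symmetric] by blast
  define B where "B = 1 + \<bar>k\<bar> / ln 2"
  have B0: "0 \<le> B" by (simp add: B_def)
  have "(\<Sum>p\<in>{p. prime p \<and> p \<le> n}. ln (real p)) \<le> B * real n" if n: "1 \<le> n" for n :: nat
  proof (cases "n = 1")
    case True
    have "\<not> (prime p \<and> p \<le> 1)" for p :: nat using prime_gt_1_nat[of p] by auto
    then have "{p. prime p \<and> p \<le> n} = {}" unfolding True by blast
    then have "(\<Sum>p\<in>{p. prime p \<and> p \<le> n}. ln (real p)) = 0" by (simp only: sum.empty)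
    also have "0 \<le> B * real n" using B0 by simp
    finally show ?thesis .
  next
    case False
    define x where "x = real n"
    have x2: "2 \<le> x" using n False by (simp add: x_def)
    let ?A = "{q::nat. 1 \<le> q \<and> real q \<le> x powr (\<theta> - \<theta> / 2)}"
    have fin: "finite ?A" by (rule finite_subset[of _ "{..nat \<lfloor>x powr (\<theta> - \<theta> / 2)\<rfloor>}"]) (auto simp: le_nat_floor)
    have "1 \<le> x powr (\<theta> - \<theta> / 2)" using x2 assms(2) by (intro ge_one_powr_ge_zero) auto
    then have "(\<Sum>q\<in>{1}. EA x q) \<le> (\<Sum>q\<in>?A. EA x q)"
      using fin EA_nonneg by (intro sum_mono2) auto
    also have "\<dots> \<le> k * x / ln x powr 1" by (rule k[OF x2])
    also have "\<dots> = k * x / ln x" using x2 by simp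
    also have "\<dots> \<le> \<bar>k\<bar> * x / ln 2" using x2 by (intro frac_le mult_right_mono) auto
    finally have ea: "EA x 1 \<le> \<bar>k\<bar> * x / ln 2" by simp
    have "\<bar>theta_ap x 1 0 - x\<bar> \<le> EA x 1" using EA_ge[of 0 1 x] by simp
    moreover have "theta_ap x 1 0 = (\<Sum>p\<in>{p. prime p \<and> p \<le> n}. ln (real p))"
      by (simp add: theta_ap_def x_def)
    ultimately have "(\<Sum>p\<in>{p. prime p \<and> p \<le> n}. ln (real p)) \<le> x + \<bar>k\<bar> * x / ln 2" using ea by linarith
    also have "\<dots> = B * real n" by (simp add: B_def x_def algebra_simps)
    finally show ?thesis .
  qed
  then show ?thesis using that B0 by blast
qed

lemma eventually_ln_ge: "eventually (\<lambda>N::nat. C \<le> ln (real N)) sequentially"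
proof -
  have "filterlim (\<lambda>N::nat. ln (real N)) at_top sequentially"
    by (rule filterlim_compose[OF ln_at_top filterlim_real_sequentially])
  then show ?thesis by (simp add: filterlim_at_top)
qed

lemma eventually_polylog_le:
  assumes "0 < \<delta>"
  shows "eventually (\<lambda>N::nat. C * ln (real N) ^ k \<le> real N powr \<delta>) sequentially"
proof -
  \<comment> \<open>The power of the logarithm then costs at most half of the exponent \<delta>; the
    other half absorbs the constant.\<close>
  define a where "a = \<delta> / (2 * (real k + 1))"
  have a: "0 < a" using assms by (simp add: a_def)
  have ak: "a * real k \<le> \<delta> / 2" using assms by (simp add: a_def field_simps)
  have "eventually (\<lambda>N::nat. 2 * \<bar>C\<bar> / (a ^ k * \<delta>) \<le> ln (real N) \<and> 1 \<le> ln (real N)) sequentially"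
    by (intro eventually_conj eventually_ln_ge)
  then show ?thesis
  proof eventually_elim
    case (elim N)
    have N1: "1 \<le> real N"
    proof (cases "N = 0")
      case True then show ?thesis using elim by simp
    qed simp
    have "ln (real N) ^ k \<le> (real N powr a / a) ^ k"
      using elim ln_powr_bound[OF N1 a] by (intro power_mono) auto
    also have "\<dots> = real N powr (a * real k) / a ^ k"
      using N1 by (simp add: power_divide powr_powr[symmetric] powr_realpow)
    also have "\<dots> \<le> real N powr (\<delta> / 2) / a ^ k"
      using ak N1 a by (intro divide_right_mono powr_mono) auto
    finally have 1: "ln (real N) ^ k \<le> real N powr (\<delta> / 2) / a ^ k" .
    have "C * ln (real N) ^ k \<le> \<bar>C\<bar> * ln (real N) ^ k" using elim by (intro mult_right_mono) auto
    also have "\<dots> \<le> \<bar>C\<bar> * (real N powr (\<delta> / 2) / a ^ k)" using 1 by (intro mult_left_mono) auto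
    also have "\<dots> = (\<bar>C\<bar> / a ^ k) * real N powr (\<delta> / 2)" by simp
    also have "\<dots> \<le> real N powr (\<delta> / 2) * real N powr (\<delta> / 2)"
    proof (rule mult_right_mono)
      have "\<bar>C\<bar> / a ^ k = (2 * \<bar>C\<bar> / (a ^ k * \<delta>)) * (\<delta> / 2)" using assms by simp
      also have "\<dots> \<le> ln (real N) * (\<delta> / 2)" using elim assms by (intro mult_right_mono) auto
      also have "\<dots> \<le> 1 + \<delta> / 2 * ln (real N)" by simp
      also have "\<dots> \<le> exp (\<delta> / 2 * ln (real N))" by (rule exp_ge_add_one_self)
      also have "\<dots> = real N powr (\<delta> / 2)" using N1 by (simp add: powr_def)
      finally show "\<bar>C\<bar> / a ^ k \<le> real N powr (\<delta> / 2)" .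
    qed simp
    also have "\<dots> = real N powr \<delta>" by (simp add: powr_add[symmetric])
    finally show ?case .
  qed
qed

text \<open>Fewer than 11 shifts cannot fill all classes of a prime p >= 11. The primes below 11 are
  those dividing 210, and \<open>r0\<close> avoids them. The local choices are glued by the Chinese
  remainder theorem.\<close>

lemma admissible_residue:
  fixes H :: "nat set"
  assumes fin: "finite H" "card H < 11" and r0: "\<And>h. h \<in> H \<Longrightarrow> coprime (r0 + h) 210"
    and Q: "Q = \<Prod>{p. prime p \<and> p \<le> d}"
  obtains v where "v < Q" "\<And>h. h \<in> H \<Longrightarrow> coprime (v + h) Q"
proof -
  let ?A = "{p::nat. prime p \<and> p \<le> d}"
  have "\<exists>r. \<forall>h\<in>H. \<not> p dvd r + h" if p: "prime p" for p :: nat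
  proof (cases "p < 11")
    case True
    have "p = 0 \<or> p = 1 \<or> p = 2 \<or> p = 3 \<or> p = 4 \<or> p = 5 \<or> p = 6 \<or> p = 7 \<or> p = 8 \<or> p = 9 \<or> p = 10"
      using True by arith
    then have "p = 2 \<or> p = 3 \<or> p = 5 \<or> p = 7" using p by (elim disjE) simp_all
    then have "p dvd 210" by auto
    then have "\<not> p dvd r0 + h" if "h \<in> H" for h
      using r0[OF that] p by (meson coprime_common_divisor not_prime_unit)
    then show ?thesis by blast
  next
    case False
    have p0: "0 < p" using False by simp
    have "card ((\<lambda>h. (p - h mod p) mod p) ` H) < card {..<p}"
      using card_image_le[OF fin(1), of "\<lambda>h. (p - h mod p) mod p"] fin(2) False by simp
    moreover have "finite ((\<lambda>h. (p - h mod p) mod p) ` H)" using fin by simp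
    ultimately have "\<not> {..<p} \<subseteq> (\<lambda>h. (p - h mod p) mod p) ` H"
      using card_mono by (metis not_le)
    then obtain r where r: "r < p" "r \<notin> (\<lambda>h. (p - h mod p) mod p) ` H" by auto
    have "\<not> p dvd r + h" if h: "h \<in> H" for h
    proof
      assume "p dvd r + h"
      then have "p dvd r + h mod p" by (simp add: dvd_eq_mod_eq_0 mod_simps)
      then obtain k where k: "r + h mod p = p * k" by (elim dvdE)
      have hp: "h mod p < p" using p0 by simp
      have "r + h mod p < p * 2" using r(1) hp by linarith
      then have "k < 2" using k by (metis mult_less_cancel1)
      then consider "k = 0" | "k = 1" by linarith
      then have "r = (p - h mod p) mod p"
      proof cases
        case 1 then show ?thesis using k by simp
      next
        case 2 then have "r = p - h mod p" using k by simp
        then show ?thesis using r(1) by simp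
      qed
      then show False using r(2) h by blast
    qed
    then show ?thesis by blast
  qed
  then obtain r where r: "\<And>p h. prime p \<Longrightarrow> h \<in> H \<Longrightarrow> \<not> p dvd r p + h" by metis
  have "\<exists>x. \<forall>p\<in>?A. [x = r p] (mod p)"
    by (rule chinese_remainder_nat[where m = "\<lambda>p. p"]) (auto intro: primes_coprime)
  then obtain x where x: "\<And>p. p \<in> ?A \<Longrightarrow> [x = r p] (mod p)" by auto
  have Q0: "0 < Q" unfolding Q by (intro prod_pos) (auto simp: prime_gt_0_nat)
  show ?thesis
  proof (rule that[of "x mod Q"])
    show "x mod Q < Q" using Q0 by simp
    fix h assume h: "h \<in> H"
    have "coprime (x + h) Q" unfolding Q
    proof (rule prod_coprime_right)
      fix p assume p: "p \<in> ?A"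
      have "[x + h = r p + h] (mod p)" using x[OF p] by (rule cong_add) simp
      then have "\<not> p dvd x + h" using r[of p h] p h cong_dvd_iff by auto
      then show "coprime (x + h) p" using p by (subst coprime_commute) (auto intro: prime_imp_coprime)
    qed
    then have "coprime ((x + h) mod Q) Q" using Q0 by simp
    moreover have "(x mod Q + h) mod Q = (x + h) mod Q" by (rule mod_add_left_eq)
    ultimately have "coprime ((x mod Q + h) mod Q) Q" by simp
    then show "coprime (x mod Q + h) Q" using Q0 by simp
  qed
qed

text \<open>Consecutive primes are eventually more than D apart, hence so are any two large
  primes.\<close>

lemma prime_gap_of_Liminf:
  assumes "\<not> Liminf sequentially (\<lambda>n. ereal (real (nth_prime (Suc n)) - real (nth_prime n))) \<le> ereal (real D)"
  obtains n0 where "\<And>p p'. prime p \<Longrightarrow> prime p' \<Longrightarrow> n0 \<le> p \<Longrightarrow> p < p' \<Longrightarrow> D < p' - p"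
proof -
  let ?S = "{p::nat. prime p}"
  have inf: "infinite ?S" by (rule primes_infinite)
  have "eventually (\<lambda>n. ereal (real D) < ereal (real (nth_prime (Suc n)) - real (nth_prime n))) sequentially"
    using assms by (intro less_LiminfD) simp
  then obtain m0 where m0: "\<And>m. m0 \<le> m \<Longrightarrow> real D < real (nth_prime (Suc m)) - real (nth_prime m)"
    by (auto simp: eventually_sequentially)
  have sm: "strict_mono (enumerate ?S)" by (rule strict_mono_enumerate[OF inf])
  show ?thesis
  proof (rule that[of "nth_prime m0"])
    fix p p' :: nat assume p: "prime p" "prime p'" "nth_prime m0 \<le> p" "p < p'"
    obtain m where m: "enumerate ?S m = p" using enumerate_Ex[OF inf, of p] p(1) by auto
    obtain k where k: "enumerate ?S k = p'" using enumerate_Ex[OF inf, of p'] p(2) by auto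
    have "enumerate ?S m0 \<le> enumerate ?S m" using p(3) unfolding m nth_prime_def .
    then have "m0 \<le> m" by (simp only: strict_mono_less_eq[OF sm])
    have "enumerate ?S m < enumerate ?S k" using p(4) unfolding m k .
    then have "m < k" by (simp only: strict_mono_less[OF sm])
    then have "enumerate ?S (Suc m) \<le> enumerate ?S k" by (simp only: strict_mono_less_eq[OF sm] Suc_le_eq)
    then have "enumerate ?S (Suc m) \<le> p'" unfolding k .
    then have "real (nth_prime (Suc m)) \<le> real p'" by (simp add: nth_prime_def)
    moreover have "real (nth_prime m) = real p" using m by (simp add: nth_prime_def)
    ultimately have "real D < real p' - real p" using m0[OF \<open>m0 \<le> m\<close>] by linarith
    then have "D + p < p'" by linarith
    then show "D < p' - p" by linarith
  qed
qed

lemma power_size_le_prod_mset: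
  assumes "\<And>q. q \<in># M \<Longrightarrow> z \<le> real q" "0 \<le> z"
  shows "z ^ size M \<le> real (\<Prod>\<^sub># M)"
  using assms
proof (induction M)
  case (add q M)
  have "z * z ^ size M \<le> real q * real (\<Prod>\<^sub># M)" using add by (intro mult_mono) auto
  then show ?case by simp
qed simp

text \<open>The only place where the failure of both alternatives enters: \<open>gap\<close> negates (ii) and \<open>bad\<close>
  negates (i).\<close>
lemma (in sieve_setup) pointwise:
  assumes gap: "\<And>p p'. prime p \<Longrightarrow> prime p' \<Longrightarrow> N \<le> p \<Longrightarrow> p < p' \<Longrightarrow> D5 < p' - p"
    and width: "\<And>h h'. h \<in> Hs \<Longrightarrow> h' \<in> Hs \<Longrightarrow> h' \<le> h + D5"
    and bad: "\<And>h n. h \<in> Hs \<Longrightarrow> N < n \<Longrightarrow> n \<le> 2 * N \<Longrightarrow> prime (n + h) \<Longrightarrow> z < real (least_pf (n + c)) \<Longrightarrow> even (bigOmega (n + c))"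
    and hN: "\<And>h. h \<in> insert c Hs \<Longrightarrow> h \<le> N" and zR: "z \<le> R"
    and n: "n \<in> I"
  shows "(\<Sum>h\<in>Hs. if prime (n + h) then ln (real (n + h)) else 0)
     \<le> ln (3 * real N) * ((1 + liouville (n + c)) / 2 + real (card {p\<in>{p\<in>P. real p \<le> z}. p dvd n + c}))"
proof -
  have nN: "N < n" "n \<le> 2 * N" "n mod Q = v" using n by (auto simp: I_def)
  have l3: "0 \<le> ln (3 * real N)" using N_pos by simp
  have lam: "-1 \<le> liouville (n + c)" using liouville_abs[of "n + c"] by linarith
  show ?thesis
  proof (cases "\<exists>h\<in>Hs. prime (n + h)")
    case False
    then have "(\<Sum>h\<in>Hs. if prime (n + h) then ln (real (n + h)) else 0) = 0" by (intro sum.neutral) auto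
    moreover have "0 \<le> ln (3 * real N) * ((1 + liouville (n + c)) / 2 + real (card {p\<in>{p\<in>P. real p \<le> z}. p dvd n + c}))"
      using l3 lam by (intro mult_nonneg_nonneg add_nonneg_nonneg) auto
    ultimately show ?thesis by simp
  next
    case True
    then obtain h where h: "h \<in> Hs" "prime (n + h)" by auto
    have uniq: "h' = h" if h': "h' \<in> Hs" "prime (n + h')" for h'
    proof (rule ccontr)
      assume "h' \<noteq> h"
      then consider "h < h'" | "h' < h" by linarith
      then show False
      proof cases
        case 1
        then show False using gap[OF h(2) h'(2)] width[OF h(1) h'(1)] nN(1) by simp
      next
        case 2
        then show False using gap[OF h'(2) h(2)] width[OF h'(1) h(1)] nN(1) by simp
      qed
    qed
    have "(\<Sum>h\<in>Hs. if prime (n + h) then ln (real (n + h)) else 0) = (\<Sum>h'\<in>Hs. if h' = h then ln (real (n + h)) else 0)"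
    proof (rule sum.cong[OF refl])
      fix h' assume h': "h' \<in> Hs"
      show "(if prime (n + h') then ln (real (n + h')) else 0) = (if h' = h then ln (real (n + h)) else 0)"
      proof (cases "prime (n + h')")
        case True
        then have "h' = h" by (rule uniq[OF h'])
        then show ?thesis using h(2) by simp
      next
        case False
        then have "h' \<noteq> h" using h(2) by auto
        then show ?thesis using False by simp
      qed
    qed
    also have "\<dots> = ln (real (n + h))" using fin_Hs h by simp
    also have "\<dots> \<le> ln (3 * real N) * 1"
    proof -
      have "n + h \<le> 3 * N" using nN hN[of h] h by simp
      then have "real (n + h) \<le> 3 * real N" by linarith
      moreover have "0 < real (n + h)" using nN by simp
      ultimately show ?thesis by (simp only: mult_1_right) (subst ln_le_cancel_iff, auto)
    qed
    also have "\<dots> \<le> ln (3 * real N) * ((1 + liouville (n + c)) / 2 + real (card {p\<in>{p\<in>P. real p \<le> z}. p dvd n + c}))"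
    proof (rule mult_left_mono[OF _ l3])
      show "1 \<le> (1 + liouville (n + c)) / 2 + real (card {p\<in>{p\<in>P. real p \<le> z}. p dvd n + c})"
      proof (cases "{p\<in>{p\<in>P. real p \<le> z}. p dvd n + c} = {}")
        case False
        then have "1 \<le> card {p\<in>{p\<in>P. real p \<le> z}. p dvd n + c}"
          by (simp add: Suc_le_eq card_gt_0_iff)
        then have "1 \<le> real (card {p\<in>{p\<in>P. real p \<le> z}. p dvd n + c})" by linarith
        moreover have "0 \<le> (1 + liouville (n + c)) / 2" using lam by simp
        ultimately show ?thesis by (intro add_increasing)
      next
        \<comment> \<open>Coprimality to Q excludes prime factors up to d, and the empty set those
          between d and z, because z is at most R. So n + c is rough, and \<open>bad\<close> makes
          its Omega even.\<close>
        case True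
        have Q0: "Q \<noteq> 0" using v_lt by simp
        have "(n + c) mod Q = (v + c) mod Q" using mod_add_left_eq[of n Q c] nN(3) by simp
        moreover have "coprime ((v + c) mod Q) Q" using v_cop[of c] Q0 by simp
        ultimately have "coprime ((n + c) mod Q) Q" by simp
        then have cop: "coprime (n + c) Q" using Q0 by simp
        have big: "z < real q" if q: "q \<in> prime_factors (n + c)" for q
        proof (rule ccontr)
          assume qz: "\<not> z < real q"
          have pq: "prime q" "q dvd n + c" using q by auto
          have "d < q"
          proof (rule ccontr)
            assume "\<not> d < q"
            then have "q dvd Q" unfolding Q_eq using pq(1) by (intro dvd_prodI[where f = "\<lambda>x. x"]) auto
            then show False using pq cop by (meson coprime_common_divisor not_prime_unit)
          qed
          then have "q \<in> P" unfolding P_eq using pq(1) qz zR by simp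
          then show False using True qz pq(2) by auto
        qed
        have "prime_factors (n + c) \<noteq> {}"
        proof -
          have "n + c \<noteq> 0" "n + c \<noteq> 1" using nN lnN by (cases "N = 0"; auto)+
          then show ?thesis by (simp add: prime_factorization_empty_iff)
        qed
        then have "z < real (least_pf (n + c))"
          unfolding least_pf_def using big Min_in[of "prime_factors (n + c)"] by auto
        then have "even (bigOmega (n + c))" by (rule bad[OF h(1) nN(1,2) h(2)])
        then have "liouville (n + c) = 1" by (simp add: liouville_def)
        then show ?thesis by simp
      qed
    qed
    finally show ?thesis .
  qed
qed

text \<open>Everything except the six concrete tuples: from the negation of both alternatives the
  exponents are fixed, one sufficiently large N is chosen, and \<open>contradiction\<close> is
  applied at that N.\<close>

lemma sieve_core:
  fixes \<theta>0 \<theta> :: real and D6 D5 :: nat and Hs :: "nat set" and c r0 :: nat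
  assumes K: "2 \<le> card Hs" "card Hs \<le> 7" and c: "c \<notin> Hs" and small: "\<And>h. h \<in> insert c Hs \<Longrightarrow> h \<le> 26"
    and adm: "\<And>h. h \<in> insert c Hs \<Longrightarrow> coprime (r0 + h) 210"
    and dist: "\<And>h. h \<in> Hs \<Longrightarrow> even (int c - int h) \<and> \<bar>int c - int h\<bar> \<le> int D6"
    and width: "\<And>h h'. h \<in> Hs \<Longrightarrow> h' \<in> Hs \<Longrightarrow> h' \<le> h + D5"
    and num: "0.538 * (real (card Hs) + 3) \<le> 2.98 * real (card Hs) * (\<theta>0 / 2)" "1 / 2 \<le> \<theta>0" "\<theta>0 < 1"
    and gt: "\<theta> > \<theta>0" and A: "condA \<theta>" and B: "condB \<theta>"
  shows "(\<exists>C::real. \<exists>c::real. c > 0 \<and> (\<exists>b::nat. \<exists>d::int. odd b \<and> real b \<le> C \<and> even d \<and>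
            0 < \<bar>d\<bar> \<and> \<bar>d\<bar> \<le> int D6 \<and>
            infinite {p::nat. prime p \<and> int p + d > 1 \<and>
                        real (least_pf (nat (int p + d))) > real p powr c \<and>
                        bigOmega (nat (int p + d)) = b}))
         \<or> Liminf sequentially (\<lambda>n. ereal (real (nth_prime (Suc n)) - real (nth_prime n)))
             \<le> ereal (real D5)"
proof (rule ccontr)
  define bset where "bset e b d' = {p::nat. prime p \<and> int p + d' > 1 \<and>
     real (least_pf (nat (int p + d'))) > real p powr e \<and> bigOmega (nat (int p + d')) = b}" for e :: real and b :: nat and d' :: int
  assume "\<not> ?thesis"
  then have neg1: "\<not> (\<exists>C::real. \<exists>e::real. e > 0 \<and> (\<exists>b::nat. \<exists>d'::int. odd b \<and> real b \<le> C \<and> even d' \<and>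
            0 < \<bar>d'\<bar> \<and> \<bar>d'\<bar> \<le> int D6 \<and> infinite (bset e b d')))"
    and neg2: "\<not> Liminf sequentially (\<lambda>n. ereal (real (nth_prime (Suc n)) - real (nth_prime n))) \<le> ereal (real D5)"
    unfolding bset_def by blast+
  obtain n1 where n1: "\<And>p p'. prime p \<Longrightarrow> prime p' \<Longrightarrow> n1 \<le> p \<Longrightarrow> p < p' \<Longrightarrow> D5 < p' - p"
    using prime_gap_of_Liminf[OF neg2] by blast
  \<comment> \<open>The moduli reach Q R^2 D^2, at most N to the power \<theta>0 + 3\<delta>. This
    must stay below \<theta> - \<delta> for the conditions (A) and (B), and below 1 with room for z
    and logarithms, where integers are merely counted; hence the minimum with 1.\<close>
  define \<delta> where "\<delta> = (min \<theta> 1 - \<theta>0) / 8"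
  have \<delta>: "0 < \<delta>" "\<theta>0 + 8 * \<delta> \<le> \<theta>" "\<theta>0 + 8 * \<delta> \<le> 1"
  proof -
    have "8 * \<delta> = min \<theta> 1 - \<theta>0" by (simp add: \<delta>_def)
    then show "0 < \<delta>" "\<theta>0 + 8 * \<delta> \<le> \<theta>" "\<theta>0 + 8 * \<delta> \<le> 1" using gt num(3) by linarith+
  qed
  \<comment> \<open>Exactly the factor 1000 between ln z and ln D that \<open>bad_le\<close> asks
    for.\<close>
  define \<zeta> where "\<zeta> = \<delta> / 1000"
  have \<zeta>: "0 < \<zeta>" using \<delta> by (simp add: \<zeta>_def)
  have fin_Hs: "finite Hs" using K card.infinite[of Hs] by fastforce
  \<comment> \<open>All primes that could witness alternative (i) with the constants 2/\<zeta> and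
    \<zeta>/2. There are finitely many pairs of b and h, so the negation of (i) makes this set
    finite.\<close>
  define Bad where "Bad = (\<Union>b\<in>{b. odd b \<and> real b \<le> 2 / \<zeta>}. \<Union>h\<in>Hs. bset (\<zeta> / 2) b (int c - int h))"
  have "finite Bad" unfolding Bad_def
  proof (intro finite_UN_I)
    show "finite {b::nat. odd b \<and> real b \<le> 2 / \<zeta>}"
      by (rule finite_subset[of _ "{..nat \<lfloor>2 / \<zeta>\<rfloor>}"]) (auto simp: le_nat_floor)
    fix b h assume b: "b \<in> {b::nat. odd b \<and> real b \<le> 2 / \<zeta>}" and h: "h \<in> Hs"
    have "c \<noteq> h" using c h by auto
    then have "0 < \<bar>int c - int h\<bar>" by simp
    then have *: "odd b \<and> real b \<le> 2 / \<zeta> \<and> even (int c - int h) \<and> 0 < \<bar>int c - int h\<bar> \<and> \<bar>int c - int h\<bar> \<le> int D6"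
      using b dist[OF h] by simp
    have "0 < \<zeta> / 2" using \<zeta> by simp
    show "finite (bset (\<zeta> / 2) b (int c - int h))"
    proof (rule ccontr)
      assume "infinite (bset (\<zeta> / 2) b (int c - int h))"
      then show False using * \<open>0 < \<zeta> / 2\<close> neg1 by blast
    qed
  qed (rule fin_Hs)
  then obtain n2 where n2: "\<And>p. p \<in> Bad \<Longrightarrow> p < n2" using finite_nat_set_iff_bounded[of Bad] by blast
  have \<theta>: "0 < \<theta>" using gt num(2) by linarith
  obtain BB where BB: "0 \<le> BB" "\<And>n::nat. 1 \<le> n \<Longrightarrow> (\<Sum>p\<in>{p. prime p \<and> p \<le> n}. ln (real p)) \<le> BB * real n"
    using chebyshev_of_condA[OF A \<theta>] by blast
  define d :: nat where "d = 100000"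
  define Q where "Q = \<Prod>{p::nat. prime p \<and> p \<le> d}"
  have fin_ins: "finite (insert c Hs)" "card (insert c Hs) < 11" using fin_Hs K c by simp_all
  obtain v where v: "v < Q" "\<And>h. h \<in> insert c Hs \<Longrightarrow> coprime (v + h) Q"
    using admissible_residue[OF fin_ins adm Q_def] by blast
  define CC where "CC = 128 * card Hs"
  define j where "j = 2 * CC\<^sup>2 + 18"
  have "0 < j" by (simp add: j_def)
  then have j0: "0 < real j" by (simp only: of_nat_0_less_iff)
  obtain ka where ka: "\<And>x. 2 \<le> x \<Longrightarrow> (\<Sum>q\<in>{q::nat. 1 \<le> q \<and> real q \<le> x powr (\<theta> - \<delta>)}. EA x q) \<le> ka * x / ln x powr real j"
    using A \<delta>(1) j0 unfolding condA_def EA_def[symmetric] by blast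
  obtain kb where kb: "\<And>x. 2 \<le> x \<Longrightarrow> (\<Sum>q\<in>{q::nat. 1 \<le> q \<and> real q \<le> x powr (\<theta> - \<delta>)}. EB x q) \<le> kb * x / ln x powr real j"
    using B \<delta>(1) j0 unfolding condB_def EB_def[symmetric] by blast
  define V where "V = real (totient Q) / real Q"
  have ev_lin: "eventually (\<lambda>N::nat. y \<le> w * ln (real N)) sequentially" if "0 < w" for y w :: real
    using eventually_ln_ge[of "y / w"] by eventually_elim (use that in \<open>simp add: field_simps\<close>)
  \<comment> \<open>All demands on N at once. The factor \<open>ln (real N) ^ 0\<close> only brings
    the bound on Q into the form of \<open>eventually_polylog_le\<close>.\<close>
  have "eventually (\<lambda>N::nat. N \<ge> n1 + n2 + 30 \<and> 100 \<le> ln (real N) \<and>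
      10000 * (BB + 1) \<le> \<theta>0 / 2 * ln (real N) \<and> 10000 * (real Q + 1) / V \<le> \<theta>0 / 2 * ln (real N) \<and>
      4 * BB \<le> \<delta> * ln (real N) \<and> BB \<le> \<zeta> * ln (real N) \<and>
      15360 * 2 ^ (2 * CC\<^sup>2) * (6 * \<bar>ka\<bar>) \<le> ln (real N) \<and> 15360 * 2 ^ (2 * CC\<^sup>2) * (6 * \<bar>kb\<bar>) \<le> ln (real N) \<and>
      1000 * real Q \<le> (\<theta>0 / 2 * \<delta>)\<^sup>2 * ln (real N) \<and>
      real Q * ln (real N) ^ 0 \<le> real N powr \<delta> \<and> 32 * 2 ^ CC * ln (real N) ^ (8 + CC) \<le> real N powr \<delta>) sequentially"
    using num(2) \<delta>(1) \<zeta>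
    by (intro eventually_conj eventually_ge_at_top eventually_ln_ge ev_lin eventually_polylog_le) auto
  then obtain N where N: "N \<ge> n1 + n2 + 30" "100 \<le> ln (real N)"
      "10000 * (BB + 1) \<le> \<theta>0 / 2 * ln (real N)" "10000 * (real Q + 1) / V \<le> \<theta>0 / 2 * ln (real N)"
      "4 * BB \<le> \<delta> * ln (real N)" "BB \<le> \<zeta> * ln (real N)"
      "15360 * 2 ^ (2 * CC\<^sup>2) * (6 * \<bar>ka\<bar>) \<le> ln (real N)" "15360 * 2 ^ (2 * CC\<^sup>2) * (6 * \<bar>kb\<bar>) \<le> ln (real N)"
      "1000 * real Q \<le> (\<theta>0 / 2 * \<delta>)\<^sup>2 * ln (real N)"
      "real Q \<le> real N powr \<delta>" "32 * 2 ^ CC * ln (real N) ^ (8 + CC) \<le> real N powr \<delta>"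
    by (auto simp: eventually_sequentially)
  define l where "l = ln (real N)"
  have N30: "30 \<le> real N" using N(1) by simp
  have N1: "1 \<le> real N" "0 < real N" using N30 by auto
  define R where "R = real N powr (\<theta>0 / 2)"
  define D where "D = real N powr \<delta>"
  define z where "z = real N powr \<zeta>"
  have lnR: "ln R = \<theta>0 / 2 * ln (real N)" and lnD: "ln D = \<delta> * ln (real N)" and lnz: "ln z = \<zeta> * ln (real N)"
    using N1 by (simp_all add: R_def D_def z_def ln_powr)
  have R1: "1 \<le> R" and D1: "1 \<le> D" and z1: "1 \<le> z"
    unfolding R_def D_def z_def using N1 num(2) \<delta>(1) \<zeta> by (auto intro!: ge_one_powr_ge_zero)
  have powle: "real N powr t \<le> real N powr t'" if "t \<le> t'" for t t' using that N1 by (intro powr_mono) auto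
  have RN: "R \<le> real N" and DN: "D \<le> real N"
    using powle[of "\<theta>0 / 2" 1] powle[of \<delta> 1] num \<delta> N1 by (auto simp: R_def D_def)
  define P where "P = {p::nat. prime p \<and> d < p \<and> real p \<le> R}"
  interpret S: sieve_setup "card Hs" d Q R D BB P Hs c v N
  proof
    show "2 \<le> card Hs" "card Hs \<le> 7" by (rule K)+
    show "100000 \<le> d" by (simp add: d_def)
    show "P = {p. prime p \<and> d < p \<and> real p \<le> R}" by (rule P_def)
    show "Q = \<Prod>{p. prime p \<and> p \<le> d}" by (rule Q_def)
    show "1 \<le> R" "1 \<le> D" by (rule R1, rule D1)
    show "(\<Sum>p\<in>{p. prime p \<and> p \<le> n}. ln (real p)) \<le> BB * real n" if "1 \<le> n" for n by (rule BB(2)[OF that])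
    show "0 \<le> BB" by (rule BB(1))
    show "card Hs = card Hs" ..
    show "c \<notin> Hs" by (rule c)
    show "h \<le> d" if "h \<in> insert c Hs" for h using small[OF that] by (simp add: d_def)
    show "v < Q" by (rule v(1))
    show "coprime (v + h) Q" if "h \<in> insert c Hs" for h by (rule v(2)[OF that])
    show "R \<le> real N" "D \<le> real N" by (rule RN, rule DN)
    show "1 \<le> ln (real N)" using N(2) by simp
  qed
  have SCC: "S.CC = CC" by (simp add: S.CC_def CC_def)
  have SV: "S.V = V" by (simp add: S.V_def V_def)
  have L2: "S.L\<^sup>2 = real N powr (\<theta>0 + 2 * \<delta>)"
  proof -
    have "R * D = real N powr (\<theta>0 / 2 + \<delta>)" unfolding R_def D_def by (simp only: powr_add)
    then have "(R * D)\<^sup>2 = real N powr ((\<theta>0 / 2 + \<delta>) + (\<theta>0 / 2 + \<delta>))" by (simp only: power2_eq_square powr_add)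
    also have "(\<theta>0 / 2 + \<delta>) + (\<theta>0 / 2 + \<delta>) = \<theta>0 + 2 * \<delta>" by simp
    finally show ?thesis unfolding S.L_def .
  qed
  have QL: "real Q * S.L\<^sup>2 \<le> real N powr (\<theta>0 + 3 * \<delta>)"
  proof -
    have "real Q * S.L\<^sup>2 \<le> real N powr \<delta> * real N powr (\<theta>0 + 2 * \<delta>)"
      unfolding L2 using N(10) by (intro mult_right_mono) auto
    also have "\<dots> = real N powr (\<theta>0 + 3 * \<delta>)" by (simp add: powr_add[symmetric] algebra_simps)
    finally show ?thesis .
  qed
  have QL1: "real Q * S.L\<^sup>2 \<le> real N"
    using QL powle[of "\<theta>0 + 3 * \<delta>" 1] \<delta> N1 by simp
  have QL2: "real Q * S.L\<^sup>2 \<le> real N powr (\<theta> - \<delta>)"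
    using QL powle[of "\<theta>0 + 3 * \<delta>" "\<theta> - \<delta>"] \<delta> by simp
  have t0: "0 \<le> \<theta> - \<delta>" using \<delta> num(2) by linarith
  have QL3: "real Q * S.L\<^sup>2 \<le> (3 * real N) powr (\<theta> - \<delta>)"
  proof -
    have "real N powr (\<theta> - \<delta>) \<le> (3 * real N) powr (\<theta> - \<delta>)" using t0 by (intro powr_mono2) auto
    then show ?thesis using QL2 by linarith
  qed
  have hN: "h \<le> N" if "h \<in> insert c Hs" for h using small[OF that] N(1) by simp
  have ln3: "ln (3 * real N) \<le> 1.02 * ln (real N)"
  proof -
    have "ln (3 * real N) = ln 3 + ln (real N)" using N1 by (simp add: ln_mult)
    moreover have "ln (3::real) \<le> 2" using ln_le_minus_one[of 3] by simp
    ultimately show ?thesis using N(2) by simp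
  qed
  have N2: "3 * real N \<le> real N powr 2"
  proof -
    have "3 * real N \<le> real N * real N" using N30 by (intro mult_right_mono) auto
    then show ?thesis using N1 by (simp add: power2_eq_square)
  qed
  show False
  proof (rule S.contradiction[where z = z and \<rho> = "\<theta>0 / 2"])
    show "10000 * (BB + 1) \<le> ln R" "10000 * (real Q + 1) / S.V \<le> ln R" "4 * BB \<le> ln D" "BB \<le> ln z" "1 \<le> z"
      using N(3-6) z1 by (simp_all add: lnR lnD lnz SV)
    show "1000 * ln z \<le> ln D" by (simp add: lnz lnD \<zeta>_def)
    show "0 < ln D" using \<delta>(1) N(2) by (simp add: lnD)
    show "ln R = \<theta>0 / 2 * ln (real N)" by (rule lnR)
    show "0.538 * (real (card Hs) + 3) \<le> 2.98 * real (card Hs) * (\<theta>0 / 2)" by (rule num(1))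
    show "ln (3 * real N) \<le> 1.02 * ln (real N)" by (rule ln3)
    show "1000 * real Q \<le> (ln R * ln D)\<^sup>2"
    proof -
      have "1000 * real Q \<le> (\<theta>0 / 2 * \<delta>)\<^sup>2 * l" using N(9) by (simp add: l_def)
      also have "\<dots> \<le> (\<theta>0 / 2 * \<delta>)\<^sup>2 * l ^ 4"
      proof (rule mult_left_mono)
        show "l \<le> l ^ 4" using N(2) power_increasing[of 1 4 l] by (simp add: l_def)
      qed simp
      also have "\<dots> = (ln R * ln D)\<^sup>2"
      proof -
        have "ln R * ln D = (\<theta>0 / 2 * \<delta>) * l\<^sup>2" unfolding lnR lnD l_def[symmetric] by (simp add: power2_eq_square)
        then have "(ln R * ln D)\<^sup>2 = (\<theta>0 / 2 * \<delta>)\<^sup>2 * (l\<^sup>2)\<^sup>2" by (simp only: power_mult_distrib)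
        also have "(l\<^sup>2)\<^sup>2 = l ^ 4" by (simp flip: power_mult)
        finally show ?thesis ..
      qed
      finally show ?thesis .
    qed
    show "\<bar>\<Sum>n\<in>S.I. liouville (n + c) * (S.f n)\<^sup>2\<bar> \<le> real N"
    proof (rule S.liouville_sum_le[OF QL1 QL3])
      show "c \<le> N" using hN by simp
      show "(\<Sum>q\<in>{q::nat. 1 \<le> q \<and> real q \<le> (3 * real N) powr (\<theta> - \<delta>)}. EB (3 * real N) q)
        \<le> kb * (3 * real N) / ln (3 * real N) powr real (2 * S.CC\<^sup>2 + 18)"
        using kb[of "3 * real N"] N30 unfolding SCC j_def by simp
      show "15360 * 2 ^ (2 * S.CC\<^sup>2) * (6 * \<bar>kb\<bar>) \<le> ln (real N)" unfolding SCC by (rule N(8))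
    qed
    show "\<bar>(\<Sum>n\<in>S.I. (if prime (n + h) then ln (real (n + h)) else 0) * (S.f n)\<^sup>2)
        - real N / real (totient Q) * S.M1\<bar> \<le> real N" if h: "h \<in> Hs" for h
    proof (rule S.prime_sum_le[OF h QL1 QL2 t0 _ ln3])
      show "h \<le> N" using hN h by simp
      show "15360 * 2 ^ (2 * S.CC\<^sup>2) * (6 * \<bar>ka\<bar>) \<le> ln (real N)" unfolding SCC by (rule N(7))
      fix x assume "real N \<le> x"
      then have "2 \<le> x" using N30 by linarith
      from ka[OF this] show "(\<Sum>q\<in>{q::nat. 1 \<le> q \<and> real q \<le> x powr (\<theta> - \<delta>)}. EA x q)
        \<le> ka * x / ln x powr real (2 * S.CC\<^sup>2 + 18)" unfolding SCC j_def .
    qed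
    show "z * (S.Ym\<^sup>2 * (\<Sum>W\<in>{W\<in>Pow P. pr W \<le> S.L\<^sup>2}. real S.CC ^ card W * 2)) \<le> real N"
    proof -
      have L1: "1 \<le> S.L\<^sup>2" using S.L_ge_1 by simp
      have lL: "1 + ln (S.L\<^sup>2) \<le> 2 * l"
      proof -
        have "S.L\<^sup>2 \<le> real N" by (rule S.L2_le[OF QL1])
        then have "ln (S.L\<^sup>2) \<le> l" unfolding l_def using L1 N1 by (subst ln_le_cancel_iff) auto
        then show ?thesis using N(2) by (simp add: l_def)
      qed
      have l0: "0 \<le> l" using N(2) by (simp add: l_def)
      have "(\<Sum>W\<in>{W\<in>Pow P. pr W \<le> S.L\<^sup>2}. real S.CC ^ card W * 2) = 2 * (\<Sum>W\<in>{W\<in>Pow P. pr W \<le> S.L\<^sup>2}. real CC ^ card W)"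
        unfolding SCC by (simp add: sum_distrib_left mult.commute)
      also have "\<dots> \<le> 2 * (S.L\<^sup>2 * (1 + ln (S.L\<^sup>2)) ^ CC)"
        using L1 S.P_prime by (intro mult_left_mono sum_card_power_le) auto
      also have "\<dots> \<le> 2 * (S.L\<^sup>2 * (2 * l) ^ CC)"
        using lL L1 by (intro mult_left_mono power_mono) auto
      finally have "z * (S.Ym\<^sup>2 * (\<Sum>W\<in>{W\<in>Pow P. pr W \<le> S.L\<^sup>2}. real S.CC ^ card W * 2))
         \<le> z * (S.Ym\<^sup>2 * (2 * (S.L\<^sup>2 * (2 * l) ^ CC)))"
        using z1 by (intro mult_left_mono) auto
      also have "\<dots> = (32 * 2 ^ CC * l ^ (8 + CC)) * (z * S.L\<^sup>2)"
        by (simp add: S.Ym_def l_def[symmetric] power_mult_distrib power_mult[symmetric] power_add mult_ac)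
      also have "\<dots> \<le> real N powr \<delta> * (z * S.L\<^sup>2)"
        using N(11) z1 by (intro mult_right_mono) (auto simp: l_def)
      also have "\<dots> = real N powr (\<delta> + (\<zeta> + (\<theta>0 + 2 * \<delta>)))"
        unfolding L2 z_def by (simp only: powr_add[symmetric])
      also have "\<dots> \<le> real N powr 1" using \<delta> by (intro powle) (simp add: \<zeta>_def)
      also have "\<dots> = real N" using N1 by simp
      finally show ?thesis .
    qed
    show "(\<Sum>h\<in>Hs. if prime (n + h) then ln (real (n + h)) else 0)
        \<le> ln (3 * real N) * ((1 + liouville (n + c)) / 2 + real (card {p\<in>{p\<in>P. real p \<le> z}. p dvd n + c}))"
      if n: "n \<in> S.I" for n
    proof (rule S.pointwise[OF _ width _ hN _ n])
      show "D5 < p' - p" if "prime p" "prime p'" "N \<le> p" "p < p'" for p p'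
        using n1[OF that(1,2) _ that(4)] that(3) N(1) by simp
      show "z \<le> R"
      proof -
        have "\<delta> \<le> 1" using \<delta> num by simp
        moreover have "1 / 2 \<le> \<theta>0" by (rule num(2))
        ultimately show ?thesis unfolding z_def R_def by (intro powle) (simp add: \<zeta>_def)
      qed
      fix h n assume h: "h \<in> Hs" and nn: "N < n" "n \<le> 2 * N" "prime (n + h)" and lp: "z < real (least_pf (n + c))"
      show "even (bigOmega (n + c))"
      proof (rule ccontr)
        assume odd: "odd (bigOmega (n + c))"
        have h26: "h \<le> 26" "c \<le> 26" using small h by auto
        have eq: "int (n + h) + (int c - int h) = int (n + c)" by simp
        have nat_eq: "nat (int (n + h) + (int c - int h)) = n + c" unfolding eq by (rule nat_int)
        have le3: "real (n + h) \<le> 3 * real N" "real (n + c) \<le> 3 * real N" using nn h26 N30 N(1) by linarith+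
        \<comment> \<open>The exponent is halved because roughness is measured against n + h, which
          may be as large as 3N, at most N^2.\<close>
        have pw: "real (n + h) powr (\<zeta> / 2) \<le> z"
        proof -
          have "real (n + h) powr (\<zeta> / 2) \<le> (real N powr 2) powr (\<zeta> / 2)"
            using le3 N2 \<zeta> by (intro powr_mono2) auto
          also have "\<dots> = real N powr (2 * (\<zeta> / 2))" by (rule powr_powr)
          also have "\<dots> = z" by (simp add: z_def)
          finally show ?thesis .
        qed
        \<comment> \<open>All prime factors exceed z, and n + c is at most N^2, so their number is
          at most 2/\<zeta>, independently of N.\<close>
        have om: "real (bigOmega (n + c)) \<le> 2 / \<zeta>"
        proof -
          have "z ^ bigOmega (n + c) \<le> real (\<Prod>\<^sub># (prime_factorization (n + c)))"
            unfolding bigOmega_def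
          proof (rule power_size_le_prod_mset)
            fix q assume q: "q \<in># prime_factorization (n + c)"
            then have "least_pf (n + c) \<le> q" unfolding least_pf_def by (intro Min_le) auto
            then show "z \<le> real q" using lp by linarith
          qed (use z1 in simp)
          also have "\<dots> = real (n + c)" using nn by (subst prod_mset_prime_factorization_nat) auto
          also have "\<dots> \<le> real N powr 2" using le3 N2 by linarith
          finally have le: "z ^ bigOmega (n + c) \<le> real N powr 2" .
          have "z ^ bigOmega (n + c) = z powr real (bigOmega (n + c))"
            using z1 by (intro powr_realpow[symmetric]) simp
          also have "\<dots> = real N powr (\<zeta> * real (bigOmega (n + c)))" unfolding z_def by (rule powr_powr)
          finally have "real N powr (\<zeta> * real (bigOmega (n + c))) \<le> real N powr 2" using le by simp
          moreover have "1 < real N" using N30 by simp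
          ultimately have "\<zeta> * real (bigOmega (n + c)) \<le> 2" by (simp only: powr_le_cancel_iff)
          then show ?thesis using \<zeta> by (simp add: field_simps)
        qed
        have "n + h \<in> bset (\<zeta> / 2) (bigOmega (n + c)) (int c - int h)"
          unfolding bset_def mem_Collect_eq nat_eq using nn lp pw N(1) by (simp add: eq)
        then have "n + h \<in> Bad" unfolding Bad_def using odd om h by auto
        then have "n + h < n2" by (rule n2)
        then show False using nn N(1) by simp
      qed
    qed
  qed
qed

theorem theorem8:
  fixes \<theta>0 \<theta> :: real and D6 D5 :: nat
  assumes triple: "(\<theta>0, D6, D5) \<in> {(0.924, 4, 6), (0.739, 6, 8), (0.643, 6, 12),
                                   (0.584, 10, 16), (0.544, 12, 20), (0.516, 14, 26)}"
    and gt: "\<theta> > \<theta>0"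
    and A: "condA \<theta>"
    and B: "condB \<theta>"
  shows "(\<exists>C::real. \<exists>c::real. c > 0 \<and> (\<exists>b::nat. \<exists>d::int. odd b \<and> real b \<le> C \<and> even d \<and>
            0 < \<bar>d\<bar> \<and> \<bar>d\<bar> \<le> int D6 \<and>
            infinite {p::nat. prime p \<and> int p + d > 1 \<and>
                        real (least_pf (nat (int p + d))) > real p powr c \<and>
                        bigOmega (nat (int p + d)) = b}))
         \<or> Liminf sequentially (\<lambda>n. ereal (real (nth_prime (Suc n)) - real (nth_prime n)))
             \<le> ereal (real D5)"
proof -
  \<comment> \<open>The tuples below are differences of consecutive primes, 11, 13, 17, ... or, for
    the fourth, 97, 101, ..., 113. Their least prime as \<open>r0\<close> makes every r0 + h a prime
    above 7, hence coprime to 210. The centre is chosen within distance D6 of all other members,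
    while the remaining members span D5.\<close>
  have cop: "coprime (r0 + h) (210::nat)" if "gcd (r0 + h) 210 = 1" for r0 h :: nat
    using that by (simp only: coprime_iff_gcd_eq_1)
  note core = sieve_core[OF _ _ _ _ _ _ _ _ _ _ gt A B]
  consider "\<theta>0 = 0.924" "D6 = 4" "D5 = 6" | "\<theta>0 = 0.739" "D6 = 6" "D5 = 8" | "\<theta>0 = 0.643" "D6 = 6" "D5 = 12"
    | "\<theta>0 = 0.584" "D6 = 10" "D5 = 16" | "\<theta>0 = 0.544" "D6 = 12" "D5 = 20" | "\<theta>0 = 0.516" "D6 = 14" "D5 = 26"
    using triple by auto
  then show ?thesis
  proof cases
    case 1
    show ?thesis
      by (rule core[where Hs = "{0, 6}" and c = 2 and ?r0.0 = 11]) (use 1 in \<open>auto intro!: cop simp: gcd_non_0_nat\<close>)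
  next
    case 2
    show ?thesis
      by (rule core[where Hs = "{0, 6, 8}" and c = 2 and ?r0.0 = 11]) (use 2 in \<open>auto intro!: cop simp: gcd_non_0_nat\<close>)
  next
    case 3
    show ?thesis
      by (rule core[where Hs = "{0, 2, 8, 12}" and c = 6 and ?r0.0 = 11]) (use 3 in \<open>auto intro!: cop simp: gcd_non_0_nat\<close>)
  next
    case 4
    show ?thesis
      by (rule core[where Hs = "{0, 4, 10, 12, 16}" and c = 6 and ?r0.0 = 97]) (use 4 in \<open>auto intro!: cop simp: gcd_non_0_nat\<close>)
  next
    case 5
    show ?thesis
      by (rule core[where Hs = "{0, 2, 6, 12, 18, 20}" and c = 8 and ?r0.0 = 11]) (use 5 in \<open>auto intro!: cop simp: gcd_non_0_nat\<close>)
  next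
    case 6
    show ?thesis
      by (rule core[where Hs = "{0, 2, 6, 8, 18, 20, 26}" and c = 12 and ?r0.0 = 11]) (use 6 in \<open>auto intro!: cop simp: gcd_non_0_nat\<close>)
  qed
qed

end
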